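(* Let $\Omega\subset\mathbb R^n$ be a bounded domain with $C^{m+2,\alpha}$ boundary, $m\in\mathbb N_0$, $0<\alpha<1$, $\phi\in C^{m+2,\alpha}(\partial\Omega)$, and let $a\in C^{2m+1,\alpha}(\overline\Omega\times\mathbb R\times\mathbb R^n)$ be positive. Let $\Phi\in C^{m+2,\alpha}(\overline\Omega)$ be a strictly convex solution of $\det D^2\Phi=a(x,\Phi,\nabla\Phi)$ in $\Omega$, $\Phi=\phi$ on $\partial\Omega$, with $D^2\Phi\ge c_0I_n$ in $\overline\Omega$ for some $c_0>0$ and $\partial_za(x,\Phi,\nabla\Phi)\ge0$. For $\eta$ near $\phi$ let $u_\eta$ be the solution near $\Phi$ of the Monge--Ampère problem with boundary value $\eta$, and for $h\in C^{m+2,\alpha}(\partial\Omega)$ let $v_h\in C^{m+2,\alpha}(\overline\Omega)$ be the unique solution of $L_\Phi v_h=0$ in $\Omega$, $v_h=h$ on $\partial\Omega$ (see context). Then for every $h\in C^{m+2,\alpha}(\partial\Omega)$, as $t\to0$, $$u_{\phi+th}=\Phi+t\,v_h+o(t)\quad\text{in }C^{m+2,\alpha}(\overline\Omega),$$ and consequently $$\partial_\nu u_{\phi+th}=\partial_\nu\Phi+t\,\partial_\nu v_h+o(t)\quad\text{in }C^{m+1,\alpha}(\partial\Omega).$$ In particular, the first variation of the nonlinear Cauchy data set $\mathscr C_a^{(\phi,\partial_\nu\Phi|_{\partial\Omega})}$ at $(\phi,\partial_\nu\Phi|_{\partial\Omega})$, i.e. the set of all $\frac{d}{dt}\big|_{t=0}(\phi+th,\partial_\nu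 u_{\phi+th}|_{\partial\Omega})$ with $h\in C^{m+2,\alpha}(\partial\Omega)$, coincides with the Cauchy data set of $L_\Phi$, $$\mathscr C^{\mathrm{lin}}_{a,\Phi}=\{(\eta,\partial_\nu v_\eta|_{\partial\Omega}):\eta\in C^{m+2,\alpha}(\partial\Omega)\}\subset C^{m+2,\alpha}(\partial\Omega)\times C^{m+1,\alpha}(\partial\Omega).$$
   Context: The nonlinearity is $a=a(x,z,p)$, $x\in\overline\Omega$, $z\in\mathbb R$, $p\in\mathbb R^n$. $C^{k,\alpha}(\overline\Omega)$ is the usual Hölder space (norms required finite on unbounded sets); $C^{k,\alpha}(\partial\Omega)$ carries the quotient norm over extensions to $C^{k,\alpha}(\overline\Omega)$. $\nu$ is the exterior unit normal of $\partial\Omega$ and $\partial_\nu$ the normal derivative. Local solutions: under the stated assumptions, local well-posedness provides $\delta>0$ and a neighbourhood $V$ of $\Phi$ in $C^{m+2,\alpha}(\overline\Omega)$ such that for every $\eta\in C^{m+2,\alpha}(\partial\Omega)$ with $\|\eta-\phi\|_{C^{m+2,\alpha}(\partial\Omega)}<\delta$ the problem $\det D^2u=a(x,u,\nabla u)$ in $\Omega$, $u=\eta$ on $\partial\Omega$ has a unique solution $u_\eta\in V$, and $\mathcal S:\eta\mapsto u_\eta$ is of class $C^{m+1}$ (Fréchet) near $\phi$ with $\mathcal S(\phi)=\Phi$. The nonlinear Cauchy data set is $$\mathscr C_a^{(\phi,\partial_\nu\Phi|_{\partial\Omega})}=\{(\eta,\partial_\nu u_\eta|_{\partial\Omega}):\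 \eta\in C^{m+2,\alpha}(\partial\Omega),\ \|\eta-\phi\|_{C^{m+2,\alpha}(\partial\Omega)}<\delta\}.$$ Linearized operator: $L_\Phi v=\operatorname{tr}(\mathcal C_\Phi D^2v)-b_\Phi\cdot\nabla v-q_\Phi v$, with $\mathcal C_\Phi=\operatorname{cof}D^2\Phi$ (cofactor matrix of the Hessian), $b_\Phi=\nabla_pa(x,\Phi,\nabla\Phi)$, $q_\Phi=\partial_za(x,\Phi,\nabla\Phi)$. *)

theory Defs
  imports "HOL-Analysis.Analysis"
begin

section \<open>Hoelder spaces on the closure of an open set\<close>

text \<open>
  For an open set \<open>U\<close> the functions of \<open>C\<^sup>k(closure U)\<close> are total functions of which only the
  values on \<open>closure U\<close> matter. A partial derivative at a boundary point is the limit of the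
  derivatives at interior points.
\<close>

definition pd :: "'a::euclidean_space set \<Rightarrow> 'a \<Rightarrow> ('a \<Rightarrow> real) \<Rightarrow> 'a \<Rightarrow> real" where
  "pd U b f x = (if x \<in> U then frechet_derivative f (at x) b
                 else Lim (at x within U) (\<lambda>y. frechet_derivative f (at y) b))"

primrec pds :: "'a::euclidean_space set \<Rightarrow> 'a list \<Rightarrow> ('a \<Rightarrow> real) \<Rightarrow> 'a \<Rightarrow> real" where
  "pds U [] f = f"
| "pds U (b # bs) f = pd U b (pds U bs f)"

definition dirs :: "nat \<Rightarrow> 'a::euclidean_space list set" where
  "dirs j = {bs. set bs \<subseteq> Basis \<and> length bs = j}"

text \<open>
  Continuity of the extended derivatives on \<open>closure U\<close> says that the limits in \<^const>\<open>pd\<close> exist.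
  Boundedness is required separately since \<open>U\<close> may be unbounded.
\<close>

definition holder_on :: "'a::euclidean_space set \<Rightarrow> nat \<Rightarrow> real \<Rightarrow> ('a \<Rightarrow> real) \<Rightarrow> bool" where
  "holder_on U k \<alpha> f \<longleftrightarrow>
     (\<forall>j<k. \<forall>bs\<in>dirs j. \<forall>x\<in>U. pds U bs f differentiable (at x)) \<and>
     (\<forall>j\<le>k. \<forall>bs\<in>dirs j. continuous_on (closure U) (pds U bs f) \<and>
                          bounded (pds U bs f ` closure U)) \<and>
     (\<forall>bs\<in>dirs k. \<exists>C. \<forall>x\<in>closure U. \<forall>y\<in>closure U.
                          \<bar>pds U bs f x - pds U bs f y\<bar> \<le> C * dist x y powr \<alpha>)"

text \<open>
  Functions on \<open>closure U\<close> are represented by their extension by zero, so that equality of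
  elements of the space is equality on \<open>closure U\<close>, and the space is a linear space under the
  pointwise operations.
\<close>

definition holder_space :: "'a::euclidean_space set \<Rightarrow> nat \<Rightarrow> real \<Rightarrow> ('a \<Rightarrow> real) set" where
  "holder_space U k \<alpha> = {f. holder_on U k \<alpha> f \<and> (\<forall>x. x \<notin> closure U \<longrightarrow> f x = 0)}"

definition holder_norm :: "'a::euclidean_space set \<Rightarrow> nat \<Rightarrow> real \<Rightarrow> ('a \<Rightarrow> real) \<Rightarrow> real" where
  "holder_norm U k \<alpha> f =
     (\<Sum>j\<le>k. SUP (bs, x) \<in> dirs j \<times> closure U. \<bar>pds U bs f x\<bar>) +
     (SUP (bs, x, y) \<in> {(bs, x, y). bs \<in> dirs k \<and> x \<in> closure U \<and> y \<in> closure U \<and> x \<noteq> y}.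
        \<bar>pds U bs f x - pds U bs f y\<bar> / dist x y powr \<alpha>)"

text \<open>Functions on the boundary, extended by zero, with the quotient norm over extensions.\<close>

definition bdry_space :: "'a::euclidean_space set \<Rightarrow> nat \<Rightarrow> real \<Rightarrow> ('a \<Rightarrow> real) set" where
  "bdry_space U k \<alpha> =
     {f. (\<exists>F\<in>holder_space U k \<alpha>. \<forall>x\<in>frontier U. F x = f x) \<and> (\<forall>x. x \<notin> frontier U \<longrightarrow> f x = 0)}"

definition bdry_norm :: "'a::euclidean_space set \<Rightarrow> nat \<Rightarrow> real \<Rightarrow> ('a \<Rightarrow> real) \<Rightarrow> real" where
  "bdry_norm U k \<alpha> f =
     (INF F \<in> {F \<in> holder_space U k \<alpha>. \<forall>x\<in>frontier U. F x = f x}. holder_norm U k \<alpha> F)"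


section \<open>Domains with Hoelder boundary, the exterior normal\<close>

text \<open>
  Near each boundary point a diffeomorphism \<open>\<psi>\<close> of class \<open>C\<^sup>k\<^sup>,\<^sup>\<alpha>\<close> with inverse \<open>\<kappa>\<close>
  of class \<open>C\<^sup>k\<^sup>,\<^sup>\<alpha>\<close> flattens the boundary.
\<close>

definition holder_boundary :: "(real^'n) set \<Rightarrow> nat \<Rightarrow> real \<Rightarrow> bool" where
  "holder_boundary \<Omega> k \<alpha> \<longleftrightarrow>
     (\<forall>x0\<in>frontier \<Omega>. \<exists>r>0. \<exists>(\<psi> :: real^'n \<Rightarrow> real^'n) (\<kappa> :: real^'n \<Rightarrow> real^'n) (i :: 'n).
        let B = ball x0 r; D = \<psi> ` B in
          open D \<and> (\<forall>x\<in>B. \<kappa> (\<psi> x) = x) \<and>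
          (\<forall>j. holder_on B k \<alpha> (\<lambda>x. \<psi> x $ j)) \<and>
          (\<forall>j. holder_on D k \<alpha> (\<lambda>y. \<kappa> y $ j)) \<and>
          \<psi> ` (B \<inter> \<Omega>) = D \<inter> {y. y $ i > 0} \<and>
          \<psi> ` (B \<inter> frontier \<Omega>) = D \<inter> {y. y $ i = 0})"

text \<open>
  The first limit says that \<open>\<nu>\<close> is orthogonal to the tangent space of the boundary at \<open>x\<close>.
\<close>

definition is_outer_normal :: "(real^'n) set \<Rightarrow> real^'n \<Rightarrow> real^'n \<Rightarrow> bool" where
  "is_outer_normal \<Omega> x \<nu> \<longleftrightarrow>
     norm \<nu> = 1 \<and>
     ((\<lambda>y. (\<nu> \<bullet> (y - x)) / norm (y - x)) \<longlongrightarrow> 0) (at x within frontier \<Omega>) \<and>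
     (\<forall>\<^sub>F t in at_right 0. x - t *\<^sub>R \<nu> \<in> \<Omega> \<and> x + t *\<^sub>R \<nu> \<notin> closure \<Omega>)"

definition outer_normal :: "(real^'n) set \<Rightarrow> real^'n \<Rightarrow> real^'n" where
  "outer_normal \<Omega> x = (THE \<nu>. is_outer_normal \<Omega> x \<nu>)"


section \<open>Gradient, Hessian and normal derivative\<close>

definition grad :: "(real^'n) set \<Rightarrow> (real^'n \<Rightarrow> real) \<Rightarrow> real^'n \<Rightarrow> real^'n" where
  "grad \<Omega> u x = (\<chi> i. pds \<Omega> [axis i 1] u x)"

definition hess :: "(real^'n) set \<Rightarrow> (real^'n \<Rightarrow> real) \<Rightarrow> real^'n \<Rightarrow> real^'n^'n" where
  "hess \<Omega> u x = (\<chi> i j. pds \<Omega> [axis i 1, axis j 1] u x)"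

definition normal_deriv :: "(real^'n) set \<Rightarrow> (real^'n \<Rightarrow> real) \<Rightarrow> real^'n \<Rightarrow> real" where
  "normal_deriv \<Omega> u x = (if x \<in> frontier \<Omega> then outer_normal \<Omega> x \<bullet> grad \<Omega> u x else 0)"

text \<open>
  Replacing row \<open>i\<close> and column \<open>j\<close> by unit vectors leaves the signed \<open>(i, j)\<close> minor.
\<close>

definition cof :: "real^'n^'n \<Rightarrow> real^'n^'n" where
  "cof A = (\<chi> i j. det (\<chi> k l. if k = i \<and> l = j then 1
                               else if k = i \<or> l = j then 0 else A $ k $ l))"

text \<open>The open set \<open>\<Omega>\<close> need not be convex: only segments inside \<open>\<Omega>\<close> are considered.\<close>

definition strictly_convex_fun :: "'a::real_vector set \<Rightarrow> ('a \<Rightarrow> real) \<Rightarrow> bool" where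
  "strictly_convex_fun \<Omega> f \<longleftrightarrow>
     (\<forall>x y s. x \<noteq> y \<and> closed_segment x y \<subseteq> \<Omega> \<and> 0 < s \<and> s < 1 \<longrightarrow>
        f ((1 - s) *\<^sub>R x + s *\<^sub>R y) < (1 - s) * f x + s * f y)"


section \<open>The Dirichlet problems\<close>

text \<open>The nonlinearity is \<open>a (x, z, p)\<close>, with \<open>(x, z, p)\<close> in the closure of \<open>jets \<Omega>\<close>.\<close>

abbreviation jets :: "(real^'n) set \<Rightarrow> ((real^'n) \<times> real \<times> (real^'n)) set" where
  "jets \<Omega> \<equiv> \<Omega> \<times> UNIV \<times> UNIV"

definition MA_solution ::
  "(real^'n) set \<Rightarrow> nat \<Rightarrow> real \<Rightarrow> ((real^'n) \<times> real \<times> (real^'n) \<Rightarrow> real) \<Rightarrow>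
   (real^'n \<Rightarrow> real) \<Rightarrow> (real^'n \<Rightarrow> real) \<Rightarrow> bool" where
  "MA_solution \<Omega> m \<alpha> a \<eta> u \<longleftrightarrow>
     u \<in> holder_space \<Omega> (m + 2) \<alpha> \<and>
     (\<forall>x\<in>\<Omega>. det (hess \<Omega> u x) = a (x, u x, grad \<Omega> u x)) \<and>
     (\<forall>x\<in>frontier \<Omega>. u x = \<eta> x)"

definition q_coeff ::
  "(real^'n) set \<Rightarrow> ((real^'n) \<times> real \<times> (real^'n) \<Rightarrow> real) \<Rightarrow> (real^'n \<Rightarrow> real) \<Rightarrow> real^'n \<Rightarrow> real" where
  "q_coeff \<Omega> a \<Phi> x = pd (jets \<Omega>) (0, 1, 0) a (x, \<Phi> x, grad \<Omega> \<Phi> x)"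

definition b_coeff ::
  "(real^'n) set \<Rightarrow> ((real^'n) \<times> real \<times> (real^'n) \<Rightarrow> real) \<Rightarrow> (real^'n \<Rightarrow> real) \<Rightarrow> real^'n \<Rightarrow> real^'n" where
  "b_coeff \<Omega> a \<Phi> x = (\<chi> i. pd (jets \<Omega>) (0, 0, axis i 1) a (x, \<Phi> x, grad \<Omega> \<Phi> x))"

definition lin_op ::
  "(real^'n) set \<Rightarrow> ((real^'n) \<times> real \<times> (real^'n) \<Rightarrow> real) \<Rightarrow> (real^'n \<Rightarrow> real) \<Rightarrow>
   (real^'n \<Rightarrow> real) \<Rightarrow> real^'n \<Rightarrow> real" where
  "lin_op \<Omega> a \<Phi> v x = trace (cof (hess \<Omega> \<Phi> x) ** hess \<Omega> v x)
     - b_coeff \<Omega> a \<Phi> x \<bullet> grad \<Omega> v x - q_coeff \<Omega> a \<Phi> x * v x"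

definition lin_solution ::
  "(real^'n) set \<Rightarrow> nat \<Rightarrow> real \<Rightarrow> ((real^'n) \<times> real \<times> (real^'n) \<Rightarrow> real) \<Rightarrow> (real^'n \<Rightarrow> real) \<Rightarrow>
   (real^'n \<Rightarrow> real) \<Rightarrow> (real^'n \<Rightarrow> real) \<Rightarrow> bool" where
  "lin_solution \<Omega> m \<alpha> a \<Phi> h v \<longleftrightarrow>
     v \<in> holder_space \<Omega> (m + 2) \<alpha> \<and>
     (\<forall>x\<in>\<Omega>. lin_op \<Omega> a \<Phi> v x = 0) \<and>
     (\<forall>x\<in>frontier \<Omega>. v x = h x)"

definition lin_sol ::
  "(real^'n) set \<Rightarrow> nat \<Rightarrow> real \<Rightarrow> ((real^'n) \<times> real \<times> (real^'n) \<Rightarrow> real) \<Rightarrow> (real^'n \<Rightarrow> real) \<Rightarrow>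
   (real^'n \<Rightarrow> real) \<Rightarrow> real^'n \<Rightarrow> real" where
  "lin_sol \<Omega> m \<alpha> a \<Phi> h = (THE v. lin_solution \<Omega> m \<alpha> a \<Phi> h v)"


section \<open>Differentiability between normed spaces of functions\<close>

text \<open>
  \<open>X\<close>, \<open>Y\<close> are linear spaces of functions normed by \<open>nX\<close>, \<open>nY\<close>. The \<open>j\<close>-th derivative at
  \<open>\<eta>\<close>, an element of \<open>L(X, L(X, \<dots>, Y))\<close>, is represented by the \<open>j\<close>-linear map
  \<open>D \<eta>\<close> on lists of length \<open>j\<close>; the list head is the direction differentiated last.
\<close>

definition bounded_multilinear ::
  "nat \<Rightarrow> ('a \<Rightarrow> real) set \<Rightarrow> (('a \<Rightarrow> real) \<Rightarrow> real) \<Rightarrow> ('b \<Rightarrow> real) set \<Rightarrow> (('b \<Rightarrow> real) \<Rightarrow> real) \<Rightarrow>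
   (('a \<Rightarrow> real) list \<Rightarrow> 'b \<Rightarrow> real) \<Rightarrow> bool" where
  "bounded_multilinear j X nX Y nY T \<longleftrightarrow>
     (\<forall>hs. set hs \<subseteq> X \<and> length hs = j \<longrightarrow> T hs \<in> Y) \<and>
     (\<forall>hs i f g c. set hs \<subseteq> X \<and> length hs = j \<and> i < j \<and> f \<in> X \<and> g \<in> X \<longrightarrow>
        T (hs[i := (\<lambda>x. f x + c * g x)]) = (\<lambda>y. T (hs[i := f]) y + c * T (hs[i := g]) y)) \<and>
     (\<exists>C. \<forall>hs. set hs \<subseteq> X \<and> length hs = j \<longrightarrow> nY (T hs) \<le> C * prod_list (map nX hs))"

definition frechet_class ::
  "nat \<Rightarrow> ('a \<Rightarrow> real) set \<Rightarrow> (('a \<Rightarrow> real) \<Rightarrow> real) \<Rightarrow> ('b \<Rightarrow> real) set \<Rightarrow> (('b \<Rightarrow> real) \<Rightarrow> real) \<Rightarrow>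
   ('a \<Rightarrow> real) set \<Rightarrow> (('a \<Rightarrow> real) \<Rightarrow> 'b \<Rightarrow> real) \<Rightarrow> bool" where
  "frechet_class k X nX Y nY W S \<longleftrightarrow>
     (\<exists>D :: ('a \<Rightarrow> real) \<Rightarrow> ('a \<Rightarrow> real) list \<Rightarrow> 'b \<Rightarrow> real.
        (\<forall>\<eta>\<in>W. D \<eta> [] = S \<eta>) \<and>
        (\<forall>j\<le>k. \<forall>\<eta>\<in>W. bounded_multilinear j X nX Y nY (D \<eta>)) \<and>
        (\<forall>j\<le>k. \<forall>\<eta>\<in>W. \<forall>\<epsilon>>0. \<exists>d>0. \<forall>\<eta>'\<in>W. nX (\<lambda>x. \<eta>' x - \<eta> x) < d \<longrightarrow>
           (\<forall>hs. set hs \<subseteq> X \<and> length hs = j \<longrightarrow>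
              nY (\<lambda>y. D \<eta>' hs y - D \<eta> hs y) \<le> \<epsilon> * prod_list (map nX hs))) \<and>
        (\<forall>j<k. \<forall>\<eta>\<in>W. \<forall>\<epsilon>>0. \<exists>d>0. \<forall>h\<in>X. nX h < d \<and> (\<lambda>x. \<eta> x + h x) \<in> W \<longrightarrow>
           (\<forall>hs. set hs \<subseteq> X \<and> length hs = j \<longrightarrow>
              nY (\<lambda>y. D (\<lambda>x. \<eta> x + h x) hs y - D \<eta> hs y - D \<eta> (h # hs) y)
                \<le> \<epsilon> * nX h * prod_list (map nX hs))))"

definition little_o_t :: "('a \<Rightarrow> real) set \<Rightarrow> (('a \<Rightarrow> real) \<Rightarrow> real) \<Rightarrow> (real \<Rightarrow> 'a \<Rightarrow> real) \<Rightarrow> bool" where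
  "little_o_t X nX r \<longleftrightarrow>
     (\<forall>\<^sub>F t in at 0. r t \<in> X) \<and> ((\<lambda>t. nX (r t) / \<bar>t\<bar>) \<longlongrightarrow> 0) (at 0)"

definition has_velocity ::
  "('a \<Rightarrow> real) set \<Rightarrow> (('a \<Rightarrow> real) \<Rightarrow> real) \<Rightarrow> (real \<Rightarrow> 'a \<Rightarrow> real) \<Rightarrow> ('a \<Rightarrow> real) \<Rightarrow> bool" where
  "has_velocity X nX \<gamma> w \<longleftrightarrow>
     w \<in> X \<and> little_o_t X nX (\<lambda>t x. \<gamma> t x - \<gamma> 0 x - t * w x)"


section \<open>Local solutions and Cauchy data\<close>

definition sol ::
  "(real^'n) set \<Rightarrow> nat \<Rightarrow> real \<Rightarrow> ((real^'n) \<times> real \<times> (real^'n) \<Rightarrow> real) \<Rightarrow> (real^'n \<Rightarrow> real) set \<Rightarrow>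
   (real^'n \<Rightarrow> real) \<Rightarrow> real^'n \<Rightarrow> real" where
  "sol \<Omega> m \<alpha> a V \<eta> = (THE u. u \<in> V \<and> MA_solution \<Omega> m \<alpha> a \<eta> u)"

definition bdry_ball ::
  "(real^'n) set \<Rightarrow> nat \<Rightarrow> real \<Rightarrow> (real^'n \<Rightarrow> real) \<Rightarrow> real \<Rightarrow> (real^'n \<Rightarrow> real) set" where
  "bdry_ball \<Omega> k \<alpha> \<phi> \<delta> = {\<eta> \<in> bdry_space \<Omega> k \<alpha>. bdry_norm \<Omega> k \<alpha> (\<lambda>x. \<eta> x - \<phi> x) < \<delta>}"

definition locally_well_posed ::
  "(real^'n) set \<Rightarrow> nat \<Rightarrow> real \<Rightarrow> ((real^'n) \<times> real \<times> (real^'n) \<Rightarrow> real) \<Rightarrow> (real^'n \<Rightarrow> real) \<Rightarrow>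
   (real^'n \<Rightarrow> real) \<Rightarrow> real \<Rightarrow> (real^'n \<Rightarrow> real) set \<Rightarrow> bool" where
  "locally_well_posed \<Omega> m \<alpha> a \<phi> \<Phi> \<delta> V \<longleftrightarrow>
     \<delta> > 0 \<and>
     V \<subseteq> holder_space \<Omega> (m + 2) \<alpha> \<and>
     (\<exists>\<epsilon>>0. {u \<in> holder_space \<Omega> (m + 2) \<alpha>.
               holder_norm \<Omega> (m + 2) \<alpha> (\<lambda>x. u x - \<Phi> x) < \<epsilon>} \<subseteq> V) \<and>
     (\<forall>\<eta>\<in>bdry_ball \<Omega> (m + 2) \<alpha> \<phi> \<delta>. \<exists>!u. u \<in> V \<and> MA_solution \<Omega> m \<alpha> a \<eta> u) \<and>
     (\<exists>\<delta>'>0. \<delta>' \<le> \<delta> \<and>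
        frechet_class (m + 1) (bdry_space \<Omega> (m + 2) \<alpha>) (bdry_norm \<Omega> (m + 2) \<alpha>)
          (holder_space \<Omega> (m + 2) \<alpha>) (holder_norm \<Omega> (m + 2) \<alpha>)
          (bdry_ball \<Omega> (m + 2) \<alpha> \<phi> \<delta>') (sol \<Omega> m \<alpha> a V)) \<and>
     sol \<Omega> m \<alpha> a V \<phi> = \<Phi>"

definition cauchy_data ::
  "(real^'n) set \<Rightarrow> nat \<Rightarrow> real \<Rightarrow> ((real^'n) \<times> real \<times> (real^'n) \<Rightarrow> real) \<Rightarrow> (real^'n \<Rightarrow> real) \<Rightarrow>
   real \<Rightarrow> (real^'n \<Rightarrow> real) set \<Rightarrow> ((real^'n \<Rightarrow> real) \<times> (real^'n \<Rightarrow> real)) set" where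
  "cauchy_data \<Omega> m \<alpha> a \<phi> \<delta> V =
     {(\<eta>, normal_deriv \<Omega> (sol \<Omega> m \<alpha> a V \<eta>)) | \<eta>. \<eta> \<in> bdry_ball \<Omega> (m + 2) \<alpha> \<phi> \<delta>}"

text \<open>
  Velocities at \<open>t = 0\<close>, in the product of the boundary spaces, of the curves
  \<open>t \<mapsto> (\<phi> + t h, \<partial>\<^sub>\<nu> u)\<close>, \<open>u\<close> the solution with boundary value \<open>\<phi> + t h\<close>. These curves
  run in the Cauchy data set.
\<close>

definition first_variation ::
  "(real^'n) set \<Rightarrow> nat \<Rightarrow> real \<Rightarrow> ((real^'n) \<times> real \<times> (real^'n) \<Rightarrow> real) \<Rightarrow> (real^'n \<Rightarrow> real) \<Rightarrow>
   real \<Rightarrow> (real^'n \<Rightarrow> real) set \<Rightarrow> ((real^'n \<Rightarrow> real) \<times> (real^'n \<Rightarrow> real)) set" where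
  "first_variation \<Omega> m \<alpha> a \<phi> \<delta> V =
     {(w, z). \<exists>h\<in>bdry_space \<Omega> (m + 2) \<alpha>.
        let \<eta> = (\<lambda>t x. \<phi> x + t * h x);
            \<zeta> = (\<lambda>t. normal_deriv \<Omega> (sol \<Omega> m \<alpha> a V (\<eta> t))) in
          (\<forall>\<^sub>F t in nhds 0. (\<eta> t, \<zeta> t) \<in> cauchy_data \<Omega> m \<alpha> a \<phi> \<delta> V) \<and>
          has_velocity (bdry_space \<Omega> (m + 2) \<alpha>) (bdry_norm \<Omega> (m + 2) \<alpha>) \<eta> w \<and>
          has_velocity (bdry_space \<Omega> (m + 1) \<alpha>) (bdry_norm \<Omega> (m + 1) \<alpha>) \<zeta> z}"

definition lin_cauchy_data ::
  "(real^'n) set \<Rightarrow> nat \<Rightarrow> real \<Rightarrow> ((real^'n) \<times> real \<times> (real^'n) \<Rightarrow> real) \<Rightarrow> (real^'n \<Rightarrow> real) \<Rightarrow>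
   ((real^'n \<Rightarrow> real) \<times> (real^'n \<Rightarrow> real)) set" where
  "lin_cauchy_data \<Omega> m \<alpha> a \<Phi> =
     {(\<eta>, normal_deriv \<Omega> (lin_sol \<Omega> m \<alpha> a \<Phi> \<eta>)) | \<eta>. \<eta> \<in> bdry_space \<Omega> (m + 2) \<alpha>}"

end

theory Submission
  imports Defs
begin

text \<open>
  Since the solution map is Frechet differentiable, \<open>u = \<Phi> + t v + o(t)\<close> for some
  \<open>v\<close>. Differentiating \<open>det D\<^sup>2 u = a (x, u, grad u)\<close> in \<open>t\<close> at each point shows that
  \<open>v\<close> solves the linearised Dirichlet problem, as \<open>cof A\<close> is the gradient of \<open>det\<close> at \<open>A\<close>.
  The maximum principle, available because \<open>cof D\<^sup>2 \<Phi>\<close> is positive definite and \<open>q \<ge> 0\<close>, makes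
  this solution unique. The normal derivative is a bounded linear map from \<open>C\<^sup>m\<^sup>+\<^sup>2\<^sup>,\<^sup>\<alpha>\<close> of the closure
  to \<open>C\<^sup>m\<^sup>+\<^sup>1\<^sup>,\<^sup>\<alpha>\<close> of the boundary since the exterior normal extends to a \<open>C\<^sup>m\<^sup>+\<^sup>1\<^sup>,\<^sup>\<alpha>\<close> field, so it may be applied
  to the expansion.
\<close>

section \<open>Hoelder bounds and products\<close>

text \<open>The norms are sums of suprema, which behave badly under the product rule. They are
  traded for \<open>holder_bd\<close>, where one constant bounds everything and the order is
  recursive; the exchange costs a factor \<open>k + 2\<close>. The obstacle is multiplication. Only
  derivatives of top order carry a Hoelder bound, so the undifferentiated factor of a product must
  inherit one from its bounded gradient. This depends on the domain, and the boundary charts supply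
  it. The boundary norm is a quotient over extensions, so bounding a normal derivative means
  exhibiting an extension of it to the closure; hence the field \<open>N\<close>. One order is lost
  because \<open>N\<close> is built from gradients of chart components. The cut-offs gluing them are
  powers of a truncated polynomial: finite smoothness is enough, and their derivatives keep the same
  form. Elliptic existence theory is bypassed: the Frechet derivative of the solution map in
  direction \<open>h\<close> is itself the solution, so only uniqueness calls for an argument about
  the equation.\<close>

lemma has_derivative_cong_open:
  assumes "open U" "x \<in> U" "\<And>x. x \<in> U \<Longrightarrow> f x = g x"
  shows "(f has_derivative f') (at x) \<longleftrightarrow> (g has_derivative f') (at x)"
  using has_derivative_transform_within_open[OF _ assms(1,2), of f f' UNIV g]
    has_derivative_transform_within_open[OF _ assms(1,2), of g f' UNIV f] assms(3) by auto

text \<open>\<open>Lim\<close> depends only on which values are limits, and these are the same for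
  both functions. So \<open>x\<close> can be arbitrary, even a point where the limit fails to
  exist.\<close>

lemma pd_cong:
  assumes "open U" "\<And>x. x \<in> U \<Longrightarrow> f x = g x"
  shows "pd U b f x = pd U b g x"
proof -
  have fd: "frechet_derivative f (at y) = frechet_derivative g (at y)" if "y \<in> U" for y
    unfolding frechet_derivative_def
    using has_derivative_cong_open[where f = f and g = g, OF assms(1) that assms(2)] by simp
  have "((\<lambda>y. frechet_derivative f (at y) b) \<longlongrightarrow> l) (at x within U) \<longleftrightarrow>
        ((\<lambda>y. frechet_derivative g (at y) b) \<longlongrightarrow> l) (at x within U)" for l
    by (rule tendsto_cong) (auto simp: eventually_at_topological fd intro!: exI[of _ UNIV])
  then show ?thesis
    unfolding pd_def Topological_Spaces.Lim_def by (simp add: fd)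
qed

text \<open>The rule by which extended derivatives are computed: at a boundary point the interior
  derivatives converge to \<open>F x\<close> by continuity of \<open>F\<close>.\<close>

lemma pd_eq_on_closure:
  assumes "open U" "continuous_on (closure U) F"
    and "\<And>x. x \<in> U \<Longrightarrow> (f has_derivative f' x) (at x)" "\<And>x. x \<in> U \<Longrightarrow> f' x b = F x"
    and "x \<in> closure U"
  shows "pd U b f x = F x"
proof (cases "x \<in> U")
  case True
  then show ?thesis
    using frechet_derivative_at[OF assms(3)[OF True]] assms(4)[OF True] by (simp add: pd_def)
next
  case False
  have fd: "frechet_derivative f (at y) b = F y" if "y \<in> U" for y
    using frechet_derivative_at[OF assms(3)[OF that]] assms(4)[OF that] by simp
  have nt: "at x within U \<noteq> bot"
    using assms(5) False by (simp add: trivial_limit_within closure_def)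
  have "(F \<longlongrightarrow> F x) (at x within U)"
    using assms(2,5) closure_subset[of U] unfolding continuous_on_def
    by (meson tendsto_within_subset)
  then have "((\<lambda>y. frechet_derivative f (at y) b) \<longlongrightarrow> F x) (at x within U)"
    by (rule Lim_transform_eventually) (auto simp: eventually_at_topological fd intro!: exI[of _ UNIV])
  then show ?thesis
    using tendsto_Lim[OF nt] False by (simp add: pd_def)
qed

text \<open>A single constant for all bounds lets estimates be tracked without suprema. The
  recursion strips the derivative that is applied first, so an induction step meets the same
  predicate for \<open>pd U b f\<close>; the Hoelder quotient is imposed at the last order
  only.\<close>

primrec holder_bd :: "'a::euclidean_space set \<Rightarrow> real \<Rightarrow> nat \<Rightarrow> real \<Rightarrow> ('a \<Rightarrow> real) \<Rightarrow> bool" where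
  "holder_bd U \<alpha> 0 K f \<longleftrightarrow> continuous_on (closure U) f \<and> (\<forall>x\<in>closure U. \<bar>f x\<bar> \<le> K) \<and>
     (\<forall>x\<in>closure U. \<forall>y\<in>closure U. \<bar>f x - f y\<bar> \<le> K * dist x y powr \<alpha>)"
| "holder_bd U \<alpha> (Suc k) K f \<longleftrightarrow> continuous_on (closure U) f \<and> (\<forall>x\<in>closure U. \<bar>f x\<bar> \<le> K) \<and>
     (\<forall>x\<in>U. f differentiable (at x)) \<and> (\<forall>b\<in>Basis. holder_bd U \<alpha> k K (pd U b f))"

lemma holder_bd_continuous: "holder_bd U \<alpha> k K f \<Longrightarrow> continuous_on (closure U) f"
  by (cases k) auto

lemma holder_bd_le: "holder_bd U \<alpha> k K f \<Longrightarrow> x \<in> closure U \<Longrightarrow> \<bar>f x\<bar> \<le> K"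
  by (cases k) auto

lemma holder_bd_cong:
  assumes "open U" "holder_bd U \<alpha> k K f" "\<And>x. x \<in> closure U \<Longrightarrow> f x = g x"
  shows "holder_bd U \<alpha> k K g"
proof (cases k)
  case 0
  then show ?thesis
    using assms(2,3) continuous_on_cong[of "closure U" _ f g] by auto
next
  case (Suc j)
  have eq: "f x = g x" if "x \<in> U" for x
    using assms(3) that closure_subset by blast
  have "g differentiable (at x)" if "x \<in> U" for x
  proof -
    have "f differentiable (at x)"
      using assms(2) Suc that by simp
    then show ?thesis
      unfolding differentiable_def
      using has_derivative_cong_open[where f = f and g = g, OF assms(1) that eq] by simp
  qed
  moreover have "pd U b g = pd U b f" for b
    using pd_cong[OF assms(1) eq] by auto
  ultimately show ?thesis
    using assms(2,3) continuous_on_cong[of "closure U" _ f g] Suc by auto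
qed

lemma holder_bd_mono: "holder_bd U \<alpha> k K f \<Longrightarrow> K \<le> L \<Longrightarrow> holder_bd U \<alpha> k L f"
proof (induction k arbitrary: f)
  case 0
  have "K * dist x y powr \<alpha> \<le> L * dist x y powr \<alpha>" for x y :: 'a
    using 0(2) by (intro mult_right_mono) auto
  then show ?case
    using 0 by simp (meson order_trans)
next
  case (Suc k)
  then show ?case
    by simp (meson order_trans)
qed

text \<open>\<open>F b\<close> is a formula from a differentiation rule that makes sense on the
  whole closure. Its continuity, contained in its own Hoelder bound, identifies it there with
  \<open>pd U b f\<close>.\<close>

lemma holder_bd_SucI:
  assumes "open U" "continuous_on (closure U) f" "\<And>x. x \<in> closure U \<Longrightarrow> \<bar>f x\<bar> \<le> K"
    and "\<And>x. x \<in> U \<Longrightarrow> (f has_derivative f' x) (at x)"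
    and "\<And>x b. x \<in> U \<Longrightarrow> b \<in> Basis \<Longrightarrow> f' x b = F b x"
    and "\<And>b. b \<in> Basis \<Longrightarrow> holder_bd U \<alpha> k K (F b)"
  shows "holder_bd U \<alpha> (Suc k) K f"
proof -
  have "holder_bd U \<alpha> k K (pd U b f)" if "b \<in> Basis" for b
    by (rule holder_bd_cong[OF assms(1) assms(6)[OF that]],
        rule pd_eq_on_closure[OF assms(1) holder_bd_continuous[OF assms(6)[OF that]] assms(4), symmetric])
       (use assms(5) that in auto)
  then show ?thesis
    using assms(2-4) by (auto simp: differentiable_def)
qed

lemma holder_bd_SucD:
  assumes "holder_bd U \<alpha> (Suc k) K f" "x \<in> U"
  shows "(f has_derivative frechet_derivative f (at x)) (at x)"
    and "frechet_derivative f (at x) b = pd U b f x"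
  using assms by (auto simp: frechet_derivative_works pd_def)

section \<open>Constants and sums\<close>

lemma holder_bd_const: "open U \<Longrightarrow> \<bar>c\<bar> \<le> K \<Longrightarrow> holder_bd U \<alpha> k K (\<lambda>_. c)"
proof (induction k arbitrary: c)
  case 0
  then show ?case by auto
next
  case (Suc k)
  show ?case
    by (rule holder_bd_SucI[where f' = "\<lambda>_ _. 0" and F = "\<lambda>_ _. 0"]) (use Suc in auto)
qed

lemma holder_bd_add:
  assumes "open U" "holder_bd U \<alpha> k K f" "holder_bd U \<alpha> k L g"
  shows "holder_bd U \<alpha> k (K + L) (\<lambda>x. f x + g x)"
  using assms(2,3)
proof (induction k arbitrary: f g)
  case 0
  have "\<bar>f x + g x - (f y + g y)\<bar> \<le> (K + L) * dist x y powr \<alpha>"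
    if "x \<in> closure U" "y \<in> closure U" for x y
  proof -
    have "\<bar>f x - f y\<bar> \<le> K * dist x y powr \<alpha>" "\<bar>g x - g y\<bar> \<le> L * dist x y powr \<alpha>"
      using 0 that by auto
    then show ?thesis by (auto simp: algebra_simps)
  qed
  moreover have "\<bar>f x + g x\<bar> \<le> K + L" if "x \<in> closure U" for x
    using holder_bd_le[OF 0(1) that] holder_bd_le[OF 0(2) that] by linarith
  ultimately show ?case
    using 0 by (simp add: continuous_on_add)
next
  case (Suc k)
  show ?case
  proof (rule holder_bd_SucI[OF assms(1)])
    show "continuous_on (closure U) (\<lambda>x. f x + g x)"
      using Suc.prems by (intro continuous_intros) auto
    show "\<bar>f x + g x\<bar> \<le> K + L" if "x \<in> closure U" for x
      using holder_bd_le[OF Suc.prems(1) that] holder_bd_le[OF Suc.prems(2) that] by linarith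
    show "((\<lambda>x. f x + g x) has_derivative
            (\<lambda>h. frechet_derivative f (at x) h + frechet_derivative g (at x) h)) (at x)"
      if "x \<in> U" for x
      using holder_bd_SucD(1)[OF Suc.prems(1) that] holder_bd_SucD(1)[OF Suc.prems(2) that]
      by (rule has_derivative_add)
    show "frechet_derivative f (at x) b + frechet_derivative g (at x) b = pd U b f x + pd U b g x"
      if "x \<in> U" for x b
      using that by (simp add: pd_def)
    show "holder_bd U \<alpha> k (K + L) (\<lambda>x. pd U b f x + pd U b g x)" if "b \<in> Basis" for b
      using Suc that by auto
  qed
qed

lemma holder_bd_sum:
  assumes "open U" "\<And>i. i \<in> I \<Longrightarrow> holder_bd U \<alpha> k (K i) (f i)"
  shows "holder_bd U \<alpha> k (\<Sum>i\<in>I. K i) (\<lambda>x. \<Sum>i\<in>I. f i x)"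
  using assms(2)
proof (induction I rule: infinite_finite_induct)
  case (insert i I)
  then show ?case
    using holder_bd_add[OF assms(1), of \<alpha> k "K i" "f i" "sum K I" "\<lambda>x. \<Sum>i\<in>I. f i x"] by simp
qed (use holder_bd_const[OF assms(1), of 0 0] in auto)

text \<open>This fails on cuspidal domains, where \<open>C\<^sup>1\<close> functions need not be Hoelder continuous.\<close>

definition holder_embed :: "'a::euclidean_space set \<Rightarrow> real \<Rightarrow> real \<Rightarrow> bool" where
  "holder_embed U \<alpha> C \<longleftrightarrow> C \<ge> 1 \<and> \<alpha> > 0 \<and> open U \<and> U \<noteq> {} \<and>
     (\<forall>f M. (\<forall>x\<in>U. f differentiable (at x) \<and> \<bar>f x\<bar> \<le> M \<and>
               (\<forall>b\<in>Basis. \<bar>frechet_derivative f (at x) b\<bar> \<le> M)) \<longrightarrow>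
            (\<forall>x\<in>U. \<forall>y\<in>U. \<bar>f x - f y\<bar> \<le> C * M * dist x y powr \<alpha>))"

lemma holder_bd_nonneg: "holder_bd U \<alpha> k K f \<Longrightarrow> U \<noteq> {} \<Longrightarrow> 0 \<le> K"
  using holder_bd_le closure_subset by (metis abs_ge_zero equals0I order_trans subsetD)

lemma continuous_le_closure2:
  fixes h :: "'a::metric_space \<Rightarrow> 'a \<Rightarrow> real"
  assumes "continuous_on (closure U \<times> closure U) (\<lambda>(x, y). h x y)"
    and "\<And>x y. x \<in> U \<Longrightarrow> y \<in> U \<Longrightarrow> h x y \<le> 0" "x \<in> closure U" "y \<in> closure U"
  shows "h x y \<le> 0"
proof -
  have "continuous_on (closure (U \<times> U)) (\<lambda>(x, y). h x y)"
    using assms(1) by (simp add: closure_Times)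
  then show ?thesis
    using continuous_le_on_closure[of "U \<times> U" "\<lambda>(x, y). h x y" "(x, y)" 0] assms(2-4)
    by (auto simp: closure_Times)
qed

text \<open>At order zero the embedding converts the bounded gradient into a Hoelder estimate on
  \<open>U\<close>, and both sides of it extend continuously to the closure. Higher orders apply
  this to the derivatives.\<close>

lemma holder_bd_down:
  assumes "holder_embed U \<alpha> C" "holder_bd U \<alpha> (Suc k) K f"
  shows "holder_bd U \<alpha> k (C * K) f"
  using assms(2)
proof (induction k arbitrary: f)
  case 0
  have U: "open U" "U \<noteq> {}" "C \<ge> 1" "\<alpha> > 0" and
    emb: "\<And>f M x y. (\<And>x. x \<in> U \<Longrightarrow> f differentiable (at x) \<and> \<bar>f x\<bar> \<le> M \<and>
               (\<forall>b\<in>Basis. \<bar>frechet_derivative f (at x) b\<bar> \<le> M)) \<Longrightarrow> x \<in> U \<Longrightarrow> y \<in> U \<Longrightarrow>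
            \<bar>f x - f y\<bar> \<le> C * M * dist x y powr \<alpha>"
    using assms(1) unfolding holder_embed_def by blast+
  have K: "0 \<le> K"
    using holder_bd_nonneg[OF 0] U by auto
  have CK: "K \<le> C * K"
    using mult_right_mono[OF U(3) K] by simp
  have c: "continuous_on (closure U) f"
    using 0 by simp
  have 1: "\<bar>f x - f y\<bar> \<le> C * K * dist x y powr \<alpha>" if "x \<in> U" "y \<in> U" for x y
  proof (rule emb[OF _ that])
    fix z assume z: "z \<in> U"
    show "f differentiable at z \<and> \<bar>f z\<bar> \<le> K \<and> (\<forall>b\<in>Basis. \<bar>frechet_derivative f (at z) b\<bar> \<le> K)"
      using 0 z closure_subset[of U] by (auto simp: holder_bd_SucD(2)[OF 0 z])
  qed
  have 2: "\<bar>f x - f y\<bar> - C * K * dist x y powr \<alpha> \<le> 0" if "x \<in> closure U" "y \<in> closure U" for x y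
  proof (rule continuous_le_closure2[OF _ _ that])
    \<comment> \<open>The diagonal is included: \<open>powr\<close> is continuous at base zero
      because \<alpha> > 0.\<close>
    have "continuous_on (closure U \<times> closure U) (\<lambda>z. \<bar>f (fst z) - f (snd z)\<bar> - C * K * dist (fst z) (snd z) powr \<alpha>)"
      by (intro continuous_intros continuous_on_compose2[OF c] continuous_on_powr') (use U in auto)
    then show "continuous_on (closure U \<times> closure U) (\<lambda>(x, y). \<bar>f x - f y\<bar> - C * K * dist x y powr \<alpha>)"
      by (simp add: case_prod_unfold)
  qed (use 1 in auto)
  have "\<bar>f x\<bar> \<le> C * K" if "x \<in> closure U" for x
    using CK holder_bd_le[OF 0 that] by linarith
  then show ?case
    using c 2 by simp
next
  case (Suc k)
  have U: "open U" "U \<noteq> {}" "C \<ge> 1"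
    using assms(1) unfolding holder_embed_def by auto
  have K: "0 \<le> K"
    using holder_bd_nonneg[OF Suc.prems] U by auto
  have CK: "K \<le> C * K"
    using mult_right_mono[OF U(3) K] by simp
  have "\<bar>f x\<bar> \<le> C * K" if "x \<in> closure U" for x
    using CK holder_bd_le[OF Suc.prems that] by linarith
  then show ?case
    using Suc by simp
qed

text \<open>The constant precedes the functions, since boundedness of the normal derivative needs a
  bound uniform in the second factor. In the product rule one factor stays undifferentiated and is
  lowered by \<open>holder_bd_down\<close>; two such terms, each with constant \<open>c\<close>,
  give \<open>2 * C * c\<close>.\<close>

lemma holder_bd_mult:
  assumes "holder_embed U \<alpha> C"
  shows "\<exists>c\<ge>1. \<forall>f g K L. holder_bd U \<alpha> k K f \<longrightarrow> holder_bd U \<alpha> k L g \<longrightarrow>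
           holder_bd U \<alpha> k (c * K * L) (\<lambda>x. f x * g x)"
proof (induction k)
  case 0
  have ne: "U \<noteq> {}"
    using assms unfolding holder_embed_def by auto
  have "holder_bd U \<alpha> 0 (2 * K * L) (\<lambda>x. f x * g x)"
    if f: "holder_bd U \<alpha> 0 K f" and g: "holder_bd U \<alpha> 0 L g" for f g K L
  proof -
    have KL: "0 \<le> K" "0 \<le> L"
      using f g ne holder_bd_nonneg by blast+
    have "\<bar>f x * g x\<bar> \<le> 2 * K * L" if "x \<in> closure U" for x
    proof -
      have "\<bar>f x * g x\<bar> \<le> K * L"
        unfolding abs_mult using f g that KL by (intro mult_mono) auto
      also have "\<dots> \<le> 2 * K * L"
        using KL by simp
      finally show ?thesis .
    qed
    moreover have "\<bar>f x * g x - f y * g y\<bar> \<le> 2 * K * L * dist x y powr \<alpha>"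
      if "x \<in> closure U" "y \<in> closure U" for x y
    proof -
      have "f x * g x - f y * g y = f x * (g x - g y) + (f x - f y) * g y"
        by (simp add: algebra_simps)
      also have "\<bar>\<dots>\<bar> \<le> \<bar>f x\<bar> * \<bar>g x - g y\<bar> + \<bar>f x - f y\<bar> * \<bar>g y\<bar>"
        by (metis abs_mult abs_triangle_ineq)
      also have "\<dots> \<le> K * (L * dist x y powr \<alpha>) + K * dist x y powr \<alpha> * L"
        using f g that KL by (intro add_mono mult_mono) auto
      finally show ?thesis
        by (simp add: algebra_simps)
    qed
    ultimately show ?thesis
      using f g by (auto intro!: continuous_intros)
  qed
  then show ?case
    by (intro exI[of _ 2]) auto
next
  case (Suc k)
  then obtain c where c: "c \<ge> 1" and IH: "\<And>f g K L. holder_bd U \<alpha> k K f \<Longrightarrow>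
      holder_bd U \<alpha> k L g \<Longrightarrow> holder_bd U \<alpha> k (c * K * L) (\<lambda>x. f x * g x)"
    by blast
  have U: "open U" "U \<noteq> {}" "C \<ge> 1"
    using assms unfolding holder_embed_def by auto
  have c': "1 \<le> 2 * C * c"
    using mult_mono[of 1 C 1 c] U(3) c by simp
  have "holder_bd U \<alpha> (Suc k) (2 * C * c * K * L) (\<lambda>x. f x * g x)"
    if f: "holder_bd U \<alpha> (Suc k) K f" and g: "holder_bd U \<alpha> (Suc k) L g" for f g K L
  proof (rule holder_bd_SucI[OF U(1)])
    have KL: "0 \<le> K" "0 \<le> L"
      using f g U holder_bd_nonneg by blast+
    show "continuous_on (closure U) (\<lambda>x. f x * g x)"
      using f g by (auto intro!: continuous_intros)
    show "\<bar>f x * g x\<bar> \<le> 2 * C * c * K * L" if "x \<in> closure U" for x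
    proof -
      have "\<bar>f x * g x\<bar> \<le> K * L"
        unfolding abs_mult using f g that KL by (intro mult_mono) auto
      also have "\<dots> \<le> 2 * C * c * (K * L)"
        using mult_right_mono[OF c', of "K * L"] KL by simp
      finally show ?thesis by (simp add: algebra_simps)
    qed
    show "((\<lambda>x. f x * g x) has_derivative
            (\<lambda>h. f x * frechet_derivative g (at x) h + frechet_derivative f (at x) h * g x)) (at x)"
      if "x \<in> U" for x
      using holder_bd_SucD(1)[OF f that] holder_bd_SucD(1)[OF g that]
      by (rule has_derivative_mult)
    show "f x * frechet_derivative g (at x) b + frechet_derivative f (at x) b * g x
            = f x * pd U b g x + pd U b f x * g x" if "x \<in> U" for x b
      using that by (simp add: pd_def)
    show "holder_bd U \<alpha> k (2 * C * c * K * L) (\<lambda>x. f x * pd U b g x + pd U b f x * g x)"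
      if "b \<in> Basis" for b
    proof -
      have "holder_bd U \<alpha> k (c * (C * K) * L + c * K * (C * L)) (\<lambda>x. f x * pd U b g x + pd U b f x * g x)"
        using f g that by (intro holder_bd_add[OF U(1)] IH holder_bd_down[OF assms]) auto
      then show ?thesis
        by (simp add: algebra_simps)
    qed
  qed
  then show ?case
    using c' by blast
qed

lemma holder_bd_cmult:
  assumes "open U" "holder_bd U \<alpha> k K f"
  shows "holder_bd U \<alpha> k (\<bar>c\<bar> * K) (\<lambda>x. c * f x)"
  using assms(2)
proof (induction k arbitrary: f)
  case 0
  have "\<bar>c * f x - c * f y\<bar> \<le> \<bar>c\<bar> * K * dist x y powr \<alpha>"
    if "x \<in> closure U" "y \<in> closure U" for x y
  proof -
    have "\<bar>c * f x - c * f y\<bar> = \<bar>c\<bar> * \<bar>f x - f y\<bar>"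
      by (metis abs_mult right_diff_distrib)
    also have "\<dots> \<le> \<bar>c\<bar> * (K * dist x y powr \<alpha>)"
      using 0 that by (intro mult_left_mono) auto
    finally show ?thesis by simp
  qed
  then show ?case
    using 0 by (auto simp: abs_mult intro: continuous_intros mult_left_mono)
next
  case (Suc k)
  show ?case
  proof (rule holder_bd_SucI[OF assms(1)])
    show "continuous_on (closure U) (\<lambda>x. c * f x)"
      using Suc.prems by (intro continuous_intros) auto
    show "\<bar>c * f x\<bar> \<le> \<bar>c\<bar> * K" if "x \<in> closure U" for x
      using holder_bd_le[OF Suc.prems(1) that] by (auto simp: abs_mult intro: mult_left_mono)
    show "((\<lambda>x. c * f x) has_derivative (\<lambda>h. c * frechet_derivative f (at x) h)) (at x)"
      if "x \<in> U" for x
      using holder_bd_SucD(1)[OF Suc.prems(1) that] by (rule has_derivative_mult_right)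
    show "c * frechet_derivative f (at x) b = c * pd U b f x" if "x \<in> U" for x b
      using that by (simp add: pd_def)
    show "holder_bd U \<alpha> k (\<bar>c\<bar> * K) (\<lambda>x. c * pd U b f x)" if "b \<in> Basis" for b
      using Suc that by auto
  qed
qed


section \<open>Powers and cut-off functions\<close>

lemma powr_lipschitz:
  fixes c K p :: real
  assumes "c > 0"
  obtains L where "L \<ge> 0"
    "\<And>s t. c \<le> s \<Longrightarrow> s \<le> K \<Longrightarrow> c \<le> t \<Longrightarrow> t \<le> K \<Longrightarrow> \<bar>s powr p - t powr p\<bar> \<le> L * \<bar>s - t\<bar>"
    "\<And>s. c \<le> s \<Longrightarrow> s \<le> K \<Longrightarrow> s powr p \<le> L"
proof -
  \<comment> \<open>A power is monotone with direction depending on the sign of the exponent; adding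
    both endpoint values covers either case.\<close>
  have mono: "s powr q \<le> c powr q + K powr q" if "c \<le> s" "s \<le> K" for s q :: real
  proof (cases "q \<ge> 0")
    case True
    then have "s powr q \<le> K powr q"
      using that assms by (intro powr_mono2) auto
    then show ?thesis
      by (smt (verit) powr_ge_zero)
  next
    case False
    then have "s powr q \<le> c powr q"
      using that assms by (intro powr_mono2') auto
    then show ?thesis
      by (smt (verit) powr_ge_zero)
  qed
  define L where "L = \<bar>p\<bar> * (c powr (p - 1) + K powr (p - 1)) + (c powr p + K powr p)"
  have "\<bar>s powr p - t powr p\<bar> \<le> L * \<bar>s - t\<bar>" if "c \<le> s" "s \<le> K" "c \<le> t" "t \<le> K" for s t
  proof -
    have "norm (s powr p - t powr p) \<le> L * norm (s - t)"
    proof (rule field_differentiable_bound[where S = "{c..K}" and f' = "\<lambda>x. p * x powr (p - 1)"])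
      fix x assume x: "x \<in> {c..K}"
      then show "((\<lambda>x. x powr p) has_field_derivative p * x powr (p - 1)) (at x within {c..K})"
        using assms by (auto intro!: derivative_eq_intros simp: powr_diff)
      have "norm (p * x powr (p - 1)) \<le> \<bar>p\<bar> * (c powr (p - 1) + K powr (p - 1))"
        using mono[of x "p - 1"] x by (auto simp: abs_mult intro!: mult_left_mono)
      then show "norm (p * x powr (p - 1)) \<le> L"
        unfolding L_def by (smt (verit) powr_ge_zero)
    qed (use that in auto)
    then show ?thesis by simp
  qed
  moreover have "s powr p \<le> L" if "c \<le> s" "s \<le> K" for s
  proof -
    have "0 \<le> \<bar>p\<bar> * (c powr (p - 1) + K powr (p - 1))"
      by simp
    then show ?thesis
      using mono[OF that, of p] unfolding L_def by linarith
  qed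
  moreover have "0 \<le> L"
    unfolding L_def by simp
  ultimately show ?thesis
    using that by blast
qed

text \<open>Meant for exponent -1/2, to normalise a vector field. The induction runs over all
  exponents because differentiation replaces \<open>p\<close> by \<open>p - 1\<close>; the lower
  bound \<open>c\<close> keeps the argument away from the singularity at zero.\<close>

lemma holder_bd_powr:
  assumes "holder_embed U \<alpha> C" "holder_bd U \<alpha> k K f" "c > 0" "\<And>x. x \<in> closure U \<Longrightarrow> c \<le> f x"
  shows "\<exists>L. holder_bd U \<alpha> k L (\<lambda>x. f x powr p)"
  using assms(2)
proof (induction k arbitrary: p K)
  case 0
  obtain L where L: "L \<ge> 0"
    "\<And>s t. c \<le> s \<Longrightarrow> s \<le> K \<Longrightarrow> c \<le> t \<Longrightarrow> t \<le> K \<Longrightarrow> \<bar>s powr p - t powr p\<bar> \<le> L * \<bar>s - t\<bar>"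
    "\<And>s. c \<le> s \<Longrightarrow> s \<le> K \<Longrightarrow> s powr p \<le> L"
    using powr_lipschitz[OF assms(3)] by blast
  have f: "c \<le> f x" "f x \<le> K" if "x \<in> closure U" for x
    using assms(4)[OF that] holder_bd_le[OF 0 that] by auto
  have "\<bar>f x powr p - f y powr p\<bar> \<le> max L (L * K) * dist x y powr \<alpha>"
    if "x \<in> closure U" "y \<in> closure U" for x y
  proof -
    have "\<bar>f x powr p - f y powr p\<bar> \<le> L * \<bar>f x - f y\<bar>"
      using L(2) f that by blast
    also have "\<dots> \<le> L * (K * dist x y powr \<alpha>)"
      using 0 that L(1) by (intro mult_left_mono) auto
    also have "\<dots> \<le> max L (L * K) * dist x y powr \<alpha>"
      using mult_right_mono[of "L * K" "max L (L * K)" "dist x y powr \<alpha>"] by (simp add: mult.assoc)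
    finally show ?thesis .
  qed
  moreover have "continuous_on (closure U) (\<lambda>x. f x powr p)"
    using 0 assms(3,4) by (intro continuous_intros) force+
  moreover have "\<bar>f x powr p\<bar> \<le> max L (L * K)" if "x \<in> closure U" for x
    using L(3) f[OF that] by (simp add: le_max_iff_disj)
  ultimately show ?case
    by auto
next
  case (Suc k)
  have U: "open U" "U \<noteq> {}"
    using assms(1) unfolding holder_embed_def by auto
  have fK: "holder_bd U \<alpha> k (C * K) f"
    using holder_bd_down[OF assms(1) Suc.prems] .
  obtain L where L: "holder_bd U \<alpha> k L (\<lambda>x. f x powr (p - 1))"
    using Suc.IH[OF fK] by blast
  obtain L' where L': "holder_bd U \<alpha> k L' (\<lambda>x. f x powr p)"
    using Suc.IH[OF fK] by blast
  obtain c' where c': "\<And>f g K L. holder_bd U \<alpha> k K f \<Longrightarrow> holder_bd U \<alpha> k L g \<Longrightarrow>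
           holder_bd U \<alpha> k (c' * K * L) (\<lambda>x. f x * g x)"
    using holder_bd_mult[OF assms(1)] by metis
  define M where "M = max L' (\<bar>p\<bar> * (c' * L * K))"
  have "holder_bd U \<alpha> (Suc k) M (\<lambda>x. f x powr p)"
  proof (rule holder_bd_SucI[OF U(1)])
    show "continuous_on (closure U) (\<lambda>x. f x powr p)"
      using L' holder_bd_continuous by blast
    show "\<bar>f x powr p\<bar> \<le> M" if "x \<in> closure U" for x
      using holder_bd_le[OF L' that] unfolding M_def by simp
    show "((\<lambda>x. f x powr p) has_derivative
        (\<lambda>h. p * (f x powr (p - 1) * frechet_derivative f (at x) h))) (at x)" if "x \<in> U" for x
    proof -
      have "f x > 0"
        using assms(3) assms(4)[of x] that closure_subset by force
      then have "((\<lambda>z. z powr p) has_real_derivative p * f x powr (p - 1)) (at (f x))"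
        by (auto intro!: derivative_eq_intros simp: powr_diff)
      from has_derivative_compose[OF holder_bd_SucD(1)[OF Suc.prems that]
          this[unfolded has_field_derivative_def]]
      show ?thesis
        by (simp add: mult.assoc)
    qed
    show "p * (f x powr (p - 1) * frechet_derivative f (at x) b)
        = p * (f x powr (p - 1) * pd U b f x)" if "x \<in> U" for x b
      using that by (simp add: pd_def)
    show "holder_bd U \<alpha> k M (\<lambda>x. p * (f x powr (p - 1) * pd U b f x))" if "b \<in> Basis" for b
    proof -
      have "holder_bd U \<alpha> k K (pd U b f)"
        using Suc.prems that by simp
      from holder_bd_cmult[OF U(1) c'[OF L this]]
      have "holder_bd U \<alpha> k (\<bar>p\<bar> * (c' * L * K)) (\<lambda>x. p * (f x powr (p - 1) * pd U b f x))" .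
      then show ?thesis
        by (rule holder_bd_mono) (simp add: M_def)
    qed
  qed
  then show ?case by blast
qed

text \<open>An exponent of at least two flattens the kink of \<open>max 0 t\<close>: at zero the
  difference quotient is at most \<open>\<bar>h\<bar> ^ Suc n\<close>.\<close>

lemma has_real_derivative_max_power:
  "((\<lambda>t::real. max 0 t ^ Suc (Suc n)) has_real_derivative real (Suc (Suc n)) * max 0 t ^ Suc n) (at t)"
proof -
  consider "t < 0" | "t = 0" | "t > 0" by linarith
  then show ?thesis
  proof cases
    case 1
    have "((\<lambda>t::real. 0) has_real_derivative 0) (at t)" by simp
    then have "((\<lambda>t::real. max 0 t ^ Suc (Suc n)) has_real_derivative 0) (at t)"
      by (rule has_field_derivative_transform_within_open[where S = "{..<0}"]) (use 1 in auto)
    then show ?thesis using 1 by simp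
  next
    case 3
    have "((\<lambda>t::real. t ^ Suc (Suc n)) has_real_derivative real (Suc (Suc n)) * t ^ Suc n) (at t)"
      by (rule derivative_eq_intros refl | simp)+
    then have "((\<lambda>t::real. max 0 t ^ Suc (Suc n)) has_real_derivative real (Suc (Suc n)) * t ^ Suc n) (at t)"
      by (rule has_field_derivative_transform_within_open[where S = "{0<..}"]) (use 3 in auto)
    then show ?thesis using 3 by simp
  next
    case 2
    have "((\<lambda>h::real. \<bar>h\<bar> ^ Suc n) \<longlongrightarrow> 0) (at 0)"
      by (rule tendsto_eq_intros | simp)+
    then have "((\<lambda>h::real. (max 0 (0 + h) ^ Suc (Suc n) - max 0 0 ^ Suc (Suc n)) / h) \<longlongrightarrow> 0) (at 0)"
    proof (rule Lim_null_comparison[rotated])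
      have "norm ((max 0 (0 + h) ^ Suc (Suc n) - max 0 0 ^ Suc (Suc n)) / h) \<le> \<bar>h\<bar> ^ Suc n" for h :: real
        by (cases "h > 0") (auto simp: max_def mult_nonpos_nonneg)
      then show "\<forall>\<^sub>F h :: real in at 0. norm ((max 0 (0 + h) ^ Suc (Suc n) - max 0 0 ^ Suc (Suc n)) / h) \<le> \<bar>h\<bar> ^ Suc n"
        by (rule always_eventually[rule_format])
    qed
    then show ?thesis
      using 2 by (simp add: DERIV_def)
  qed
qed

text \<open>Only powers of this function serve as cut-offs. Differentiating a power of exponent at
  least two gives the next lower power times a linear function, so a power above \<open>k\<close>
  supports order \<open>k\<close>.\<close>

definition bump :: "'a::euclidean_space \<Rightarrow> real \<Rightarrow> 'a \<Rightarrow> real" where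
  "bump x0 s x = max 0 (s\<^sup>2 - (x - x0) \<bullet> (x - x0))"

lemma bump_pos_iff: "s > 0 \<Longrightarrow> bump x0 s x > 0 \<longleftrightarrow> dist x x0 < s"
proof -
  assume s: "s > 0"
  have "(x - x0) \<bullet> (x - x0) = (dist x x0)\<^sup>2"
    by (simp add: dist_norm power2_norm_eq_inner)
  moreover have "dist x x0 < s \<longleftrightarrow> (dist x x0)\<^sup>2 < s\<^sup>2"
    using s power2_less_imp_less[of "dist x x0" s] power_strict_mono[of "dist x x0" s 2] by auto
  ultimately show ?thesis
    unfolding bump_def by (simp add: less_max_iff_disj)
qed

lemma bump_nonneg: "0 \<le> bump x0 s x"
  by (simp add: bump_def)

lemma bump_eq_0: "s > 0 \<Longrightarrow> dist x x0 \<ge> s \<Longrightarrow> bump x0 s x = 0"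
  using bump_pos_iff[of s x0 x] bump_nonneg[of x0 s x] by linarith

lemma bump_power_has_derivative:
  "((\<lambda>x. bump x0 s x ^ Suc (Suc n)) has_derivative
      (\<lambda>h. bump x0 s x ^ Suc n * (- 2 * real (Suc (Suc n)) * ((x - x0) \<bullet> h)))) (at x)"
proof -
  have 1: "((\<lambda>x. s\<^sup>2 - (x - x0) \<bullet> (x - x0)) has_derivative (\<lambda>h. - 2 * ((x - x0) \<bullet> h))) (at x)"
    by (auto intro!: derivative_eq_intros simp: inner_commute)
  from has_derivative_compose[OF 1 has_real_derivative_max_power[unfolded has_field_derivative_def]]
  show ?thesis
    unfolding bump_def by (simp add: algebra_simps)
qed

lemma bump_lipschitz:
  assumes "x \<in> cball x0 r" "y \<in> cball x0 r"
  shows "\<bar>bump x0 s x - bump x0 s y\<bar> \<le> 2 * r * dist x y"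
proof -
  have "(y - x0) \<bullet> (y - x0) - (x - x0) \<bullet> (x - x0) = (y - x) \<bullet> ((y - x0) + (x - x0))"
    by (simp add: algebra_simps inner_commute)
  also have "\<bar>\<dots>\<bar> \<le> norm (y - x) * norm ((y - x0) + (x - x0))"
    by (rule Cauchy_Schwarz_ineq2)
  also have "\<dots> \<le> norm (y - x) * (r + r)"
    using assms by (intro mult_left_mono order_trans[OF norm_triangle_ineq] add_mono)
      (auto simp: dist_norm norm_minus_commute)
  finally have "\<bar>(y - x0) \<bullet> (y - x0) - (x - x0) \<bullet> (x - x0)\<bar> \<le> 2 * r * dist x y"
    by (simp add: dist_norm norm_minus_commute algebra_simps)
  then show ?thesis
    unfolding bump_def by linarith
qed

text \<open>Write \<open>d\<close> as \<open>d powr (1 - \<alpha>) * d powr \<alpha>\<close>. On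
  bounded sets this turns Lipschitz estimates into Hoelder estimates.\<close>

lemma le_powr_times_powr:
  fixes d R \<alpha> :: real
  assumes "0 \<le> d" "d \<le> R" "\<alpha> < 1"
  shows "d \<le> R powr (1 - \<alpha>) * d powr \<alpha>"
proof (cases "d = 0")
  case False
  have "d = d powr (1 - \<alpha>) * d powr \<alpha>"
    using assms False by (simp flip: powr_add)
  also have "\<dots> \<le> R powr (1 - \<alpha>) * d powr \<alpha>"
    using assms by (intro mult_right_mono powr_mono2) auto
  finally show ?thesis .
qed simp

lemma holder_bd_bump_power:
  assumes "holder_embed (ball x0 r) \<alpha> C" "\<alpha> < 1"
  shows "\<exists>L. holder_bd (ball x0 r) \<alpha> 0 L (\<lambda>x. bump x0 s x ^ n)"
proof (induction n)
  case 0
  then show ?case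
    using holder_bd_const[of "ball x0 r" 1 1 \<alpha> 0] by auto
next
  case (Suc n)
  have a: "\<alpha> > 0" and ne: "ball x0 r \<noteq> {}"
    using assms(1) unfolding holder_embed_def by auto
  then have r: "r > 0" by auto
  then have cl: "closure (ball x0 r) = cball x0 r" by simp
  define K where "K = max (s\<^sup>2) (2 * r * (2 * r) powr (1 - \<alpha>))"
  have "\<bar>bump x0 s x - bump x0 s y\<bar> \<le> K * dist x y powr \<alpha>" if "x \<in> cball x0 r" "y \<in> cball x0 r" for x y
  proof -
    have "dist x y \<le> 2 * r"
      using dist_triangle2[of x y x0] that by (simp add: dist_commute)
    then have "2 * r * dist x y \<le> 2 * r * ((2 * r) powr (1 - \<alpha>) * dist x y powr \<alpha>)"
      using r assms(2) by (intro mult_left_mono le_powr_times_powr) auto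
    also have "\<dots> = 2 * r * (2 * r) powr (1 - \<alpha>) * dist x y powr \<alpha>"
      by simp
    also have "\<dots> \<le> K * dist x y powr \<alpha>"
      unfolding K_def by (intro mult_right_mono) auto
    finally show ?thesis
      using bump_lipschitz[OF that, of s] by linarith
  qed
  moreover have "\<bar>bump x0 s x\<bar> \<le> K" for x
    unfolding K_def bump_def by (auto simp: le_max_iff_disj)
  moreover have "continuous_on A (bump x0 s)" for A
    unfolding bump_def by (intro continuous_intros)
  ultimately have "holder_bd (ball x0 r) \<alpha> 0 K (bump x0 s)"
    using cl by simp
  then show ?case
    using holder_bd_mult[OF assms(1), of 0] Suc by (simp only: power_Suc) blast
qed

text \<open>Here \<open>g\<close> is controlled only on the ball of radius \<open>r\<close>. The
  lemmas take \<open>s < r\<close>, so the cut-off vanishes before that ball ends and the extension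
  by zero is smooth across its sphere.\<close>

definition bump_ext :: "'a::euclidean_space \<Rightarrow> real \<Rightarrow> real \<Rightarrow> nat \<Rightarrow> ('a \<Rightarrow> real) \<Rightarrow> 'a \<Rightarrow> real" where
  "bump_ext x0 s r n g x = (if x \<in> ball x0 r then bump x0 s x ^ n * g x else 0)"

lemma holder_bd_inner:
  assumes "holder_embed (ball x0 r) \<alpha> C" "\<alpha> < 1"
  shows "\<exists>L. holder_bd (ball x0 r) \<alpha> k L (\<lambda>x. (x - x0) \<bullet> b)"
proof -
  have U: "open (ball x0 r)" by simp
  have r: "r > 0"
    using assms(1) unfolding holder_embed_def by auto
  then have cl: "closure (ball x0 r) = cball x0 r" by simp
  define L where "L = max (\<bar>r\<bar> * norm b) (norm b)"
  \<comment> \<open>The derivative is constant, so a positive order is the easy case; lowering it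
    afterwards includes order zero without a separate argument.\<close>
  have "holder_bd (ball x0 r) \<alpha> (Suc k) L (\<lambda>x. (x - x0) \<bullet> b)"
  proof (rule holder_bd_SucI[OF U, where f' = "\<lambda>x h. h \<bullet> b" and F = "\<lambda>b' x. b' \<bullet> b"])
    show "\<bar>(x - x0) \<bullet> b\<bar> \<le> L" if "x \<in> closure (ball x0 r)" for x
    proof -
      have "\<bar>(x - x0) \<bullet> b\<bar> \<le> norm (x - x0) * norm b"
        by (rule Cauchy_Schwarz_ineq2)
      also have "\<dots> \<le> \<bar>r\<bar> * norm b"
        using that r unfolding cl by (intro mult_right_mono) (auto simp: dist_norm norm_minus_commute)
      finally show ?thesis unfolding L_def by simp
    qed
    show "holder_bd (ball x0 r) \<alpha> k L (\<lambda>x. b' \<bullet> b)" if "b' \<in> Basis" for b'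
      using that Basis_le_norm[OF that, of b] unfolding L_def
      by (intro holder_bd_const[OF U]) (simp add: inner_commute)
  qed (auto intro!: continuous_intros derivative_eq_intros)
  then show ?thesis
    using holder_bd_down[OF assms(1)] by blast
qed

text \<open>The class is closed under differentiation: each derivative is the sum of a
  \<open>bump_ext\<close> with exponent \<open>n - 1\<close> and one with exponent \<open>n\<close>.
  A power is lost together with an order, so \<open>k < n\<close> persists down to order zero, where
  the exponent is still positive.\<close>

lemma holder_bd_bump_ext:
  assumes "holder_embed (ball x0 r) \<alpha> C" "\<alpha> < 1" "0 < s" "s < r" "open U"
    and "holder_bd (ball x0 r) \<alpha> k K g" "k < n"
  shows "\<exists>L. holder_bd U \<alpha> k L (bump_ext x0 s r n g)"
  using assms(6,7)
proof (induction k arbitrary: g n K)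
  case 0
  let ?B = "ball x0 r" and ?G = "bump_ext x0 s r n g"
  have a: "\<alpha> > 0"
    using assms(1) unfolding holder_embed_def by auto
  have cl: "closure ?B = cball x0 r"
    using assms(3,4) by simp
  obtain L0 where "holder_bd ?B \<alpha> 0 L0 (\<lambda>x. bump x0 s x ^ n)"
    using holder_bd_bump_power[OF assms(1,2)] by blast
  then obtain L where L: "holder_bd ?B \<alpha> 0 L (\<lambda>x. bump x0 s x ^ n * g x)"
    using holder_bd_mult[OF assms(1)] 0 by blast
  have L0: "L \<ge> 0"
    using holder_bd_nonneg[OF L] assms(3,4) by auto
  have out: "?G x = 0" if "dist x x0 \<ge> s" for x
    using that bump_eq_0[OF assms(3) that] 0 by (auto simp: bump_ext_def)
  have bd: "\<bar>?G x\<bar> \<le> L" for x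
    using holder_bd_le[OF L, of x] L0 cl by (auto simp: bump_ext_def)
  \<comment> \<open>A point where the cut-off is nonzero and a point off the large ball are at least
    \<open>r - s\<close> apart, so \<open>D\<close> turns the supremum bound into a Hoelder bound
    for such pairs.\<close>
  define D where "D = max 1 (1 / (r - s) powr \<alpha>)"
  have far: "\<bar>?G x\<bar> \<le> L * D * dist x y powr \<alpha>" if "x \<in> ?B" "y \<notin> ?B" for x y
  proof (cases "dist x x0 < s")
    case True
    have "r - s \<le> dist x y"
      using dist_triangle[of x0 y x] True that by (simp add: dist_commute)
    then have "(r - s) powr \<alpha> \<le> dist x y powr \<alpha>"
      using a assms(4) by (intro powr_mono2) auto
    then have "1 \<le> 1 / (r - s) powr \<alpha> * dist x y powr \<alpha>"
      using assms(4) by (simp add: field_simps)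
    also have "\<dots> \<le> D * dist x y powr \<alpha>"
      unfolding D_def by (intro mult_right_mono) auto
    finally have "L * 1 \<le> L * (D * dist x y powr \<alpha>)"
      using L0 by (intro mult_left_mono) auto
    then show ?thesis
      using bd[of x] by simp
  next
    case False
    then show ?thesis
      using out[of x] L0 D_def by simp
  qed
  have "\<bar>?G x - ?G y\<bar> \<le> L * D * dist x y powr \<alpha>" for x y
  proof -
    consider "x \<in> ?B" "y \<in> ?B" | "x \<in> ?B" "y \<notin> ?B" | "x \<notin> ?B" "y \<in> ?B" | "x \<notin> ?B" "y \<notin> ?B"
      by blast
    then show ?thesis
    proof cases
      case 1
      then have "x \<in> closure ?B" "y \<in> closure ?B"
        using closure_subset by blast+
      with L 1 have "\<bar>?G x - ?G y\<bar> \<le> L * dist x y powr \<alpha>"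
        unfolding bump_ext_def by simp
      also have "\<dots> \<le> L * D * dist x y powr \<alpha>"
        using mult_left_mono[of 1 D L] L0 D_def by (intro mult_right_mono) auto
      finally show ?thesis .
    next
      case 2
      then show ?thesis using far[OF 2] by (simp add: bump_ext_def)
    next
      case 3
      then show ?thesis using far[OF 3(2,1)] by (simp add: bump_ext_def dist_commute)
    next
      case 4
      then show ?thesis using L0 D_def by (simp add: bump_ext_def)
    qed
  qed
  moreover have "continuous_on (closure U) ?G"
  proof -
    have "continuous_on (?B \<union> - cball x0 s) ?G"
    proof (rule continuous_on_open_Un)
      show "continuous_on ?B ?G"
        using continuous_on_subset[OF holder_bd_continuous[OF L] closure_subset]
        by (rule continuous_on_eq) (auto simp: bump_ext_def)
      have "continuous_on (- cball x0 s) (\<lambda>x. 0::real)" by simp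
      then show "continuous_on (- cball x0 s) ?G"
        by (rule continuous_on_eq) (use out in \<open>auto simp: dist_commute\<close>)
    qed auto
    moreover have "?B \<union> - cball x0 s = UNIV"
      using assms(4) by auto
    ultimately show ?thesis
      using continuous_on_subset by (metis subset_UNIV)
  qed
  moreover have "\<bar>?G x\<bar> \<le> L * D" for x
    using bd[of x] mult_left_mono[of 1 D L] L0 D_def by simp
  ultimately show ?case
    by auto
next
  case (Suc k)
  let ?B = "ball x0 r" and ?G = "bump_ext x0 s r n g"
  obtain m where m: "n = Suc (Suc m)" "k < Suc m"
    using Suc.prems(2) by (metis Suc_less_eq2 not0_implies_Suc gr_implies_not0)
  have g: "holder_bd ?B \<alpha> k (C * K) g"
    using holder_bd_down[OF assms(1) Suc.prems(1)] .
  obtain L0 where L0: "holder_bd U \<alpha> k L0 ?G"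
    using Suc.IH[OF g, of n] Suc.prems(2) by auto
  \<comment> \<open>What remains beside the lowered power \<open>n - 1\<close> when the derivative
    falls on the cut-off.\<close>
  define g1 where "g1 b x = - 2 * real n * (((x - x0) \<bullet> b) * g x)" for b x
  have "\<exists>L. holder_bd U \<alpha> k L (\<lambda>x. bump_ext x0 s r (Suc m) (g1 b) x + bump_ext x0 s r n (pd ?B b g) x)"
    if "b \<in> Basis" for b
  proof -
    obtain L1 where "holder_bd ?B \<alpha> k L1 (\<lambda>x. ((x - x0) \<bullet> b) * g x)"
      using holder_bd_mult[OF assms(1), of k] holder_bd_inner[OF assms(1,2)] g by blast
    then have "\<exists>L. holder_bd ?B \<alpha> k L (g1 b)"
      unfolding g1_def using holder_bd_cmult by blast
    then obtain L2 where L2: "holder_bd U \<alpha> k L2 (bump_ext x0 s r (Suc m) (g1 b))"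
      using Suc.IH m by blast
    have "holder_bd ?B \<alpha> k K (pd ?B b g)"
      using Suc.prems that by auto
    then obtain L3 where L3: "holder_bd U \<alpha> k L3 (bump_ext x0 s r n (pd ?B b g))"
      using Suc.IH[of K _ n] Suc.prems(2) by auto
    show ?thesis
      using holder_bd_add[OF assms(5) L2 L3] by blast
  qed
  then obtain Lb where Lb: "\<And>b. b \<in> Basis \<Longrightarrow> holder_bd U \<alpha> k (Lb b)
      (\<lambda>x. bump_ext x0 s r (Suc m) (g1 b) x + bump_ext x0 s r n (pd ?B b g) x)"
    by metis
  define L where "L = Max (insert L0 (Lb ` Basis))"
  have "holder_bd U \<alpha> (Suc k) L ?G"
  proof (rule holder_bd_SucI[OF assms(5)])
    show "continuous_on (closure U) ?G"
      using holder_bd_continuous[OF L0] .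
    show "\<bar>?G x\<bar> \<le> L" if "x \<in> closure U" for x
      using holder_bd_le[OF L0 that] unfolding L_def by (simp add: Max_ge_iff)
    show "holder_bd U \<alpha> k L (\<lambda>x. bump_ext x0 s r (Suc m) (g1 b) x + bump_ext x0 s r n (pd ?B b g) x)"
      if "b \<in> Basis" for b
      using that unfolding L_def by (intro holder_bd_mono[OF Lb[OF that]] Max_ge) auto
    let ?f' = "\<lambda>x h. if x \<in> ?B then bump x0 s x ^ n * frechet_derivative g (at x) h +
        bump x0 s x ^ Suc m * (- 2 * real n * ((x - x0) \<bullet> h)) * g x else 0"
    show "(?G has_derivative ?f' x) (at x)" if "x \<in> U" for x
    proof (cases "x \<in> ?B")
      case True
      have 1: "(g has_derivative frechet_derivative g (at x)) (at x)"
        using holder_bd_SucD(1)[OF Suc.prems(1) True] .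
      have "((\<lambda>x. bump x0 s x ^ n * g x) has_derivative ?f' x) (at x)"
        using has_derivative_mult[OF bump_power_has_derivative[of x0 s m x] 1] True m(1) by simp
      moreover have "(?G has_derivative D) (at x) \<longleftrightarrow> ((\<lambda>x. bump x0 s x ^ n * g x) has_derivative D) (at x)" for D
        by (rule has_derivative_cong_open[OF _ True]) (auto simp: bump_ext_def)
      ultimately show ?thesis by blast
    next
      case False
      then have x: "x \<in> - cball x0 s"
        using assms(4) by auto
      have "(?G has_derivative D) (at x) \<longleftrightarrow> ((\<lambda>x. 0) has_derivative D) (at x)" for D
        by (rule has_derivative_cong_open[OF _ x])
           (auto simp: bump_ext_def bump_eq_0[OF assms(3)] dist_commute m)
      then show ?thesis
        using False by simp
    qed
    show "?f' x b = bump_ext x0 s r (Suc m) (g1 b) x + bump_ext x0 s r n (pd ?B b g) x"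
      if "b \<in> Basis" for x b
      by (simp add: bump_ext_def g1_def pd_def algebra_simps)
  qed
  then show ?case by blast
qed


section \<open>Hoelder norms and boundary norms\<close>

lemma pds_append: "pds U (bs @ [b]) f = pds U bs (pd U b f)"
  by (induction bs) auto

lemma dirs_0: "dirs 0 = {[]}"
  by (auto simp: dirs_def)

text \<open>The last list entry is the derivative applied first, so splitting it off matches the
  recursion of \<open>holder_bd\<close>.\<close>

lemma ball_dirs_Suc:
  fixes P :: "'a::euclidean_space list \<Rightarrow> bool"
  shows "(\<forall>bs\<in>dirs (Suc j). P bs) \<longleftrightarrow> (\<forall>b\<in>Basis. \<forall>bs\<in>dirs j. P (bs @ [b]))"
proof safe
  fix b :: 'a and bs :: "'a list" assume "\<forall>bs\<in>dirs (Suc j). P bs" "b \<in> Basis" "bs \<in> dirs j"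
  then show "P (bs @ [b])"
    by (auto simp: dirs_def)
next
  fix bs :: "'a list" assume *: "\<forall>b\<in>Basis. \<forall>bs\<in>dirs j. P (bs @ [b])" "bs \<in> dirs (Suc j)"
  then show "P bs"
    by (cases bs rule: rev_cases) (auto simp: dirs_def)
qed

lemma finite_dirs: "finite (dirs j)"
  unfolding dirs_def by (intro finite_lists_length_eq) simp

lemma dirs_nonempty: "dirs j \<noteq> {}"
proof -
  obtain b :: 'a where "b \<in> Basis"
    using nonempty_Basis by blast
  then have "replicate j b \<in> dirs j"
    by (auto simp: dirs_def)
  then show ?thesis by blast
qed

lemma holder_bd_iff:
  "holder_bd U \<alpha> k K f \<longleftrightarrow>
     (\<forall>j<k. \<forall>bs\<in>dirs j. \<forall>x\<in>U. pds U bs f differentiable (at x)) \<and>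
     (\<forall>j\<le>k. \<forall>bs\<in>dirs j. continuous_on (closure U) (pds U bs f) \<and>
                          (\<forall>x\<in>closure U. \<bar>pds U bs f x\<bar> \<le> K)) \<and>
     (\<forall>bs\<in>dirs k. \<forall>x\<in>closure U. \<forall>y\<in>closure U.
                          \<bar>pds U bs f x - pds U bs f y\<bar> \<le> K * dist x y powr \<alpha>)"
proof (induction k arbitrary: f)
  case 0
  then show ?case by (simp add: dirs_0)
next
  case (Suc k)
  show ?case
    unfolding holder_bd.simps(2) Suc.IH less_Suc_eq_le[symmetric] All_less_Suc2[of "Suc k"]
      All_less_Suc2[of k]
    by (simp only: ball_dirs_Suc dirs_0 pds_append) auto
qed

text \<open>\<open>holder_on\<close> allows every derivative its own bound. There are finitely many
  lists of basis vectors of each length, so the maximum is a common bound.\<close>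

lemma holder_on_iff_holder_bd: "holder_on U k \<alpha> f \<longleftrightarrow> (\<exists>K. holder_bd U \<alpha> k K f)"
proof
  assume f: "holder_on U k \<alpha> f"
  have "\<exists>K. \<forall>x\<in>closure U. \<bar>pds U bs f x\<bar> \<le> K" if "bs \<in> (\<Union>j\<le>k. dirs j)" for bs
  proof -
    have "bounded (pds U bs f ` closure U)"
      using f that unfolding holder_on_def by blast
    then show ?thesis
      unfolding bounded_iff by auto
  qed
  then obtain K1 where K1: "\<And>bs x. bs \<in> (\<Union>j\<le>k. dirs j) \<Longrightarrow> x \<in> closure U \<Longrightarrow> \<bar>pds U bs f x\<bar> \<le> K1 bs"
    by metis
  obtain K2 where K2: "\<And>bs x y. bs \<in> dirs k \<Longrightarrow> x \<in> closure U \<Longrightarrow> y \<in> closure U \<Longrightarrow>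
      \<bar>pds U bs f x - pds U bs f y\<bar> \<le> K2 bs * dist x y powr \<alpha>"
    using f unfolding holder_on_def by metis
  define K where "K = Max (K1 ` (\<Union>j\<le>k. dirs j) \<union> K2 ` dirs k)"
  have fin: "finite (K1 ` (\<Union>j\<le>k. dirs j) \<union> K2 ` dirs k)"
    using finite_dirs by blast
  have "\<bar>pds U bs f x\<bar> \<le> K" if "j \<le> k" "bs \<in> dirs j" "x \<in> closure U" for j bs x
  proof -
    have "K1 bs \<le> K"
      unfolding K_def using that by (intro Max_ge[OF fin]) auto
    moreover have "\<bar>pds U bs f x\<bar> \<le> K1 bs"
      using that by (intro K1) auto
    ultimately show ?thesis by linarith
  qed
  moreover have "\<bar>pds U bs f x - pds U bs f y\<bar> \<le> K * dist x y powr \<alpha>"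
    if "bs \<in> dirs k" "x \<in> closure U" "y \<in> closure U" for bs x y
  proof -
    have "K2 bs \<le> K"
      unfolding K_def using that by (intro Max_ge[OF fin]) auto
    then have "K2 bs * dist x y powr \<alpha> \<le> K * dist x y powr \<alpha>"
      by (intro mult_right_mono) auto
    then show ?thesis
      using K2[OF that] by linarith
  qed
  ultimately show "\<exists>K. holder_bd U \<alpha> k K f"
    using f unfolding holder_bd_iff holder_on_def by (intro exI[of _ K]) simp
next
  assume "\<exists>K. holder_bd U \<alpha> k K f"
  then show "holder_on U k \<alpha> f"
    unfolding holder_bd_iff holder_on_def by (force simp: bounded_iff)
qed

text \<open>Keeps the index set of the Hoelder quotients in \<open>holder_norm\<close> nonempty,
  where the supremum says something.\<close>

lemma closure_open_two_points:
  fixes U :: "'a::euclidean_space set"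
  assumes "open U" "U \<noteq> {}"
  obtains x y where "x \<in> closure U" "y \<in> closure U" "x \<noteq> y"
proof -
  obtain x where x: "x \<in> U"
    using assms by blast
  then have "U \<noteq> {x}"
    using assms(1) not_open_singleton by metis
  then show ?thesis
    using that x closure_subset by blast
qed

text \<open>The norm adds \<open>k + 1\<close> suprema and one Hoelder quotient, each at most
  \<open>K\<close>; conversely it dominates each of them because all are nonnegative and
  finite.\<close>

lemma
  fixes U :: "'a::euclidean_space set"
  assumes "open U" "U \<noteq> {}"
  shows holder_norm_le: "holder_bd U \<alpha> k K f \<Longrightarrow> holder_norm U k \<alpha> f \<le> real (k + 2) * K"
    and holder_bd_norm: "holder_on U k \<alpha> f \<Longrightarrow> holder_bd U \<alpha> k (holder_norm U k \<alpha> f) f"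
proof -
  obtain x0 y0 where xy: "x0 \<in> closure U" "y0 \<in> closure U" "x0 \<noteq> y0"
    using closure_open_two_points[OF assms] .
  define A where "A j = (dirs j :: 'a list set) \<times> closure U" for j
  define B where "B = {(bs :: 'a list, x, y). bs \<in> dirs k \<and> x \<in> closure U \<and> y \<in> closure U \<and> x \<noteq> y}"
  define p where "p = (\<lambda>(bs, x). \<bar>pds U bs f x\<bar>)"
  define q where "q = (\<lambda>(bs, x, y). \<bar>pds U bs f x - pds U bs f y\<bar> / dist x y powr \<alpha>)"
  have norm: "holder_norm U k \<alpha> f = (\<Sum>j\<le>k. Sup (p ` A j)) + Sup (q ` B)"
    unfolding holder_norm_def A_def B_def p_def q_def ..
  have A: "A j \<noteq> {}" for j
    unfolding A_def using dirs_nonempty assms by auto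
  have "B \<noteq> {}"
  proof -
    obtain bs :: "'a list" where "bs \<in> dirs k"
      using dirs_nonempty by blast
    then have "(bs, x0, y0) \<in> B"
      using xy by (simp add: B_def)
    then show ?thesis by blast
  qed
  have pK: "p z \<le> K" if "holder_bd U \<alpha> k K f" "j \<le> k" "z \<in> A j" for z j K
    using that unfolding A_def p_def holder_bd_iff by auto
  have qK: "q z \<le> K" if "holder_bd U \<alpha> k K f" "z \<in> B" for z K
    using that unfolding B_def q_def holder_bd_iff by (auto simp: field_simps)
  show "holder_norm U k \<alpha> f \<le> real (k + 2) * K" if f: "holder_bd U \<alpha> k K f"
  proof -
    have "(\<Sum>j\<le>k. Sup (p ` A j)) \<le> (\<Sum>j\<le>k. K)"
      using A pK[OF f] by (intro sum_mono cSUP_least) auto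
    moreover have "Sup (q ` B) \<le> K"
      using \<open>B \<noteq> {}\<close> qK[OF f] by (intro cSUP_least) auto
    ultimately show ?thesis
      unfolding norm by (simp add: algebra_simps)
  qed
  show "holder_bd U \<alpha> k (holder_norm U k \<alpha> f) f" if f: "holder_on U k \<alpha> f"
  proof -
    obtain K where K: "holder_bd U \<alpha> k K f"
      using f holder_on_iff_holder_bd by blast
    have bA: "bdd_above (p ` A j)" if "j \<le> k" for j
      using pK[OF K that] by (meson bdd_aboveI2)
    have bB: "bdd_above (q ` B)"
      using qK[OF K] by (meson bdd_aboveI2)
    have p0: "0 \<le> p z" and q0: "0 \<le> q w" for z w
      unfolding p_def q_def by (auto split: prod.split)
    have sA: "0 \<le> Sup (p ` A j)" if "j \<le> k" for j
      using cSUP_upper2[OF bA[OF that]] A p0 by (metis equals0I)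
    have sB: "0 \<le> Sup (q ` B)"
      using cSUP_upper2[OF bB] \<open>B \<noteq> {}\<close> q0 by (metis equals0I)
    have "\<bar>pds U bs f x\<bar> \<le> holder_norm U k \<alpha> f" if "j \<le> k" "bs \<in> dirs j" "x \<in> closure U" for j bs x
    proof -
      have "p (bs, x) \<le> Sup (p ` A j)"
        using that by (intro cSUP_upper bA) (auto simp: A_def)
      also have "\<dots> \<le> (\<Sum>j\<le>k. Sup (p ` A j))"
        using that sA by (intro member_le_sum) auto
      finally show ?thesis
        using sB unfolding norm by (simp add: p_def)
    qed
    moreover have "\<bar>pds U bs f x - pds U bs f y\<bar> \<le> holder_norm U k \<alpha> f * dist x y powr \<alpha>"
      if "bs \<in> dirs k" "x \<in> closure U" "y \<in> closure U" for bs x y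
    proof (cases "x = y")
      case False
      have "q (bs, x, y) \<le> Sup (q ` B)"
        using that False by (intro cSUP_upper bB) (auto simp: B_def)
      moreover have "0 \<le> (\<Sum>j\<le>k. Sup (p ` A j))"
        using sA by (intro sum_nonneg) auto
      ultimately have "q (bs, x, y) \<le> holder_norm U k \<alpha> f"
        unfolding norm by linarith
      then show ?thesis
        using False by (simp add: q_def field_simps)
    qed simp
    ultimately show ?thesis
      using K unfolding holder_bd_iff by simp
  qed
qed

section \<open>Linearity of extended derivatives and of the function spaces\<close>

lemma pds_cong:
  assumes "open U" "\<And>x. x \<in> closure U \<Longrightarrow> f x = g x" "x \<in> closure U"
  shows "pds U bs f x = pds U bs g x"
  using assms(2,3)
proof (induction bs arbitrary: x)
  case (Cons b bs)
  have "pd U b (pds U bs f) x = pd U b (pds U bs g) x"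
    using Cons closure_subset by (intro pd_cong assms(1)) blast
  then show ?case by simp
qed auto

text \<open>At boundary points this rests on the existence of the limits in \<open>pd\<close>, which
  the continuity of the derivatives on the closure provides.\<close>

lemma pds_linear:
  assumes "open U" "holder_on U k \<alpha> f" "holder_on U k \<alpha> g" "bs \<in> dirs j" "j \<le> k" "x \<in> closure U"
  shows "pds U bs (\<lambda>x. f x + c * g x) x = pds U bs f x + c * pds U bs g x"
  using assms(2-5)
proof (induction j arbitrary: k f g bs)
  case 0
  then show ?case by (simp add: dirs_0)
next
  case (Suc j)
  obtain i where k: "k = Suc i" "j \<le> i"
    using Suc.prems(4) by (metis Suc_le_D Suc_le_mono)
  obtain b bs' where bs: "bs = bs' @ [b]" "b \<in> Basis" "bs' \<in> dirs j"
    using Suc.prems(3) by (cases bs rule: rev_cases) (auto simp: dirs_def)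
  obtain K L where K: "holder_bd U \<alpha> (Suc i) K f" and L: "holder_bd U \<alpha> (Suc i) L g"
    using Suc.prems k holder_on_iff_holder_bd by blast
  have hf: "holder_on U i \<alpha> (pd U b f)" and hg: "holder_on U i \<alpha> (pd U b g)"
    using K L bs(2) unfolding holder_on_iff_holder_bd by auto
  have c: "continuous_on (closure U) (\<lambda>x. pd U b f x + c * pd U b g x)"
    using K L bs(2) holder_bd_continuous[of U \<alpha> i K] holder_bd_continuous[of U \<alpha> i L]
    by (intro continuous_intros) auto
  have "pd U b (\<lambda>x. f x + c * g x) y = pd U b f y + c * pd U b g y" if "y \<in> closure U" for y
  proof (rule pd_eq_on_closure[OF assms(1) c _ _ that])
    show "((\<lambda>x. f x + c * g x) has_derivative
        (\<lambda>h. frechet_derivative f (at x) h + c * frechet_derivative g (at x) h)) (at x)" if "x \<in> U" for x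
      by (intro has_derivative_add has_derivative_mult_right holder_bd_SucD(1)[OF K that] holder_bd_SucD(1)[OF L that])
  qed (simp add: pd_def)
  then have "pds U bs (\<lambda>x. f x + c * g x) x = pds U bs' (\<lambda>x. pd U b f x + c * pd U b g x) x"
    unfolding bs(1) pds_append by (rule pds_cong[OF assms(1) _ assms(6)])
  also have "\<dots> = pds U bs' (pd U b f) x + c * pds U bs' (pd U b g) x"
    using Suc.IH[OF hf hg bs(3) k(2)] .
  finally show ?case
    by (simp add: bs(1) pds_append)
qed

lemma holder_on_linear:
  assumes "open U" "holder_on U k \<alpha> f" "holder_on U k \<alpha> g"
  shows "holder_on U k \<alpha> (\<lambda>x. f x + c * g x)"
  using assms(2,3) holder_bd_add[OF assms(1)] holder_bd_cmult[OF assms(1)]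
  unfolding holder_on_iff_holder_bd by meson

lemma holder_space_linear:
  assumes "open U" "f \<in> holder_space U k \<alpha>" "g \<in> holder_space U k \<alpha>"
  shows "(\<lambda>x. f x + c * g x) \<in> holder_space U k \<alpha>"
  using assms holder_on_linear unfolding holder_space_def by auto

lemma holder_space_zero: "open U \<Longrightarrow> (\<lambda>_. 0) \<in> holder_space U k \<alpha>"
  unfolding holder_space_def holder_on_iff_holder_bd using holder_bd_const[of U 0 0] by auto

lemma bdry_space_linear:
  assumes "open U" "f \<in> bdry_space U k \<alpha>" "g \<in> bdry_space U k \<alpha>"
  shows "(\<lambda>x. f x + c * g x) \<in> bdry_space U k \<alpha>"
proof -
  obtain F G where "F \<in> holder_space U k \<alpha>" "G \<in> holder_space U k \<alpha>"
    "\<forall>x\<in>frontier U. F x = f x" "\<forall>x\<in>frontier U. G x = g x"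
    using assms(2,3) unfolding bdry_space_def by blast
  then show ?thesis
    using assms holder_space_linear[of U F k \<alpha> G c] unfolding bdry_space_def
    by (auto intro!: bexI[of _ "\<lambda>x. F x + c * G x"])
qed

lemma bdry_space_zero: "open U \<Longrightarrow> (\<lambda>_. 0) \<in> bdry_space U k \<alpha>"
  unfolding bdry_space_def using holder_space_zero by fastforce

section \<open>The quotient norm on the boundary\<close>

lemma holder_norm_nonneg:
  assumes "open U" "U \<noteq> {}" "holder_on U k \<alpha> f"
  shows "0 \<le> holder_norm U k \<alpha> f"
  using holder_bd_nonneg[OF holder_bd_norm[OF assms] assms(2)] .

lemma bdry_norm_le:
  assumes "open U" "U \<noteq> {}" "F \<in> holder_space U k \<alpha>" "\<And>x. x \<in> frontier U \<Longrightarrow> F x = f x"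
  shows "bdry_norm U k \<alpha> f \<le> holder_norm U k \<alpha> F"
  unfolding bdry_norm_def
proof (rule cINF_lower)
  show "bdd_below (holder_norm U k \<alpha> ` {F \<in> holder_space U k \<alpha>. \<forall>x\<in>frontier U. F x = f x})"
    using holder_norm_nonneg[OF assms(1,2)] by (intro bdd_belowI2[of _ 0]) (auto simp: holder_space_def)
qed (use assms in auto)

lemma le_bdry_norm:
  assumes "f \<in> bdry_space U k \<alpha>"
    and "\<And>F. F \<in> holder_space U k \<alpha> \<Longrightarrow> (\<And>x. x \<in> frontier U \<Longrightarrow> F x = f x) \<Longrightarrow> c \<le> holder_norm U k \<alpha> F"
  shows "c \<le> bdry_norm U k \<alpha> f"
  unfolding bdry_norm_def using assms by (intro cINF_greatest) (auto simp: bdry_space_def)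

lemma bdry_norm_nonneg:
  assumes "open U" "U \<noteq> {}" "f \<in> bdry_space U k \<alpha>"
  shows "0 \<le> bdry_norm U k \<alpha> f"
  using assms(3) holder_norm_nonneg[OF assms(1,2)]
  by (intro le_bdry_norm) (auto simp: holder_space_def)

text \<open>Every extension bounds the value at \<open>x\<close> by its own norm, hence so does the
  infimum. Evaluation at a frontier point is thus continuous.\<close>

lemma abs_le_bdry_norm:
  assumes "open U" "U \<noteq> {}" "f \<in> bdry_space U k \<alpha>" "x \<in> frontier U"
  shows "\<bar>f x\<bar> \<le> bdry_norm U k \<alpha> f"
proof (rule le_bdry_norm[OF assms(3)])
  fix F assume F: "F \<in> holder_space U k \<alpha>" "\<And>x. x \<in> frontier U \<Longrightarrow> F x = f x"
  have "x \<in> closure U"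
    using assms(4) by (simp add: frontier_def)
  then have "\<bar>F x\<bar> \<le> holder_norm U k \<alpha> F"
    using F(1) holder_bd_norm[OF assms(1,2)] holder_bd_le unfolding holder_space_def by blast
  then show "\<bar>f x\<bar> \<le> holder_norm U k \<alpha> F"
    using F(2)[OF assms(4)] by simp
qed

text \<open>The factor \<open>k + 2\<close> comes from passing through \<open>holder_bd\<close>. It
  is harmless: the bound is applied for \<open>t\<close> tending to zero and at
  \<open>t = 0\<close>.\<close>

lemma bdry_norm_scale:
  assumes "open U" "U \<noteq> {}" "f \<in> bdry_space U k \<alpha>"
  shows "bdry_norm U k \<alpha> (\<lambda>x. t * f x) \<le> real (k + 2) * \<bar>t\<bar> * bdry_norm U k \<alpha> f"
proof (cases "t = 0")
  case True
  have "bdry_norm U k \<alpha> (\<lambda>x. 0) \<le> holder_norm U k \<alpha> (\<lambda>x. 0)"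
    using holder_space_zero[OF assms(1)] by (intro bdry_norm_le assms) auto
  also have "\<dots> \<le> real (k + 2) * 0"
    using holder_bd_const[OF assms(1), of 0 0] by (intro holder_norm_le assms) auto
  finally show ?thesis
    using True by simp
next
  case False
  have "bdry_norm U k \<alpha> (\<lambda>x. t * f x) / (real (k + 2) * \<bar>t\<bar>) \<le> bdry_norm U k \<alpha> f"
  proof (rule le_bdry_norm[OF assms(3)])
    fix F assume F: "F \<in> holder_space U k \<alpha>" "\<And>x. x \<in> frontier U \<Longrightarrow> F x = f x"
    have tF: "(\<lambda>x. t * F x) \<in> holder_space U k \<alpha>"
      using holder_space_linear[OF assms(1) holder_space_zero[OF assms(1)] F(1)] by simp
    have "bdry_norm U k \<alpha> (\<lambda>x. t * f x) \<le> holder_norm U k \<alpha> (\<lambda>x. t * F x)"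
      using F by (intro bdry_norm_le assms tF) auto
    also have "\<dots> \<le> real (k + 2) * (\<bar>t\<bar> * holder_norm U k \<alpha> F)"
      using F by (intro holder_norm_le holder_bd_cmult holder_bd_norm assms) (auto simp: holder_space_def)
    finally show "bdry_norm U k \<alpha> (\<lambda>x. t * f x) / (real (k + 2) * \<bar>t\<bar>) \<le> holder_norm U k \<alpha> F"
      using False by (simp add: divide_le_eq mult.assoc mult.commute mult.left_commute)
  qed
  then show ?thesis
    using False by (simp add: divide_le_eq mult.assoc mult.commute mult.left_commute)
qed


section \<open>Cofactors and positive definite matrices\<close>

text \<open>In the Leibniz sum only permutations sending \<open>i\<close> to \<open>j\<close>
  survive on either side, and for these no other entry of column \<open>j\<close> occurs. So
  clearing that column has no effect.\<close>

lemma cof_eq_det_row: "cof A $ i $ j = det (\<chi> k. if k = i then axis j 1 else A $ k)"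
proof -
  have "(\<Prod>k\<in>UNIV. (\<chi> k l. if k = i \<and> l = j then 1 else if k = i \<or> l = j then 0 else A $ k $ l) $ k $ p k)
      = (\<Prod>k\<in>UNIV. (\<chi> k. if k = i then axis j 1 else A $ k) $ k $ p k)"
    if p: "p permutes UNIV" for p
  proof (cases "p i = j")
    case True
    then have "p k = j \<longleftrightarrow> k = i" for k
      using permutes_inj[OF p] by (metis injD)
    then show ?thesis
      by (intro prod.cong) (auto simp: axis_def)
  next
    case False
    then show ?thesis
      by (intro trans[OF prod_zero prod_zero[symmetric]] bexI[of _ i]) (auto simp: axis_def)
  qed
  then show ?thesis
    unfolding cof_def vec_lambda_beta det_def by (intro sum.cong) auto
qed

text \<open>Laplace expansion with an arbitrary row inserted. The derivative of a row will give
  Jacobi's formula, and a row of \<open>A\<close> the adjugate identity.\<close>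

lemma det_row_expand:
  fixes A :: "real^'n^'n"
  shows "det (\<chi> k. if k = i then v else A $ k) = (\<Sum>j\<in>UNIV. v $ j * cof A $ i $ j)"
proof -
  have "det (\<chi> k. if k = i then v else A $ k)
      = det (\<chi> k. if k = i then (\<Sum>j\<in>UNIV. v $ j *s axis j 1) else A $ k)"
    unfolding basis_expansion ..
  also have "\<dots> = (\<Sum>j\<in>UNIV. det (\<chi> k. if k = i then v $ j *s axis j 1 else A $ k))"
    by (rule det_linear_row_sum) simp
  also have "\<dots> = (\<Sum>j\<in>UNIV. v $ j * cof A $ i $ j)"
    unfolding cof_eq_det_row
    using det_row_mul[of i _ "\<lambda>_. axis _ 1" "\<lambda>k. A $ k"] by (intro sum.cong refl)
  finally show ?thesis .
qed

text \<open>Jacobi's formula: the product rule in the Leibniz sum differentiates one row at a time,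
  and each resulting determinant is expanded along that row.\<close>

lemma has_real_derivative_det:
  fixes A :: "real \<Rightarrow> real^'n^'n"
  assumes "\<And>i j. ((\<lambda>t. A t $ i $ j) has_real_derivative B $ i $ j) (at t0)"
  shows "((\<lambda>t. det (A t)) has_real_derivative (\<Sum>i\<in>UNIV. \<Sum>j\<in>UNIV. B $ i $ j * cof (A t0) $ i $ j)) (at t0)"
proof -
  have "((\<lambda>t. det (A t)) has_real_derivative
      (\<Sum>p | p permutes UNIV. of_int (sign p) * (\<Sum>i\<in>UNIV. B $ i $ p i * (\<Prod>j\<in>UNIV - {i}. A t0 $ j $ p j)))) (at t0)"
    unfolding det_def by (intro DERIV_sum DERIV_cmult has_field_derivative_prod assms)
  also have "(\<Sum>p | p permutes UNIV. of_int (sign p) * (\<Sum>i\<in>UNIV. B $ i $ p i * (\<Prod>j\<in>UNIV - {i}. A t0 $ j $ p j)))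
      = (\<Sum>i\<in>UNIV. det (\<chi> k. if k = i then B $ i else A t0 $ k))"
    unfolding det_def sum_distrib_left
  proof (subst sum.swap, intro sum.cong refl)
    fix i :: 'n and p :: "'n \<Rightarrow> 'n"
    have "(\<Prod>k\<in>UNIV. (\<chi> k. if k = i then B $ i else A t0 $ k) $ k $ p k)
        = B $ i $ p i * (\<Prod>k\<in>UNIV - {i}. (\<chi> k. if k = i then B $ i else A t0 $ k) $ k $ p k)"
      by (subst prod.remove[of _ i]) auto
    also have "(\<Prod>k\<in>UNIV - {i}. (\<chi> k. if k = i then B $ i else A t0 $ k) $ k $ p k)
        = (\<Prod>k\<in>UNIV - {i}. A t0 $ k $ p k)"
      by (intro prod.cong) auto
    finally show "of_int (sign p) * (B $ i $ p i * (\<Prod>j\<in>UNIV - {i}. A t0 $ j $ p j))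
        = of_int (sign p) * (\<Prod>k\<in>UNIV. (\<chi> k. if k = i then B $ i else A t0 $ k) $ k $ p k)"
      by simp
  qed
  finally show ?thesis
    unfolding det_row_expand .
qed

lemma cof_mult_transpose:
  fixes A :: "real^'n^'n"
  shows "cof A ** transpose A = mat (det A)"
proof -
  have "(\<Sum>k\<in>UNIV. cof A $ i $ k * A $ j $ k) = (if i = j then det A else 0)" for i j
  proof -
    have "(\<Sum>k\<in>UNIV. cof A $ i $ k * A $ j $ k) = det (\<chi> k. if k = i then A $ j else A $ k)"
      by (simp add: det_row_expand mult.commute)
    also have "\<dots> = (if i = j then det A else 0)"
    proof (cases "i = j")
      case True
      then have "(\<chi> k. if k = i then A $ j else A $ k) = A"
        by (simp add: vec_eq_iff)
      then show ?thesis using True by simp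
    next
      case False
      then show ?thesis
        by (simp add: det_identical_rows[of i j] row_def vec_eq_iff)
    qed
    finally show ?thesis .
  qed
  then show ?thesis
    by (simp add: vec_eq_iff matrix_matrix_mult_def transpose_def mat_def)
qed

text \<open>Along the segment from the identity to \<open>A\<close> the quadratic form stays
  positive, so the determinant never vanishes and keeps its initial sign. Eigenvalues are avoided
  because the Hessian at boundary points is not known to be symmetric at this stage.\<close>

lemma det_pos_if_pos_def:
  fixes A :: "real^'n^'n"
  assumes "\<And>x. x \<noteq> 0 \<Longrightarrow> x \<bullet> (A *v x) > 0"
  shows "det A > 0"
proof -
  define M where "M t = (1 - t) *\<^sub>R mat 1 + t *\<^sub>R A" for t :: real
  have nz: "det (M t) \<noteq> 0" if "0 \<le> t" "t \<le> 1" for t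
  proof -
    have "x = 0" if x: "M t *v x = 0" for x
    proof (rule ccontr)
      assume "x \<noteq> 0"
      have "0 < (1 - t) * (x \<bullet> x) + t * (x \<bullet> (A *v x))"
      proof (cases "t = 0")
        case False
        then have "0 < t * (x \<bullet> (A *v x))"
          using \<open>0 \<le> t\<close> assms[OF \<open>x \<noteq> 0\<close>] by simp
        moreover have "0 \<le> (1 - t) * (x \<bullet> x)"
          using \<open>t \<le> 1\<close> by simp
        ultimately show ?thesis by linarith
      qed (use \<open>x \<noteq> 0\<close> in simp)
      also have "\<dots> = x \<bullet> (M t *v x)"
        unfolding M_def by (simp add: matrix_vector_mult_add_rdistrib inner_add_right
            scaleR_matrix_vector_assoc[symmetric])
      finally show False using x by simp
    qed
    then show ?thesis
      using invertible_det_nz[of "M t"] matrix_left_invertible_ker[of "M t"]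
      by (simp add: invertible_left_inverse)
  qed
  have "continuous_on {0..1} (\<lambda>t. det (M t))"
    unfolding det_def M_def by (intro continuous_intros)
  moreover have "det (M 0) = 1" "det (M 1) = det A"
    by (simp_all add: M_def)
  ultimately show ?thesis
    using IVT2'[of "\<lambda>t. det (M t)" 1 0 0] nz by (metis less_eq_real_def linorder_not_le zero_le_one atLeastAtMost_iff)
qed

text \<open>Put \<open>\<xi> = transpose A *v y\<close>. The adjugate identity gives
  \<open>cof A *v \<xi> = det A *\<^sub>R y\<close>, so the form equals
  \<open>det A * (y \<bullet> (A *v y))\<close>.\<close>

lemma cof_pos_def:
  fixes A :: "real^'n^'n"
  assumes "\<And>x. x \<noteq> 0 \<Longrightarrow> x \<bullet> (A *v x) > 0" "\<xi> \<noteq> 0"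
  shows "\<xi> \<bullet> (cof A *v \<xi>) > 0"
proof -
  have d: "det A > 0"
    using det_pos_if_pos_def assms(1) by blast
  then have "invertible (transpose A)"
    by (simp add: invertible_det_nz)
  then obtain B where B: "transpose A ** B = mat 1"
    unfolding invertible_def by blast
  define y where "y = B *v \<xi>"
  have \<xi>: "transpose A *v y = \<xi>"
    by (simp add: y_def matrix_vector_mul_assoc B)
  then have "y \<noteq> 0"
    using assms(2) by auto
  have "cof A *v \<xi> = mat (det A) *v y"
    unfolding \<xi>[symmetric] matrix_vector_mul_assoc cof_mult_transpose ..
  also have "\<dots> = det A *\<^sub>R y"
    by (simp add: vec_eq_iff matrix_vector_mult_def mat_def if_distrib[of "\<lambda>x. x * _"] cong: if_cong)
  finally have 1: "cof A *v \<xi> = det A *\<^sub>R y" .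
  have "\<xi> \<bullet> y = y \<bullet> (A *v y)"
    unfolding \<xi>[symmetric] by (simp add: dot_lmul_matrix)
  with 1 have "\<xi> \<bullet> (cof A *v \<xi>) = det A * (y \<bullet> (A *v y))"
    by simp
  then show ?thesis
    using d assms(1)[OF \<open>y \<noteq> 0\<close>] by simp
qed

lemma inner_axis_matrix: "axis i (1::real) \<bullet> (B *v axis j 1) = B $ i $ j"
  by (simp add: inner_axis' matrix_vector_mult_basis column_def)

text \<open>With a zero diagonal entry the form at \<open>s *\<^sub>R axis i 1 + axis j 1\<close> is
  affine in \<open>s\<close>. A nonzero slope lets it reach -1, which is how \<open>s\<close> is
  chosen.\<close>

lemma psd_zero_diag:
  fixes B :: "real^'n^'n"
  assumes "transpose B = B" "\<And>x. 0 \<le> x \<bullet> (B *v x)" "B $ i $ i = 0"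
  shows "B $ i $ j = 0"
proof (rule ccontr)
  assume nz: "B $ i $ j \<noteq> 0"
  have sym: "B $ j $ i = B $ i $ j"
    using assms(1) by (metis transpose_def vec_lambda_beta)
  define s where "s = - (B $ j $ j + 1) / (2 * B $ i $ j)"
  have "(s *\<^sub>R axis i 1 + axis j 1) \<bullet> (B *v (s *\<^sub>R axis i 1 + axis j 1))
      = s * (s * (B $ i $ i)) + s * B $ i $ j + s * B $ j $ i + B $ j $ j"
    by (simp add: matrix_vector_right_distrib matrix_vector_mult_scaleR inner_add_left inner_add_right
        inner_axis_matrix algebra_simps)
  also have "\<dots> = -1"
    using nz sym assms(3) by (simp add: s_def field_simps)
  finally show False
    using assms(2)[of "s *\<^sub>R axis i 1 + axis j 1"] by linarith
qed

text \<open>Subtracting the rank one matrices \<open>B e\<^sub>p (B e\<^sub>p)\<^sup>T / B\<^sub>p\<^sub>p\<close> one after the other writes \<open>B\<close> as a sum of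
  positive semidefinite rank one matrices.\<close>

lemma frobenius_psd_nonneg:
  fixes B C :: "real^'n^'n"
  assumes "transpose B = B" "\<And>x. 0 \<le> x \<bullet> (B *v x)" "\<And>x. 0 \<le> x \<bullet> (C *v x)"
  shows "0 \<le> (\<Sum>i\<in>UNIV. \<Sum>j\<in>UNIV. C $ i $ j * B $ i $ j)"
  using assms(1,2)
proof (induction "card {i. B $ i $ i \<noteq> 0}" arbitrary: B rule: less_induct)
  case less
  show ?case
  proof (cases "\<forall>i. B $ i $ i = 0")
    case True
    then show ?thesis
      using psd_zero_diag[OF less.prems] by simp
  next
    case False
    then obtain p where p: "B $ p $ p \<noteq> 0" by blast
    have sym: "B $ i $ j = B $ j $ i" for i j
      using less.prems(1) by (metis transpose_def vec_lambda_beta)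
    have pp: "B $ p $ p > 0"
      using less.prems(2)[of "axis p 1"] p by (simp add: inner_axis_matrix)
    define v where "v = column p B"
    define B' where "B' = (\<chi> i j. B $ i $ j - v $ i * v $ j / B $ p $ p)"
    have "transpose B' = B'"
      by (simp add: B'_def transpose_def vec_eq_iff sym mult.commute)
    moreover have "0 \<le> x \<bullet> (B' *v x)" for x
    proof -
      \<comment> \<open>Completing the square: \<open>c\<close> is the shift along the basis vector
        \<open>p\<close> that minimises the form of \<open>B\<close>, and the minimum is the form of
        \<open>B'\<close> at \<open>x\<close>.\<close>
      define c where "c = (v \<bullet> x) / B $ p $ p"
      have vB: "axis p 1 \<bullet> (B *v y) = v \<bullet> y" for y
        unfolding inner_axis' by (simp add: matrix_vector_mult_def v_def column_def inner_vec_def sym[of p])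
      have xB: "x \<bullet> (B *v axis p 1) = v \<bullet> x"
        by (simp add: matrix_vector_mult_basis v_def inner_commute)
      have "B' *v x = B *v x - ((v \<bullet> x) / B $ p $ p) *\<^sub>R v"
        unfolding B'_def
        by (simp add: vec_eq_iff matrix_vector_mult_def inner_vec_def algebra_simps sum_subtractf
            sum_divide_distrib sum_distrib_left sum_distrib_right)
      then have "x \<bullet> (B' *v x) = x \<bullet> (B *v x) - c * (v \<bullet> x)"
        by (simp add: inner_diff_right c_def inner_commute)
      also have "\<dots> = (x - c *\<^sub>R axis p 1) \<bullet> (B *v (x - c *\<^sub>R axis p 1))"
        using pp by (simp add: matrix_vector_mult_diff_distrib matrix_vector_mult_scaleR inner_diff_left
            inner_diff_right vB xB inner_axis_matrix) (simp add: c_def)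
      finally show ?thesis
        using less.prems(2) by simp
    qed
    \<comment> \<open>A vanishing diagonal entry comes with a vanishing row, so the subtraction
      revives no old zero while it creates a new one at \<open>p\<close>.\<close>
    moreover have "card {i. B' $ i $ i \<noteq> 0} < card {i. B $ i $ i \<noteq> 0}"
    proof (rule psubset_card_mono)
      have "B' $ i $ i = 0" if "B $ i $ i = 0" for i
        using psd_zero_diag[OF less.prems that, of p] that by (simp add: B'_def v_def column_def)
      moreover have "B' $ p $ p = 0"
        using p by (simp add: B'_def v_def column_def)
      ultimately show "{i. B' $ i $ i \<noteq> 0} \<subset> {i. B $ i $ i \<noteq> 0}"
        using p by blast
    qed simp
    ultimately have IH: "0 \<le> (\<Sum>i\<in>UNIV. \<Sum>j\<in>UNIV. C $ i $ j * B' $ i $ j)"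
      using less.hyps by blast
    have "(\<Sum>i\<in>UNIV. \<Sum>j\<in>UNIV. C $ i $ j * B $ i $ j)
        = (\<Sum>i\<in>UNIV. \<Sum>j\<in>UNIV. C $ i $ j * B' $ i $ j + v $ i * (C $ i $ j * v $ j) / B $ p $ p)"
      by (intro sum.cong refl) (simp add: B'_def algebra_simps)
    also have "\<dots> = (\<Sum>i\<in>UNIV. \<Sum>j\<in>UNIV. C $ i $ j * B' $ i $ j) + v \<bullet> (C *v v) / B $ p $ p"
      by (simp add: sum.distrib inner_vec_def matrix_vector_mult_def sum_distrib_left sum_divide_distrib)
    finally show ?thesis
      using IH assms(3)[of v] pp by simp
  qed
qed


section \<open>Symmetry of the Hessian and the maximum principle\<close>

text \<open>The mean value theorem twice: along \<open>e\<close> for the increment of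
  \<open>f\<close> in direction \<open>d\<close>, then along \<open>d\<close> for the derivative in
  direction \<open>e\<close>.\<close>

lemma mixed_difference:
  fixes f :: "'a::euclidean_space \<Rightarrow> real"
  assumes "ball x r \<subseteq> U" "norm d \<le> 1" "norm e \<le> 1" "h > 0" "2 * h < r"
    and f: "\<And>y. y \<in> U \<Longrightarrow> (f has_derivative D y) (at y)"
    and Df: "\<And>y. y \<in> U \<Longrightarrow> ((\<lambda>y. D y e) has_derivative D2 y) (at y)"
  shows "\<exists>p\<in>cball x (2 * h).
      f (x + h *\<^sub>R e + h *\<^sub>R d) - f (x + h *\<^sub>R e) - f (x + h *\<^sub>R d) + f x = h * h * D2 p d"
proof -
  have cb: "x + s *\<^sub>R e + t *\<^sub>R d \<in> cball x (2 * h)" if "0 \<le> s" "s \<le> h" "0 \<le> t" "t \<le> h" for s t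
  proof -
    have "norm (s *\<^sub>R e + t *\<^sub>R d) \<le> s * norm e + t * norm d"
      using norm_triangle_ineq[of "s *\<^sub>R e" "t *\<^sub>R d"] that by simp
    also have "\<dots> \<le> h * 1 + h * 1"
      using that assms(2-4) by (intro add_mono mult_mono) auto
    finally have "norm (s *\<^sub>R e + t *\<^sub>R d) \<le> 2 * h" by simp
    moreover have "dist x (x + s *\<^sub>R e + t *\<^sub>R d) = norm (s *\<^sub>R e + t *\<^sub>R d)"
      unfolding dist_norm by (subst norm_minus_commute) (simp add: algebra_simps)
    ultimately show ?thesis by simp
  qed
  have inU: "x + s *\<^sub>R e + t *\<^sub>R d \<in> U" if "0 \<le> s" "s \<le> h" "0 \<le> t" "t \<le> h" for s t
    using cb[OF that] assms(1,5) by (auto simp: subset_iff)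
  \<comment> \<open>The term \<open>0 *\<^sub>R d\<close> gives both summands the shape treated by
    \<open>line\<close>.\<close>
  define \<phi> where "\<phi> s = f (x + s *\<^sub>R e + h *\<^sub>R d) - f (x + s *\<^sub>R e + 0 *\<^sub>R d)" for s
  have line: "((\<lambda>s. f (x + s *\<^sub>R e + t *\<^sub>R d)) has_real_derivative D (x + s *\<^sub>R e + t *\<^sub>R d) e) (at s)"
    if "0 \<le> s" "s \<le> h" "0 \<le> t" "t \<le> h" for s t
  proof -
    have "((\<lambda>s. x + s *\<^sub>R e + t *\<^sub>R d) has_derivative (\<lambda>h. h *\<^sub>R e)) (at s)"
      by (auto intro!: derivative_eq_intros)
    from has_derivative_compose[OF this f[OF inU[OF that]]]
    show ?thesis
      using linear_cmul[OF has_derivative_linear[OF f[OF inU[OF that]]]]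
      by (simp add: has_field_derivative_def mult_commute_abs)
  qed
  have "\<exists>s. 0 < s \<and> s < h \<and> \<phi> h - \<phi> 0 = (h - 0) * (D (x + s *\<^sub>R e + h *\<^sub>R d) e - D (x + s *\<^sub>R e + 0 *\<^sub>R d) e)"
    unfolding \<phi>_def using assms(4) by (intro MVT2 DERIV_diff line) auto
  then obtain s where s: "0 < s" "s < h"
    "\<phi> h - \<phi> 0 = h * (D (x + s *\<^sub>R e + h *\<^sub>R d) e - D (x + s *\<^sub>R e + 0 *\<^sub>R d) e)"
    by auto
  have "\<exists>t. 0 < t \<and> t < h \<and> D (x + s *\<^sub>R e + h *\<^sub>R d) e - D (x + s *\<^sub>R e + 0 *\<^sub>R d) e
      = (h - 0) * D2 (x + s *\<^sub>R e + t *\<^sub>R d) d"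
  proof (rule MVT2)
    fix t assume t: "0 \<le> t" "t \<le> h"
    have m: "x + s *\<^sub>R e + t *\<^sub>R d \<in> U"
      using inU[of s t] s t by simp
    have "((\<lambda>t. x + s *\<^sub>R e + t *\<^sub>R d) has_derivative (\<lambda>h. h *\<^sub>R d)) (at t)"
      by (auto intro!: derivative_eq_intros)
    from has_derivative_compose[OF this Df[OF m]]
    show "((\<lambda>t. D (x + s *\<^sub>R e + t *\<^sub>R d) e) has_real_derivative D2 (x + s *\<^sub>R e + t *\<^sub>R d) d) (at t)"
      using linear_cmul[OF has_derivative_linear[OF Df[OF m]]]
      by (simp add: has_field_derivative_def mult_commute_abs)
  qed (use assms in auto)
  then obtain t where t: "0 < t" "t < h" "D (x + s *\<^sub>R e + h *\<^sub>R d) e - D (x + s *\<^sub>R e + 0 *\<^sub>R d) e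
      = h * D2 (x + s *\<^sub>R e + t *\<^sub>R d) d"
    by auto
  show ?thesis
    using s t cb[of s t] by (intro bexI[of _ "x + s *\<^sub>R e + t *\<^sub>R d"]) (auto simp: \<phi>_def)
qed

text \<open>The mixed difference is unchanged when \<open>d\<close> and \<open>e\<close> are
  exchanged, so the two second derivatives agree at points \<open>p\<close> and \<open>q\<close>
  near \<open>x\<close>. Continuity transfers this to \<open>x\<close>.\<close>

lemma symmetric_mixed_derivative:
  fixes f :: "'a::euclidean_space \<Rightarrow> real"
  assumes "open U" "x \<in> U" "norm d \<le> 1" "norm e \<le> 1"
    and f: "\<And>y. y \<in> U \<Longrightarrow> (f has_derivative D y) (at y)"
    and De: "\<And>y. y \<in> U \<Longrightarrow> ((\<lambda>y. D y e) has_derivative D2e y) (at y)"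
    and Dd: "\<And>y. y \<in> U \<Longrightarrow> ((\<lambda>y. D y d) has_derivative D2d y) (at y)"
    and ce: "continuous_on U (\<lambda>y. D2e y d)" and cd: "continuous_on U (\<lambda>y. D2d y e)"
  shows "D2e x d = D2d x e"
proof (rule ccontr)
  assume ne: "D2e x d \<noteq> D2d x e"
  define \<epsilon> where "\<epsilon> = \<bar>D2e x d - D2d x e\<bar> / 2"
  have \<epsilon>: "\<epsilon> > 0"
    using ne by (simp add: \<epsilon>_def)
  obtain r0 where r0: "r0 > 0" "ball x r0 \<subseteq> U"
    using assms(1,2) open_contains_ball by blast
  have "isCont (\<lambda>y. D2e y d) x" "isCont (\<lambda>y. D2d y e) x"
    using ce cd assms(1,2) continuous_on_eq_continuous_at by blast+
  then obtain r1 r2 where r: "r1 > 0" "\<And>y. dist y x < r1 \<Longrightarrow> dist (D2e y d) (D2e x d) < \<epsilon>"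
    "r2 > 0" "\<And>y. dist y x < r2 \<Longrightarrow> dist (D2d y e) (D2d x e) < \<epsilon>"
    using \<epsilon> unfolding continuous_at_eps_delta by metis
  define h where "h = min r0 (min r1 r2) / 4"
  have h: "h > 0" "2 * h < r0" "2 * h < r1" "2 * h < r2"
    using r0 r by (auto simp: h_def)
  obtain p where p: "p \<in> cball x (2 * h)"
    "f (x + h *\<^sub>R e + h *\<^sub>R d) - f (x + h *\<^sub>R e) - f (x + h *\<^sub>R d) + f x = h * h * D2e p d"
    using mixed_difference[OF r0(2) assms(3,4) h(1,2) f De] by blast
  obtain q where q: "q \<in> cball x (2 * h)"
    "f (x + h *\<^sub>R d + h *\<^sub>R e) - f (x + h *\<^sub>R d) - f (x + h *\<^sub>R e) + f x = h * h * D2d q e"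
    using mixed_difference[OF r0(2) assms(4,3) h(1,2) f Dd] by blast
  have "f (x + h *\<^sub>R d + h *\<^sub>R e) = f (x + h *\<^sub>R e + h *\<^sub>R d)"
    by (simp add: algebra_simps)
  then have "h * h * D2e p d = h * h * D2d q e"
    using p(2) q(2) by linarith
  then have "D2e p d = D2d q e"
    using h by simp
  moreover have "dist (D2e p d) (D2e x d) < \<epsilon>" "dist (D2d q e) (D2d x e) < \<epsilon>"
    using p(1) q(1) h by (auto intro!: r simp: dist_commute)
  ultimately show False
    unfolding dist_real_def \<epsilon>_def by (smt (verit) field_sum_of_halves)
qed

section \<open>Gradients and Hessians of Hoelder functions\<close>

lemma has_derivative_grad:
  assumes "holder_on U (Suc k) \<alpha> f" "x \<in> U"
  shows "(f has_derivative (\<lambda>h. h \<bullet> grad U f x)) (at x)"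
proof -
  obtain K where K: "holder_bd U \<alpha> (Suc k) K f"
    using assms(1) holder_on_iff_holder_bd by blast
  have d: "(f has_derivative frechet_derivative f (at x)) (at x)"
    using holder_bd_SucD(1)[OF K assms(2)] .
  have "frechet_derivative f (at x) h = h \<bullet> grad U f x" for h
  proof -
    have "frechet_derivative f (at x) h = frechet_derivative f (at x) (\<Sum>i\<in>UNIV. h $ i *\<^sub>R axis i 1)"
      using basis_expansion[of h] by (simp add: scalar_mult_eq_scaleR)
    also have "\<dots> = (\<Sum>i\<in>UNIV. h $ i * frechet_derivative f (at x) (axis i 1))"
      by (simp add: linear_sum[OF has_derivative_linear[OF d]] linear_cmul[OF has_derivative_linear[OF d]])
    also have "\<dots> = h \<bullet> grad U f x"
      by (simp add: inner_vec_def grad_def holder_bd_SucD(2)[OF K assms(2)])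
    finally show ?thesis .
  qed
  then show ?thesis
    using d by presburger
qed

lemma holder_on_pd:
  assumes "holder_on U (Suc k) \<alpha> f" "b \<in> Basis"
  shows "holder_on U k \<alpha> (pd U b f)"
  using assms unfolding holder_on_iff_holder_bd by auto

lemma hess_symmetric:
  fixes x :: "real^'n"
  assumes "open U" "holder_on U (Suc (Suc k)) \<alpha> f" "x \<in> U"
  shows "hess U f x $ i $ j = hess U f x $ j $ i"
proof -
  have b: "axis i (1::real) \<in> Basis" for i :: 'n
    by (simp add: axis_in_Basis_iff)
  have d: "(pd U (axis i 1) f has_derivative (\<lambda>h. h \<bullet> grad U (pd U (axis i 1) f) y)) (at y)" if "y \<in> U" for i y
    using has_derivative_grad[OF holder_on_pd[OF assms(2) b] that] .
  have gr: "axis i 1 \<bullet> grad U g y = pd U (axis i 1) g y" for i y g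
    by (simp add: inner_axis' grad_def)
  have c: "continuous_on U (\<lambda>y. axis i 1 \<bullet> grad U (pd U (axis j 1) f) y)" for i j
    unfolding gr using holder_on_pd[OF holder_on_pd[OF assms(2) b] b, of i j] closure_subset
    unfolding holder_on_iff_holder_bd by (meson continuous_on_subset holder_bd_continuous)
  have f: "(f has_derivative (\<lambda>h. h \<bullet> grad U f y)) (at y)" if "y \<in> U" for y
    using has_derivative_grad[OF assms(2) that] .
  have "axis i 1 \<bullet> grad U (pd U (axis j 1) f) x = axis j 1 \<bullet> grad U (pd U (axis i 1) f) x"
    by (rule symmetric_mixed_derivative[OF assms(1,3) _ _ f])
       (use d c in \<open>auto simp: gr\<close>)
  then show ?thesis
    by (simp add: gr hess_def)
qed

text \<open>The second derivative is available at zero only. If it were positive, \<open>g'\<close>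
  would be positive just to the right of zero, and the mean value theorem would lift
  \<open>g\<close> above \<open>g 0\<close>.\<close>

lemma local_max_second_derivative:
  fixes g :: "real \<Rightarrow> real"
  assumes "r > 0" "\<And>t. \<bar>t\<bar> < r \<Longrightarrow> (g has_real_derivative g' t) (at t)"
    and "(g' has_real_derivative c) (at 0)" "\<And>t. \<bar>t\<bar> < r \<Longrightarrow> g t \<le> g 0"
  shows "g' 0 = 0" "c \<le> 0"
proof -
  show 0: "g' 0 = 0"
    using DERIV_local_max[OF assms(2)[of 0] assms(1)] assms(1,4) by simp
  show "c \<le> 0"
  proof (rule ccontr)
    assume "\<not> c \<le> 0"
    then obtain d where d: "d > 0" "\<And>h. 0 < h \<Longrightarrow> h < d \<Longrightarrow> g' 0 < g' (0 + h)"
      using DERIV_pos_inc_right[OF assms(3)] by force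
    define t where "t = min d r / 2"
    have t: "0 < t" "t < d" "t < r"
      using d assms(1) by (auto simp: t_def)
    have "\<exists>z. 0 < z \<and> z < t \<and> g t - g 0 = (t - 0) * g' z"
      using t by (intro MVT2 assms(2)) auto
    then obtain z where z: "0 < z" "z < t" "g t - g 0 = t * g' z"
      by auto
    have "0 < t * g' z"
      using d(2)[of z] z t 0 by simp
    then show False
      using assms(4)[of t] z t by simp
  qed
qed

text \<open>The perturbation \<open>\<epsilon> exp (\<lambda> x\<^sub>p)\<close> makes the subsolution strict once \<open>\<lambda>\<close> dominates the drift.\<close>

lemma weak_maximum_principle:
  fixes \<Omega> :: "(real^'n) set" and C :: "real^'n \<Rightarrow> real^'n^'n"
  assumes "open \<Omega>" "bounded \<Omega>" "holder_on \<Omega> (Suc (Suc k)) \<alpha> v"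
    and C: "\<And>x \<xi>. x \<in> \<Omega> \<Longrightarrow> 0 \<le> \<xi> \<bullet> (C x *v \<xi>)"
    and c: "c > 0" "\<And>x. x \<in> \<Omega> \<Longrightarrow> c \<le> C x $ p $ p"
    and b: "\<And>x. x \<in> \<Omega> \<Longrightarrow> \<bar>b x $ p\<bar> \<le> K"
    and q: "\<And>x. x \<in> \<Omega> \<Longrightarrow> 0 \<le> q x"
    and L: "\<And>x. x \<in> \<Omega> \<Longrightarrow>
      0 \<le> (\<Sum>i\<in>UNIV. \<Sum>j\<in>UNIV. C x $ i $ j * hess \<Omega> v x $ i $ j) - b x \<bullet> grad \<Omega> v x - q x * v x"
    and bdry: "\<And>x. x \<in> frontier \<Omega> \<Longrightarrow> v x \<le> 0"
    and x0: "x0 \<in> closure \<Omega>"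
  shows "v x0 \<le> 0"
proof (rule ccontr)
  assume "\<not> v x0 \<le> 0"
  then have pos: "v x0 > 0" by simp
  \<comment> \<open>Then \<open>\<mu> * c = \<bar>K\<bar> + c\<close>, so the second order term
    \<open>\<mu>\<^sup>2 * C x $ p $ p\<close> of the exponential strictly exceeds its drift term.
    This \<open>\<mu>\<close> is the exponent rate.\<close>
  define \<mu> where "\<mu> = \<bar>K\<bar> / c + 1"
  have \<mu>: "\<mu> > 0" "\<mu> * c > \<bar>K\<bar>"
    using c by (auto simp: \<mu>_def field_simps intro: add_nonneg_pos)
  define E where "E x = exp (\<mu> * x $ p)" for x :: "real^'n"
  have cpt: "compact (closure \<Omega>)"
    using assms(2) by simp
  have cE: "continuous_on A E" for A
    unfolding E_def by (intro continuous_intros)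
  have cv: "continuous_on (closure \<Omega>) v"
    using assms(3) holder_bd_continuous unfolding holder_on_iff_holder_bd by blast
  obtain xE where xE: "\<And>x. x \<in> closure \<Omega> \<Longrightarrow> E x \<le> E xE"
    using continuous_attains_sup[OF cpt _ cE] x0 by (metis equals0D)
  \<comment> \<open>Keeps the perturbation below \<open>v x0 / 2\<close> on the closure. The maximum
    of \<open>w\<close> then sits where \<open>v\<close> is positive, hence off the
    frontier.\<close>
  define \<epsilon> where "\<epsilon> = v x0 / (2 * E xE)"
  have E0: "E x > 0" for x
    by (simp add: E_def)
  have \<epsilon>: "\<epsilon> > 0"
    using pos E0 by (simp add: \<epsilon>_def)
  define w where "w x = v x + \<epsilon> * E x" for x
  obtain y where y: "y \<in> closure \<Omega>" "\<And>x. x \<in> closure \<Omega> \<Longrightarrow> w x \<le> w y"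
  proof -
    have "continuous_on (closure \<Omega>) w"
      unfolding w_def by (intro continuous_intros cv cE)
    then show ?thesis
      using that continuous_attains_sup[OF cpt, of w] x0 by (metis equals0D)
  qed
  have "\<epsilon> * E y \<le> v x0 / 2"
  proof -
    have "\<epsilon> * E y \<le> \<epsilon> * E xE"
      using xE[OF y(1)] \<epsilon> by simp
    also have "\<dots> = v x0 / 2"
      using E0[of xE] by (simp add: \<epsilon>_def)
    finally show ?thesis .
  qed
  moreover have "v x0 \<le> w x0"
    using \<epsilon> E0[of x0] by (simp add: w_def)
  ultimately have vy: "v y > 0"
    using y(2)[OF x0] pos unfolding w_def by linarith
  then have y\<Omega>: "y \<in> \<Omega>"
    using bdry[of y] y(1) assms(1) by (force simp: frontier_def interior_open)
  obtain r where r: "r > 0" "ball y r \<subseteq> \<Omega>"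
    using assms(1) y\<Omega> open_contains_ball by blast
  define e where "e = \<epsilon> * E y"
  have e: "e > 0"
    using \<epsilon> E0 by (simp add: e_def)
  define H where "H = hess \<Omega> v y"
  \<comment> \<open>First and second order conditions for the maximum of \<open>w\<close> along a
    unit direction, with the derivatives of the exponential written out.\<close>
  have dir: "\<xi> \<bullet> grad \<Omega> v y + e * (\<mu> * \<xi> $ p) = 0"
    "\<xi> \<bullet> (H *v \<xi>) + e * (\<mu> * \<xi> $ p)\<^sup>2 \<le> 0" if "norm \<xi> = 1" for \<xi>
  proof -
    have inr: "y + t *\<^sub>R \<xi> \<in> \<Omega>" if "\<bar>t\<bar> < r" for t
      using that \<open>norm \<xi> = 1\<close> r(2) by (intro subsetD[OF r(2)]) (simp add: dist_norm)
    define g where "g t = w (y + t *\<^sub>R \<xi>)" for t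
    define g' where "g' t = \<xi> \<bullet> grad \<Omega> v (y + t *\<^sub>R \<xi>) + \<epsilon> * (E (y + t *\<^sub>R \<xi>) * (\<mu> * \<xi> $ p))" for t
    have line: "((\<lambda>t. f (y + t *\<^sub>R \<xi>)) has_real_derivative \<xi> \<bullet> grad \<Omega> f (y + t *\<^sub>R \<xi>)) (at t)"
      if "\<bar>t\<bar> < r" "holder_on \<Omega> (Suc j) \<alpha> f" for f t j
    proof -
      have "((\<lambda>t. y + t *\<^sub>R \<xi>) has_derivative (\<lambda>h. h *\<^sub>R \<xi>)) (at t)"
        by (auto intro!: derivative_eq_intros)
      from has_derivative_compose[OF this has_derivative_grad[OF that(2) inr[OF that(1)]]]
      show ?thesis
        by (simp add: has_field_derivative_def mult_commute_abs)
    qed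
    have lineE: "((\<lambda>t. E (y + t *\<^sub>R \<xi>)) has_real_derivative E (y + t *\<^sub>R \<xi>) * (\<mu> * \<xi> $ p)) (at t)" for t
      unfolding E_def by (auto intro!: derivative_eq_intros)
    have 1: "(g has_real_derivative g' t) (at t)" if "\<bar>t\<bar> < r" for t
      unfolding g_def g'_def w_def by (intro DERIV_add DERIV_cmult line[OF that assms(3)] lineE)
    have "((\<lambda>t. \<Sum>i\<in>UNIV. \<xi> $ i * pd \<Omega> (axis i 1) v (y + t *\<^sub>R \<xi>)) has_real_derivative
        (\<Sum>i\<in>UNIV. \<xi> $ i * (\<xi> \<bullet> grad \<Omega> (pd \<Omega> (axis i 1) v) (y + 0 *\<^sub>R \<xi>)))) (at 0)"
      using r(1) by (intro DERIV_sum DERIV_cmult line[where j = k] holder_on_pd[OF assms(3)])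
        (auto simp: axis_in_Basis_iff)
    moreover have "(\<Sum>i\<in>UNIV. \<xi> $ i * (\<xi> \<bullet> grad \<Omega> (pd \<Omega> (axis i 1) v) (y + 0 *\<^sub>R \<xi>))) = \<xi> \<bullet> (H *v \<xi>)"
      unfolding inner_vec_def matrix_vector_mult_def H_def grad_def hess_def
      by (simp add: sum_distrib_left sum_distrib_right algebra_simps, subst sum.swap, simp add: mult.left_commute)
    moreover have "(\<Sum>i\<in>UNIV. \<xi> $ i * pd \<Omega> (axis i 1) v z) = \<xi> \<bullet> grad \<Omega> v z" for z
      by (simp add: inner_vec_def grad_def)
    ultimately have "((\<lambda>t. \<xi> \<bullet> grad \<Omega> v (y + t *\<^sub>R \<xi>)) has_real_derivative \<xi> \<bullet> (H *v \<xi>)) (at 0)"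
      by simp
    then have 2: "(g' has_real_derivative \<xi> \<bullet> (H *v \<xi>) + \<epsilon> * (E (y + 0 *\<^sub>R \<xi>) * (\<mu> * \<xi> $ p) * (\<mu> * \<xi> $ p))) (at 0)"
      unfolding g'_def by (intro DERIV_add DERIV_cmult DERIV_cmult_right lineE)
    have 3: "g t \<le> g 0" if "\<bar>t\<bar> < r" for t
      using y(2)[of "y + t *\<^sub>R \<xi>"] inr[OF that] closure_subset by (auto simp: g_def)
    show "\<xi> \<bullet> grad \<Omega> v y + e * (\<mu> * \<xi> $ p) = 0"
      using local_max_second_derivative(1)[OF r(1) 1 2 3] by (simp add: g'_def e_def)
    show "\<xi> \<bullet> (H *v \<xi>) + e * (\<mu> * \<xi> $ p)\<^sup>2 \<le> 0"
      using local_max_second_derivative(2)[OF r(1) 1 2 3] by (simp add: e_def power2_eq_square algebra_simps)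
  qed
  have gr: "grad \<Omega> v y $ i = (if i = p then - e * \<mu> else 0)" for i
  proof -
    have "axis i 1 \<bullet> grad \<Omega> v y + e * (\<mu> * axis i 1 $ p) = 0"
      by (intro dir(1)) simp
    then have "grad \<Omega> v y $ i + e * (\<mu> * axis i 1 $ p) = 0"
      by (simp add: inner_axis')
    then show ?thesis
      by (simp add: axis_def split: if_splits)
  qed
  \<comment> \<open>Minus the Hessian of \<open>w\<close> at \<open>y\<close>, positive semidefinite
    by the second order conditions.\<close>
  define B where "B = (\<chi> i j. - H $ i $ j - (if i = p \<and> j = p then e * \<mu>\<^sup>2 else 0))"
  have B: "\<xi> \<bullet> (B *v \<xi>) = - (\<xi> \<bullet> (H *v \<xi>)) - e * (\<mu> * \<xi> $ p)\<^sup>2" for \<xi>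
  proof -
    have "B *v \<xi> = - (H *v \<xi>) - (e * \<mu>\<^sup>2 * \<xi> $ p) *\<^sub>R axis p 1"
      by (simp add: B_def vec_eq_iff matrix_vector_mult_def algebra_simps sum_subtractf sum_negf axis_def
          if_distrib[of "\<lambda>x. _ * x"] cong: if_cong)
    then show ?thesis
      by (simp only: inner_diff_right inner_minus_right inner_scaleR_right inner_axis)
        (simp add: power2_eq_square algebra_simps)
  qed
  have "transpose B = B"
    using hess_symmetric[OF assms(1,3) y\<Omega>] by (auto simp: B_def H_def transpose_def vec_eq_iff)
  moreover have "0 \<le> \<xi> \<bullet> (B *v \<xi>)" for \<xi>
  proof (cases "\<xi> = 0")
    case False
    define \<zeta> where "\<zeta> = \<xi> /\<^sub>R norm \<xi>"
    have "norm \<zeta> = 1" "\<xi> = norm \<xi> *\<^sub>R \<zeta>"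
      using False by (auto simp: \<zeta>_def)
    moreover have "0 \<le> \<zeta> \<bullet> (B *v \<zeta>)"
      using dir(2)[OF \<open>norm \<zeta> = 1\<close>] unfolding B by linarith
    moreover have "(norm \<xi> *\<^sub>R \<zeta>) \<bullet> (B *v (norm \<xi> *\<^sub>R \<zeta>)) = norm \<xi> * (norm \<xi> * (\<zeta> \<bullet> (B *v \<zeta>)))"
      by (simp add: matrix_vector_mult_scaleR)
    ultimately show ?thesis
      by simp
  qed simp
  ultimately have "0 \<le> (\<Sum>i\<in>UNIV. \<Sum>j\<in>UNIV. C y $ i $ j * B $ i $ j)"
    using C[OF y\<Omega>] frobenius_psd_nonneg by blast
  also have "\<dots> = - (\<Sum>i\<in>UNIV. \<Sum>j\<in>UNIV. C y $ i $ j * H $ i $ j) - C y $ p $ p * (e * \<mu>\<^sup>2)"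
  proof -
    have "(\<Sum>i\<in>UNIV. \<Sum>j\<in>UNIV. C y $ i $ j * (if i = p \<and> j = p then e * \<mu>\<^sup>2 else 0)) = C y $ p $ p * (e * \<mu>\<^sup>2)"
    proof -
      have "(\<Sum>i\<in>UNIV. \<Sum>j\<in>UNIV. C y $ i $ j * (if i = p \<and> j = p then e * \<mu>\<^sup>2 else 0))
          = (\<Sum>i\<in>UNIV. if i = p then C y $ i $ p * (e * \<mu>\<^sup>2) else 0)"
        by (intro sum.cong) (auto simp: if_distrib[of "\<lambda>x. _ * x"] cong: if_cong)
      then show ?thesis by simp
    qed
    then show ?thesis
      by (simp add: B_def algebra_simps sum_subtractf sum_negf)
  qed
  finally have tr: "(\<Sum>i\<in>UNIV. \<Sum>j\<in>UNIV. C y $ i $ j * H $ i $ j) \<le> - C y $ p $ p * (e * \<mu>\<^sup>2)"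
    by simp
  have bg: "b y \<bullet> grad \<Omega> v y = - b y $ p * (e * \<mu>)"
    by (simp add: inner_vec_def gr if_distrib[of "\<lambda>x. _ * x"] cong: if_cong)
  have "0 \<le> q y * v y"
    using q[OF y\<Omega>] vy by simp
  then have "0 \<le> - C y $ p $ p * (e * \<mu>\<^sup>2) + b y $ p * (e * \<mu>)"
    using L[OF y\<Omega>] tr bg unfolding H_def by linarith
  also have "\<dots> = (e * \<mu>) * (b y $ p - \<mu> * C y $ p $ p)"
    by (simp add: power2_eq_square algebra_simps)
  finally have "\<mu> * C y $ p $ p \<le> b y $ p"
    using mult_le_cancel_left_pos[OF mult_pos_pos[OF e \<mu>(1)], of 0 "b y $ p - \<mu> * C y $ p $ p"]
    by linarith
  moreover have "\<mu> * c \<le> \<mu> * C y $ p $ p"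
    using c(2)[OF y\<Omega>] \<mu> by simp
  ultimately show False
    using b[OF y\<Omega>] \<mu> by linarith
qed


section \<open>Boundary charts and the exterior normal\<close>

lemma has_derivative_lipschitz:
  fixes f :: "'a::euclidean_space \<Rightarrow> real"
  assumes "convex S" "open S" "\<And>x. x \<in> S \<Longrightarrow> (f has_derivative D x) (at x)"
    and "\<And>x b. x \<in> S \<Longrightarrow> b \<in> Basis \<Longrightarrow> \<bar>D x b\<bar> \<le> M" "x \<in> S" "y \<in> S"
  shows "\<bar>f x - f y\<bar> \<le> real DIM('a) * M * dist x y"
proof -
  have "norm (f x - f y) \<le> real DIM('a) * M * norm (x - y)"
  proof (rule differentiable_bound[OF assms(1) _ _ assms(5,6)])
    fix z assume z: "z \<in> S"
    then show "(f has_derivative D z) (at z within S)"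
      using assms(3) has_derivative_at_withinI by blast
    have "(\<Sum>b\<in>Basis. norm (D z b)) \<le> (\<Sum>b\<in>(Basis :: 'a set). M)"
      using assms(4)[OF z] by (intro sum_mono) auto
    then show "onorm (D z) \<le> real DIM('a) * M"
      using onorm_componentwise_le[OF has_derivative_bounded_linear[OF assms(3)[OF z]], of "real DIM('a) * M"]
      by simp
  qed
  then show ?thesis
    by (simp add: dist_norm)
qed

lemma holder_embed_ball:
  fixes x0 :: "'a::euclidean_space"
  assumes "0 < r" "0 < \<alpha>" "\<alpha> < 1"
  shows "\<exists>C. holder_embed (ball x0 r) \<alpha> C"
proof (intro exI)
  define C where "C = max 1 (real DIM('a) * (2 * r) powr (1 - \<alpha>))"
  have "\<bar>f x - f y\<bar> \<le> C * M * dist x y powr \<alpha>"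
    if f: "\<forall>x\<in>ball x0 r. f differentiable (at x) \<and> \<bar>f x\<bar> \<le> M \<and>
         (\<forall>b\<in>Basis. \<bar>frechet_derivative f (at x) b\<bar> \<le> M)"
      and xy: "x \<in> ball x0 r" "y \<in> ball x0 r" for f M x y
  proof -
    have M: "0 \<le> M"
      using f xy(1) by force
    have "dist x y \<le> 2 * r"
      using dist_triangle2[of x y x0] xy by (simp add: dist_commute)
    then have "dist x y \<le> (2 * r) powr (1 - \<alpha>) * dist x y powr \<alpha>"
      using assms by (intro le_powr_times_powr) auto
    then have "real DIM('a) * M * dist x y \<le> real DIM('a) * M * ((2 * r) powr (1 - \<alpha>) * dist x y powr \<alpha>)"
      using M by (intro mult_left_mono) auto
    also have "\<dots> = (real DIM('a) * (2 * r) powr (1 - \<alpha>)) * (M * dist x y powr \<alpha>)"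
      by simp
    also have "\<dots> \<le> C * (M * dist x y powr \<alpha>)"
      unfolding C_def using M by (intro mult_right_mono) auto
    finally have "real DIM('a) * M * dist x y \<le> C * M * dist x y powr \<alpha>"
      by simp
    moreover have "\<bar>f x - f y\<bar> \<le> real DIM('a) * M * dist x y"
      by (rule has_derivative_lipschitz[where D = "\<lambda>x. frechet_derivative f (at x)", OF convex_ball open_ball])
         (use f xy in \<open>auto simp: frechet_derivative_works\<close>)
    ultimately show ?thesis by linarith
  qed
  then show "holder_embed (ball x0 r) \<alpha> C"
    using assms unfolding holder_embed_def C_def by auto
qed

lemma has_derivative_vec_nthI:
  fixes f :: "'a::real_normed_vector \<Rightarrow> real^'n"
  assumes "\<And>j. ((\<lambda>x. f x $ j) has_derivative (\<lambda>h. f' h $ j)) (at x)"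
  shows "(f has_derivative f') (at x)"
  unfolding has_derivative_componentwise_within[of f]
proof
  fix b :: "real^'n" assume "b \<in> Basis"
  then obtain j where "b = axis j 1"
    by (auto simp: Basis_vec_def)
  then show "((\<lambda>x. f x \<bullet> b) has_derivative (\<lambda>h. f' h \<bullet> b)) (at x)"
    using assms[of j] by (simp add: inner_axis)
qed

text \<open>The class of the boundary is written \<open>Suc k\<close> because the normal, a
  normalised gradient of the chart component \<open>i\<close>, has order \<open>k\<close>. That
  component is a local defining function of the domain.\<close>

locale boundary_chart =
  fixes \<Omega> :: "(real^'n) set" and k :: nat and \<alpha> :: real and x0 :: "real^'n" and r :: real
    and \<psi> \<kappa> :: "real^'n \<Rightarrow> real^'n" and i :: 'n
  assumes open_\<Omega>: "open \<Omega>" and r_pos: "0 < r" and open_D: "open (\<psi> ` ball x0 r)"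
    and \<kappa>_\<psi>: "x \<in> ball x0 r \<Longrightarrow> \<kappa> (\<psi> x) = x"
    and holder_\<psi>: "holder_on (ball x0 r) (Suc k) \<alpha> (\<lambda>x. \<psi> x $ j)"
    and holder_\<kappa>: "holder_on (\<psi> ` ball x0 r) (Suc k) \<alpha> (\<lambda>y. \<kappa> y $ j)"
    and image_\<Omega>: "\<psi> ` (ball x0 r \<inter> \<Omega>) = \<psi> ` ball x0 r \<inter> {y. y $ i > 0}"
    and image_frontier: "\<psi> ` (ball x0 r \<inter> frontier \<Omega>) = \<psi> ` ball x0 r \<inter> {y. y $ i = 0}"
begin

abbreviation "B \<equiv> ball x0 r"
abbreviation "D \<equiv> \<psi> ` B"
abbreviation "\<rho> \<equiv> \<lambda>x. \<psi> x $ i"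
abbreviation "g \<equiv> grad B \<rho>"

definition "d\<psi> x h = (\<chi> j. h \<bullet> grad B (\<lambda>x. \<psi> x $ j) x)"
definition "d\<kappa> y h = (\<chi> j. h \<bullet> grad D (\<lambda>y. \<kappa> y $ j) y)"

lemma \<psi>_\<kappa>: "y \<in> D \<Longrightarrow> \<psi> (\<kappa> y) = y"
  using \<kappa>_\<psi> by auto

lemma \<kappa>_in: "y \<in> D \<Longrightarrow> \<kappa> y \<in> B"
  using \<kappa>_\<psi> by auto

lemma \<psi>_deriv: "x \<in> B \<Longrightarrow> (\<psi> has_derivative d\<psi> x) (at x)"
  by (intro has_derivative_vec_nthI) (use has_derivative_grad[OF holder_\<psi>] in \<open>simp add: d\<psi>_def\<close>)

lemma \<kappa>_deriv: "y \<in> D \<Longrightarrow> (\<kappa> has_derivative d\<kappa> y) (at y)"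
  by (intro has_derivative_vec_nthI) (use has_derivative_grad[OF holder_\<kappa>] in \<open>simp add: d\<kappa>_def\<close>)

lemma \<rho>_deriv: "x \<in> B \<Longrightarrow> (\<rho> has_derivative (\<lambda>h. h \<bullet> g x)) (at x)"
  by (rule has_derivative_grad[OF holder_\<psi>])

lemma d\<kappa>_d\<psi>: "x \<in> B \<Longrightarrow> d\<kappa> (\<psi> x) (d\<psi> x h) = h"
proof -
  assume x: "x \<in> B"
  have "((\<lambda>x. \<kappa> (\<psi> x)) has_derivative (\<lambda>h. d\<kappa> (\<psi> x) (d\<psi> x h))) (at x)"
    using has_derivative_compose[OF \<psi>_deriv[OF x] \<kappa>_deriv] x by blast
  then have "((\<lambda>x. x) has_derivative (\<lambda>h. d\<kappa> (\<psi> x) (d\<psi> x h))) (at x)"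
    by (rule has_derivative_transform_within_open[OF _ open_ball x]) (use \<kappa>_\<psi> in auto)
  then show ?thesis
    using has_derivative_unique[OF has_derivative_ident] by metis
qed

lemma d\<psi>_d\<kappa>: "x \<in> B \<Longrightarrow> d\<psi> x (d\<kappa> (\<psi> x) h) = h"
proof -
  assume x: "x \<in> B"
  then have y: "\<psi> x \<in> D" by blast
  have "((\<lambda>y. \<psi> (\<kappa> y)) has_derivative (\<lambda>h. d\<psi> x (d\<kappa> (\<psi> x) h))) (at (\<psi> x))"
    using has_derivative_compose[OF \<kappa>_deriv[OF y]] \<psi>_deriv[OF x] \<kappa>_\<psi>[OF x] by metis
  then have "((\<lambda>x. x) has_derivative (\<lambda>h. d\<psi> x (d\<kappa> (\<psi> x) h))) (at (\<psi> x))"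
    by (rule has_derivative_transform_within_open[OF _ open_D y]) (use \<psi>_\<kappa> in auto)
  then show ?thesis
    using has_derivative_unique[OF has_derivative_ident] by metis
qed

text \<open>The image equations become pointwise statements because the left inverse \<kappa> makes
  \<psi> injective on the ball.\<close>

lemma \<Omega>_iff: "x \<in> B \<Longrightarrow> x \<in> \<Omega> \<longleftrightarrow> \<rho> x > 0"
  and frontier_iff: "x \<in> B \<Longrightarrow> x \<in> frontier \<Omega> \<longleftrightarrow> \<rho> x = 0"
proof -
  assume x: "x \<in> B"
  have *: "x \<in> S \<longleftrightarrow> \<psi> x \<in> \<psi> ` (B \<inter> S)" for S
  proof
    assume "\<psi> x \<in> \<psi> ` (B \<inter> S)"
    then obtain z where z: "z \<in> B" "z \<in> S" "\<psi> x = \<psi> z"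
      by blast
    have "x = \<kappa> (\<psi> z)"
      using \<kappa>_\<psi>[OF x] z(3) by argo
    also have "\<dots> = z"
      by (rule \<kappa>_\<psi>[OF z(1)])
    finally show "x \<in> S"
      using z(2) by argo
  next
    assume "x \<in> S"
    then show "\<psi> x \<in> \<psi> ` (B \<inter> S)"
      using x by (intro imageI) blast
  qed
  show "x \<in> \<Omega> \<longleftrightarrow> \<rho> x > 0"
    unfolding *[of \<Omega>] image_\<Omega> using x by blast
  show "x \<in> frontier \<Omega> \<longleftrightarrow> \<rho> x = 0"
    unfolding *[of "frontier \<Omega>"] image_frontier using x by blast
qed

lemma closure_iff: "x \<in> B \<Longrightarrow> x \<in> closure \<Omega> \<longleftrightarrow> \<rho> x \<ge> 0"
  using \<Omega>_iff frontier_iff open_\<Omega> by (force simp: frontier_def interior_open closure_def)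

text \<open>Pairing with this gradient is component \<open>i\<close> of the differential of \<psi>,
  which is onto.\<close>

lemma g_nonzero: "x \<in> B \<Longrightarrow> g x \<noteq> 0"
proof
  assume x: "x \<in> B" and "g x = 0"
  then have "d\<psi> x h $ i = 0" for h
    by (simp add: d\<psi>_def)
  then have "axis i 1 $ i = (0::real)"
    using d\<psi>_d\<kappa>[OF x] by metis
  then show False
    by simp
qed

section \<open>Existence and uniqueness of the exterior normal\<close>

lemma eventually_\<rho>_along:
  assumes x: "x \<in> B" "\<rho> x = 0"
  shows "w \<bullet> g x > 0 \<Longrightarrow> \<forall>\<^sub>F t in at_right 0. x + t *\<^sub>R w \<in> B \<and> \<rho> (x + t *\<^sub>R w) > 0"
    and "w \<bullet> g x < 0 \<Longrightarrow> \<forall>\<^sub>F t in at_right 0. x + t *\<^sub>R w \<in> B \<and> \<rho> (x + t *\<^sub>R w) < 0"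
proof -
  have "((\<lambda>t. x + t *\<^sub>R w) \<longlongrightarrow> x + 0 *\<^sub>R w) (at_right 0)"
    by (intro tendsto_intros)
  then have inB: "\<forall>\<^sub>F t in at_right 0. x + t *\<^sub>R w \<in> B"
    using x(1) topological_tendstoD[of "\<lambda>t. x + t *\<^sub>R w" "x" "at_right 0" B] by simp
  have "((\<lambda>t. x + t *\<^sub>R w) has_derivative (\<lambda>h. h *\<^sub>R w)) (at 0)"
    by (auto intro!: derivative_eq_intros)
  from has_derivative_compose[OF this, of \<rho> "\<lambda>h. h \<bullet> g x"] \<rho>_deriv[OF x(1)]
  have d: "((\<lambda>t. \<rho> (x + t *\<^sub>R w)) has_real_derivative w \<bullet> g x) (at 0)"
    by (simp add: has_field_derivative_def mult_commute_abs)
  show "w \<bullet> g x > 0 \<Longrightarrow> \<forall>\<^sub>F t in at_right 0. x + t *\<^sub>R w \<in> B \<and> \<rho> (x + t *\<^sub>R w) > 0"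
  proof -
    assume "w \<bullet> g x > 0"
    from DERIV_pos_inc_right[OF d this] have "\<forall>\<^sub>F t in at_right 0. \<rho> (x + t *\<^sub>R w) > 0"
      using x(2) unfolding eventually_at_right_field by auto
    then show ?thesis
      using inB eventually_conj by blast
  qed
  show "w \<bullet> g x < 0 \<Longrightarrow> \<forall>\<^sub>F t in at_right 0. x + t *\<^sub>R w \<in> B \<and> \<rho> (x + t *\<^sub>R w) < 0"
  proof -
    assume "w \<bullet> g x < 0"
    from DERIV_neg_dec_right[OF d this] have "\<forall>\<^sub>F t in at_right 0. \<rho> (x + t *\<^sub>R w) < 0"
      using x(2) unfolding eventually_at_right_field by auto
    then show ?thesis
      using inB eventually_conj by blast
  qed
qed

text \<open>Since \<rho> vanishes on the frontier, its first order expansion there is exactly the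
  tangency limit. The sign of \<rho> along the normal line separates inside from outside.\<close>

lemma is_outer_normal_grad:
  assumes x: "x \<in> B" "x \<in> frontier \<Omega>"
  shows "is_outer_normal \<Omega> x (- g x /\<^sub>R norm (g x))"
proof -
  let ?\<nu> = "- g x /\<^sub>R norm (g x)"
  have \<rho>x: "\<rho> x = 0"
    using frontier_iff x by blast
  have g0: "g x \<noteq> 0"
    using g_nonzero x by blast
  have "((\<lambda>y. (\<rho> y - \<rho> x - (y - x) \<bullet> g x) /\<^sub>R norm (y - x)) \<longlongrightarrow> 0) (at x within frontier \<Omega>)"
    using has_derivative_at_withinI[OF \<rho>_deriv[OF x(1)], of "frontier \<Omega>"]
    by (simp add: has_derivative_at_within)
  then have "((\<lambda>y. (\<rho> y - \<rho> x - (y - x) \<bullet> g x) /\<^sub>R norm (y - x) * (1 / norm (g x))) \<longlongrightarrow> 0)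
      (at x within frontier \<Omega>)"
    by (rule tendsto_mult_left_zero)
  then have 1: "((\<lambda>y. (?\<nu> \<bullet> (y - x)) / norm (y - x)) \<longlongrightarrow> 0) (at x within frontier \<Omega>)"
  proof (rule Lim_transform_eventually)
    have "\<forall>\<^sub>F y in at x within frontier \<Omega>. y \<in> B \<and> y \<in> frontier \<Omega>"
      using x(1) unfolding eventually_at_topological by (auto intro!: exI[of _ B])
    then show "\<forall>\<^sub>F y in at x within frontier \<Omega>. (\<rho> y - \<rho> x - (y - x) \<bullet> g x) /\<^sub>R norm (y - x) * (1 / norm (g x))
        = (?\<nu> \<bullet> (y - x)) / norm (y - x)"
    proof eventually_elim
      case (elim y)
      then have "\<rho> y = 0"
        using frontier_iff by blast
      then show ?case
        using \<rho>x by (simp add: inner_commute divide_inverse)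
    qed
  qed
  have gg: "g x \<bullet> g x > 0"
    using g0 by simp
  have "\<forall>\<^sub>F t in at_right 0. x + t *\<^sub>R (- ?\<nu>) \<in> B \<and> \<rho> (x + t *\<^sub>R (- ?\<nu>)) > 0"
    using g0 gg by (intro eventually_\<rho>_along x(1) \<rho>x) (simp add: zero_less_mult_iff)
  moreover have "\<forall>\<^sub>F t in at_right 0. x + t *\<^sub>R ?\<nu> \<in> B \<and> \<rho> (x + t *\<^sub>R ?\<nu>) < 0"
    using g0 gg by (intro eventually_\<rho>_along x(1) \<rho>x) (simp add: zero_less_mult_iff)
  ultimately have "\<forall>\<^sub>F t in at_right 0. x - t *\<^sub>R ?\<nu> \<in> \<Omega> \<and> x + t *\<^sub>R ?\<nu> \<notin> closure \<Omega>"
  proof eventually_elim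
    case (elim t)
    then show ?case
      using \<Omega>_iff[of "x + t *\<^sub>R (- ?\<nu>)"] closure_iff[of "x + t *\<^sub>R ?\<nu>"] by simp
  qed
  with 1 g0 show ?thesis
    unfolding is_outer_normal_def by simp
qed

text \<open>Directions with zero component \<open>i\<close> stay in the flattened boundary. Their
  image under \<kappa> is a curve in the frontier through \<open>x\<close>, and the tangency limit
  is tested along it.\<close>

lemma outer_normal_tangent:
  assumes x: "x \<in> B" "x \<in> frontier \<Omega>"
    and \<nu>: "((\<lambda>y. (\<nu> \<bullet> (y - x)) / norm (y - x)) \<longlongrightarrow> 0) (at x within frontier \<Omega>)"
    and e: "e $ i = 0"
  shows "\<nu> \<bullet> d\<kappa> (\<psi> x) e = 0"
proof (cases "e = 0")
  case True
  then show ?thesis by (simp add: d\<kappa>_def inner_vec_def)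
next
  case False
  have y: "\<psi> x \<in> D"
    using x by blast
  define c where "c s = \<kappa> (\<psi> x + s *\<^sub>R e)" for s
  have c0: "c 0 = x"
    using \<kappa>_\<psi> x by (simp add: c_def)
  have "((\<lambda>s. \<psi> x + s *\<^sub>R e) has_derivative (\<lambda>h. h *\<^sub>R e)) (at 0)"
    by (auto intro!: derivative_eq_intros)
  from has_derivative_compose[OF this, of \<kappa> "d\<kappa> (\<psi> x)"] \<kappa>_deriv[OF y]
  have "(c has_derivative (\<lambda>h. d\<kappa> (\<psi> x) (h *\<^sub>R e))) (at 0)"
    unfolding c_def by simp
  then have c_deriv: "(c has_derivative (\<lambda>h. h *\<^sub>R d\<kappa> (\<psi> x) e)) (at 0)"
    using linear_cmul[OF has_derivative_linear[OF \<kappa>_deriv[OF y]]] by simp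
  have cd: "((\<lambda>s. (c s - x) /\<^sub>R s) \<longlongrightarrow> d\<kappa> (\<psi> x) e) (at 0)"
  proof (rule LIM_zero_cancel, rule tendsto_norm_zero_cancel, rule Lim_transform_eventually)
    show "((\<lambda>s. norm (c (0 + s) - c 0 - s *\<^sub>R d\<kappa> (\<psi> x) e) / norm s) \<longlongrightarrow> 0) (at 0)"
      using c_deriv unfolding has_derivative_at by blast
    have "norm (c (0 + s) - c 0 - s *\<^sub>R d\<kappa> (\<psi> x) e) / norm s = norm ((c s - x) /\<^sub>R s - d\<kappa> (\<psi> x) e)"
      if "s \<noteq> 0" for s
    proof -
      have "(c s - x) /\<^sub>R s - d\<kappa> (\<psi> x) e = (c s - x - s *\<^sub>R d\<kappa> (\<psi> x) e) /\<^sub>R s"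
        using that by (simp add: scaleR_diff_right)
      then show ?thesis
        by (simp add: c0 divide_inverse mult.commute)
    qed
    then show "\<forall>\<^sub>F s in at 0. norm (c (0 + s) - c 0 - s *\<^sub>R d\<kappa> (\<psi> x) e) / norm s
        = norm ((c s - x) /\<^sub>R s - d\<kappa> (\<psi> x) e)"
      by (simp add: eventually_at_filter)
  qed
  have "((\<lambda>s. \<psi> x + s *\<^sub>R e) \<longlongrightarrow> \<psi> x + 0 *\<^sub>R e) (at 0)"
    by (intro tendsto_intros)
  then have inD: "\<forall>\<^sub>F s in at 0. \<psi> x + s *\<^sub>R e \<in> D"
    using y open_D topological_tendstoD[of "\<lambda>s. \<psi> x + s *\<^sub>R e" "\<psi> x" "at 0" D] by simp
  \<comment> \<open>The filter excludes \<open>x\<close> itself; \<open>c s\<close> differs from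
    \<open>x\<close> because \<open>e\<close> and \<open>s\<close> are nonzero.\<close>
  have "filterlim c (at x within frontier \<Omega>) (at 0)"
  proof (rule filterlim_at_withinI)
    have "isCont c 0"
      using c_deriv has_derivative_continuous by blast
    then show "(c \<longlongrightarrow> x) (at 0)"
      using c0 by (simp add: isCont_def)
    have "\<forall>\<^sub>F s :: real in at 0. s \<noteq> 0"
      by (simp add: eventually_at_filter)
    with inD show "\<forall>\<^sub>F s in at 0. c s \<in> frontier \<Omega> - {x}"
    proof eventually_elim
      case (elim s)
      have "\<psi> (c s) = \<psi> x + s *\<^sub>R e"
        unfolding c_def using \<psi>_\<kappa>[OF elim(1)] .
      moreover have "c s \<in> B"
        unfolding c_def using \<kappa>_in[OF elim(1)] .
      moreover have "\<rho> x = 0"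
        using frontier_iff x by blast
      ultimately show ?case
        using frontier_iff[of "c s"] e elim(2) False by auto
    qed
  qed
  then have 1: "((\<lambda>s. (\<nu> \<bullet> (c s - x)) / norm (c s - x)) \<longlongrightarrow> 0) (at 0)"
    by (rule filterlim_compose[OF \<nu>])
  \<comment> \<open>Multiplying by the length of the difference quotient replaces the normalisation
    by \<open>norm (c s - x)\<close> with one by \<open>s\<close>, whose limit is the
    velocity.\<close>
  have "((\<lambda>s. \<bar>(\<nu> \<bullet> (c s - x)) / norm (c s - x)\<bar> * norm ((c s - x) /\<^sub>R s)) \<longlongrightarrow> \<bar>0\<bar> * norm (d\<kappa> (\<psi> x) e)) (at 0)"
    by (intro tendsto_mult tendsto_rabs tendsto_norm 1 cd)
  moreover have "\<bar>(\<nu> \<bullet> (c s - x)) / norm (c s - x)\<bar> * norm ((c s - x) /\<^sub>R s) = \<bar>\<nu> \<bullet> ((c s - x) /\<^sub>R s)\<bar>" for s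
    by (cases "c s = x") (auto simp: abs_mult divide_inverse)
  ultimately have "((\<lambda>s. \<bar>\<nu> \<bullet> ((c s - x) /\<^sub>R s)\<bar>) \<longlongrightarrow> 0) (at 0)"
    by simp
  moreover have "((\<lambda>s. \<bar>\<nu> \<bullet> ((c s - x) /\<^sub>R s)\<bar>) \<longlongrightarrow> \<bar>\<nu> \<bullet> d\<kappa> (\<psi> x) e\<bar>) (at 0)"
    by (intro tendsto_rabs tendsto_inner tendsto_const cd)
  ultimately have "0 = \<bar>\<nu> \<bullet> d\<kappa> (\<psi> x) e\<bar>"
    by (rule LIM_unique)
  then show ?thesis by simp
qed

text \<open>Any exterior normal annihilates the tangent directions, so it is a multiple of
  \<open>g x\<close>. Unit length fixes the modulus, and a positive factor would send the inward ray
  out of the domain.\<close>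

lemma outer_normal_eq:
  assumes x: "x \<in> B" "x \<in> frontier \<Omega>"
  shows "outer_normal \<Omega> x = - g x /\<^sub>R norm (g x)"
  unfolding outer_normal_def
proof (rule the_equality)
  show "is_outer_normal \<Omega> x (- g x /\<^sub>R norm (g x))"
    by (rule is_outer_normal_grad[OF x])
next
  fix \<nu> assume \<nu>: "is_outer_normal \<Omega> x \<nu>"
  have \<rho>x: "\<rho> x = 0"
    using frontier_iff x by blast
  define c where "c = \<nu> \<bullet> d\<kappa> (\<psi> x) (axis i 1)"
  have lin: "linear (d\<kappa> (\<psi> x))"
    using has_derivative_linear[OF \<kappa>_deriv] x by blast
  have "\<nu> \<bullet> w = (c *\<^sub>R g x) \<bullet> w" for w
  proof -
    \<comment> \<open>Removes component \<open>i\<close> from the image of \<open>w\<close>, which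
      is \<open>w \<bullet> g x\<close>; what is left is tangent to the flattened boundary.\<close>
    define e where "e = d\<psi> x w - (w \<bullet> g x) *\<^sub>R axis i 1"
    have "e $ i = 0"
      by (simp add: e_def d\<psi>_def)
    then have "\<nu> \<bullet> d\<kappa> (\<psi> x) e = 0"
      using outer_normal_tangent[OF x] \<nu> unfolding is_outer_normal_def by blast
    moreover have "d\<kappa> (\<psi> x) e = w - (w \<bullet> g x) *\<^sub>R d\<kappa> (\<psi> x) (axis i 1)"
      unfolding e_def linear_diff[OF lin] linear_cmul[OF lin] d\<kappa>_d\<psi>[OF x(1)] ..
    ultimately show ?thesis
      by (simp add: inner_diff_right c_def inner_commute)
  qed
  then have \<nu>c: "\<nu> = c *\<^sub>R g x"
    by (metis inner_commute vector_eq_ldot)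
  have n1: "norm \<nu> = 1"
    using \<nu> unfolding is_outer_normal_def by blast
  have g0: "norm (g x) > 0"
    using g_nonzero x by simp
  have "\<not> c > 0"
  proof
    assume "c > 0"
    then have "(- \<nu>) \<bullet> g x < 0"
      using g0 by (simp add: \<nu>c)
    from eventually_\<rho>_along(2)[OF x(1) \<rho>x this]
    have "\<forall>\<^sub>F t in at_right 0. x - t *\<^sub>R \<nu> \<notin> \<Omega>"
      by eventually_elim (use \<Omega>_iff in fastforce)
    moreover have "\<forall>\<^sub>F t in at_right 0. x - t *\<^sub>R \<nu> \<in> \<Omega>"
      using \<nu> unfolding is_outer_normal_def by (auto elim: eventually_mono)
    ultimately have "\<forall>\<^sub>F t :: real in at_right 0. False"
      by eventually_elim blast
    then show False
      by simp
  qed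
  then have "c = - (1 / norm (g x))"
    using n1 g0 unfolding \<nu>c by (simp add: field_simps abs_if split: if_splits)
  then show "\<nu> = - g x /\<^sub>R norm (g x)"
    unfolding \<nu>c by (simp add: divide_inverse)
qed

text \<open>A segment between two points of \<Omega> may leave \<Omega>, so the mean value estimate
  is applied to the composition with \<kappa> on a half ball, which is convex, and carried back by
  the Lipschitz chart. The constant does not depend on \<open>f\<close>.\<close>

lemma local_lipschitz:
  assumes x0: "x0 \<in> frontier \<Omega>"
  shows "\<exists>s>0. \<exists>L. \<forall>f M. (\<forall>x\<in>\<Omega>. f differentiable (at x) \<and>
            (\<forall>b\<in>Basis. \<bar>frechet_derivative f (at x) b\<bar> \<le> M)) \<longrightarrow>
          (\<forall>x\<in>\<Omega> \<inter> ball x0 s. \<forall>y\<in>\<Omega> \<inter> ball x0 s. \<bar>f x - f y\<bar> \<le> L * M * dist x y)"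
proof -
  obtain K1 where K1: "\<And>j. holder_bd B \<alpha> (Suc k) (K1 j) (\<lambda>x. \<psi> x $ j)"
    using holder_\<psi> unfolding holder_on_iff_holder_bd by metis
  obtain K2 where K2: "\<And>j. holder_bd D \<alpha> (Suc k) (K2 j) (\<lambda>x. \<kappa> x $ j)"
    using holder_\<kappa> unfolding holder_on_iff_holder_bd by metis
  define K where "K = (\<Sum>j\<in>UNIV. \<bar>K2 j\<bar>)"
  define L1 where "L1 = (\<Sum>j\<in>UNIV. real DIM(real^'n) * K1 j)"
  have \<psi>_lip: "norm (\<psi> x - \<psi> y) \<le> L1 * dist x y" if "x \<in> B" "y \<in> B" for x y
  proof -
    have "\<bar>\<psi> x $ j - \<psi> y $ j\<bar> \<le> real DIM(real^'n) * K1 j * dist x y" for j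
    proof (rule has_derivative_lipschitz[OF convex_ball open_ball holder_bd_SucD(1)[OF K1] _ that])
      fix z b assume z: "z \<in> B" and "b \<in> (Basis :: (real^'n) set)"
      then have "holder_bd B \<alpha> k (K1 j) (pd B b (\<lambda>x. \<psi> x $ j))"
        using K1 by simp
      then show "\<bar>frechet_derivative (\<lambda>x. \<psi> x $ j) (at z) b\<bar> \<le> K1 j"
        using holder_bd_le[of B \<alpha> k "K1 j" _ z] z closure_subset
        unfolding holder_bd_SucD(2)[OF K1 z] by blast
    qed auto
    then have "(\<Sum>j\<in>UNIV. \<bar>(\<psi> x - \<psi> y) $ j\<bar>) \<le> (\<Sum>j\<in>UNIV. real DIM(real^'n) * K1 j * dist x y)"
      by (intro sum_mono) simp
    then show ?thesis
      using norm_le_l1_cart[of "\<psi> x - \<psi> y"] unfolding L1_def sum_distrib_right by linarith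
  qed
  have y0: "\<psi> x0 \<in> D"
    using r_pos by simp
  obtain R where R: "R > 0" "ball (\<psi> x0) R \<subseteq> D"
    using open_D y0 open_contains_ball by blast
  have "isCont \<psi> x0"
    using \<psi>_deriv r_pos has_derivative_continuous by (metis centre_in_ball)
  then obtain s0 where s0: "s0 > 0" "\<And>x. dist x x0 < s0 \<Longrightarrow> dist (\<psi> x) (\<psi> x0) < R"
    using R(1) unfolding continuous_at_eps_delta by blast
  define s where "s = min s0 r"
  define S where "S = ball (\<psi> x0) R \<inter> {y. y $ i > 0}"
  have "{y :: real^'n. y $ i > 0} = {y. axis i 1 \<bullet> y > 0}"
    by (simp add: inner_axis')
  then have S: "convex S" "open S"
    unfolding S_def by (auto intro!: convex_Int open_Int convex_halfspace_gt open_halfspace_gt)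
  have \<kappa>S: "\<kappa> y \<in> \<Omega>" "y \<in> D" if "y \<in> S" for y
    using that R(2) \<Omega>_iff[OF \<kappa>_in] \<psi>_\<kappa> unfolding S_def by auto
  have "\<bar>f x - f y\<bar> \<le> real DIM(real^'n) * K * L1 * M * dist x y"
    if f: "\<forall>x\<in>\<Omega>. f differentiable (at x) \<and> (\<forall>b\<in>Basis. \<bar>frechet_derivative f (at x) b\<bar> \<le> M)"
      and xy: "x \<in> \<Omega> \<inter> ball x0 s" "y \<in> \<Omega> \<inter> ball x0 s" for f M x y
  proof -
    have M: "0 \<le> M"
      using f xy(1) nonempty_Basis by (meson IntD1 abs_ge_zero ex_in_conv order_trans)
    have fd: "(f has_derivative frechet_derivative f (at z)) (at z)" if "z \<in> \<Omega>" for z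
      using f that by (simp add: frechet_derivative_works)
    have S_xy: "\<psi> x \<in> S" "\<psi> y \<in> S" and B_xy: "x \<in> B" "y \<in> B"
      using xy s0(2)[of x] s0(2)[of y] \<Omega>_iff unfolding S_def s_def by (auto simp: dist_commute)
    have "\<bar>f (\<kappa> (\<psi> x)) - f (\<kappa> (\<psi> y))\<bar> \<le> real DIM(real^'n) * (K * M) * dist (\<psi> x) (\<psi> y)"
    proof (rule has_derivative_lipschitz[OF S _ _ S_xy])
      fix z assume z: "z \<in> S"
      show "((\<lambda>z. f (\<kappa> z)) has_derivative (\<lambda>h. frechet_derivative f (at (\<kappa> z)) (d\<kappa> z h))) (at z)"
        using has_derivative_compose[OF \<kappa>_deriv[OF \<kappa>S(2)[OF z]] fd[OF \<kappa>S(1)[OF z]]] .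
      fix b :: "real^'n" assume b: "b \<in> Basis"
      have d: "\<bar>d\<kappa> z b $ j\<bar> \<le> \<bar>K2 j\<bar>" for j
      proof -
        have "((\<lambda>z. \<kappa> z $ j) has_derivative (\<lambda>h. d\<kappa> z h $ j)) (at z)"
          using has_derivative_grad[OF holder_\<kappa> \<kappa>S(2)[OF z]] by (simp add: d\<kappa>_def)
        then have "d\<kappa> z b $ j = pd D b (\<lambda>z. \<kappa> z $ j) z"
          using frechet_derivative_at \<kappa>S(2)[OF z] by (metis pd_def)
        moreover have "holder_bd D \<alpha> k (K2 j) (pd D b (\<lambda>z. \<kappa> z $ j))"
          using K2 b by simp
        ultimately show ?thesis
          using holder_bd_le[of D \<alpha> k "K2 j" _ z] \<kappa>S(2)[OF z] closure_subset[of D] by (metis abs_ge_self order_trans subsetD)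
      qed
      note lin = has_derivative_linear[OF fd[OF \<kappa>S(1)[OF z]]]
      have "frechet_derivative f (at (\<kappa> z)) (d\<kappa> z b)
          = frechet_derivative f (at (\<kappa> z)) (\<Sum>j\<in>UNIV. d\<kappa> z b $ j *\<^sub>R axis j 1)"
        using basis_expansion[of "d\<kappa> z b"] by (simp add: scalar_mult_eq_scaleR)
      also have "\<dots> = (\<Sum>j\<in>UNIV. d\<kappa> z b $ j * frechet_derivative f (at (\<kappa> z)) (axis j 1))"
        by (simp add: linear_sum[OF lin] linear_cmul[OF lin])
      also have "\<bar>\<dots>\<bar> \<le> (\<Sum>j\<in>UNIV. \<bar>K2 j\<bar> * M)"
      proof (rule order_trans[OF sum_abs], rule sum_mono)
        fix j
        have "\<bar>frechet_derivative f (at (\<kappa> z)) (axis j 1)\<bar> \<le> M"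
          using f \<kappa>S(1)[OF z] by (auto simp: axis_in_Basis_iff)
        then show "\<bar>d\<kappa> z b $ j * frechet_derivative f (at (\<kappa> z)) (axis j 1)\<bar> \<le> \<bar>K2 j\<bar> * M"
          unfolding abs_mult using d by (intro mult_mono) auto
      qed
      finally show "\<bar>frechet_derivative f (at (\<kappa> z)) (d\<kappa> z b)\<bar> \<le> K * M"
        by (simp add: K_def sum_distrib_right)
    qed
    also have "\<dots> \<le> real DIM(real^'n) * (K * M) * (L1 * dist x y)"
      using \<psi>_lip[OF B_xy] M by (intro mult_left_mono) (auto simp: dist_norm K_def sum_nonneg)
    finally show ?thesis
      using \<kappa>_\<psi> B_xy by (simp add: algebra_simps)
  qed
  moreover have "s > 0"
    using s0 r_pos by (simp add: s_def)
  ultimately show ?thesis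
    by blast
qed

end


section \<open>Extending the normal into the domain\<close>

lemma boundary_chart_exists:
  assumes "holder_boundary \<Omega> (Suc k) \<alpha>" "open \<Omega>" "x0 \<in> frontier \<Omega>"
  shows "\<exists>r \<psi> \<kappa> i. boundary_chart \<Omega> k \<alpha> x0 r \<psi> \<kappa> i"
  using assms unfolding holder_boundary_def boundary_chart_def Let_def by meson

text \<open>Let \<open>e\<close> be a Lebesgue number of a finite cover by balls with a local
  Lipschitz estimate. Pairs closer than \<open>e\<close> share a ball; for all others the trivial
  bound \<open>2 * M\<close> is at most \<open>2 * M / e powr \<alpha>\<close> times the Hoelder
  factor. The entries of \<open>C\<close> stem from these two cases.\<close>

lemma holder_embed_domain:
  fixes \<Omega> :: "(real^'n) set"
  assumes "holder_boundary \<Omega> (Suc k) \<alpha>" "open \<Omega>" "\<Omega> \<noteq> {}" "bounded \<Omega>" "0 < \<alpha>" "\<alpha> < 1"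
  shows "\<exists>C. holder_embed \<Omega> \<alpha> C"
proof -
  define P where "P x0 s L \<longleftrightarrow> s > 0 \<and> (\<forall>f M. (\<forall>x\<in>\<Omega>. f differentiable (at x) \<and>
            (\<forall>b\<in>Basis. \<bar>frechet_derivative f (at x) b\<bar> \<le> M)) \<longrightarrow>
          (\<forall>x\<in>\<Omega> \<inter> ball x0 s. \<forall>y\<in>\<Omega> \<inter> ball x0 s. \<bar>f x - f y\<bar> \<le> L * M * dist x y))"
    for x0 :: "real^'n" and s L :: real
  have "\<exists>s L. P x0 s L" if x0: "x0 \<in> closure \<Omega>" for x0
  proof (cases "x0 \<in> \<Omega>")
    case True
    then obtain s where s: "s > 0" "ball x0 s \<subseteq> \<Omega>"
      using assms(2) open_contains_ball by blast
    have "P x0 s (real DIM(real^'n))"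
      unfolding P_def
    proof (intro conjI allI impI ballI s(1))
      fix f :: "real^'n \<Rightarrow> real" and M x y
      assume f: "\<forall>x\<in>\<Omega>. f differentiable (at x) \<and> (\<forall>b\<in>Basis. \<bar>frechet_derivative f (at x) b\<bar> \<le> M)"
        and xy: "x \<in> \<Omega> \<inter> ball x0 s" "y \<in> \<Omega> \<inter> ball x0 s"
      show "\<bar>f x - f y\<bar> \<le> real DIM(real^'n) * M * dist x y"
        by (rule has_derivative_lipschitz[where D = "\<lambda>x. frechet_derivative f (at x)", OF convex_ball[of x0 s] open_ball])
           (use f s(2) xy in \<open>auto simp: frechet_derivative_works\<close>)
    qed
    then show ?thesis by blast
  next
    case False
    then have "x0 \<in> frontier \<Omega>"
      using x0 assms(2) by (simp add: frontier_def interior_open)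
    moreover from this obtain r \<psi> \<kappa> i where "boundary_chart \<Omega> k \<alpha> x0 r \<psi> \<kappa> i"
      using boundary_chart_exists[OF assms(1,2)] by blast
    ultimately show ?thesis
      using boundary_chart.local_lipschitz unfolding P_def by blast
  qed
  then obtain s L where sL: "\<And>x. x \<in> closure \<Omega> \<Longrightarrow> P x (s x) (L x)"
    by metis
  have cpt: "compact (closure \<Omega>)"
    using assms(4) by simp
  have "closure \<Omega> \<subseteq> (\<Union>x\<in>closure \<Omega>. ball x (s x))"
    using sL unfolding P_def by force
  then obtain T where T: "T \<subseteq> closure \<Omega>" "finite T" "closure \<Omega> \<subseteq> (\<Union>x\<in>T. ball x (s x))"
    using compactE_image[OF cpt, of "closure \<Omega>" "\<lambda>x. ball x (s x)"] by auto
  obtain e where e: "e > 0" "\<And>x. x \<in> closure \<Omega> \<Longrightarrow> \<exists>G\<in>(\<lambda>x. ball x (s x)) ` T. ball x e \<subseteq> G"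
    using Heine_Borel_lemma[OF cpt T(3)] by auto
  define Lm where "Lm = Max (insert 0 (L ` T))"
  have Lm: "0 \<le> Lm" "\<And>t. t \<in> T \<Longrightarrow> L t \<le> Lm"
    unfolding Lm_def using T(2) by auto
  define C where "C = max 1 (max (Lm * e powr (1 - \<alpha>)) (2 / e powr \<alpha>))"
  have "\<bar>f x - f y\<bar> \<le> C * M * dist x y powr \<alpha>"
    if f: "\<forall>x\<in>\<Omega>. f differentiable (at x) \<and> \<bar>f x\<bar> \<le> M \<and>
         (\<forall>b\<in>Basis. \<bar>frechet_derivative f (at x) b\<bar> \<le> M)"
      and xy: "x \<in> \<Omega>" "y \<in> \<Omega>" for f M x y
  proof -
    have M: "0 \<le> M"
      using f xy(1) by force
    show ?thesis
    proof (cases "dist x y < e")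
      case True
      obtain t where t: "t \<in> T" "ball x e \<subseteq> ball t (s t)"
        using e(2)[of x] xy closure_subset by blast
      have "x \<in> ball t (s t)" "y \<in> ball t (s t)"
        using subsetD[OF t(2), of x] subsetD[OF t(2), of y] e(1) True by auto
      then have "\<bar>f x - f y\<bar> \<le> L t * M * dist x y"
        using sL[of t] t(1) T(1) f xy unfolding P_def by blast
      also have "\<dots> \<le> Lm * M * dist x y"
        using Lm(2)[OF t(1)] M by (intro mult_right_mono) auto
      also have "\<dots> \<le> Lm * M * (e powr (1 - \<alpha>) * dist x y powr \<alpha>)"
        using True assms(6) Lm(1) M by (intro mult_left_mono le_powr_times_powr) auto
      also have "\<dots> = (Lm * e powr (1 - \<alpha>)) * (M * dist x y powr \<alpha>)"
        by simp
      also have "\<dots> \<le> C * (M * dist x y powr \<alpha>)"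
        using M by (intro mult_right_mono) (auto simp: C_def)
      finally show ?thesis by simp
    next
      case False
      then have "e powr \<alpha> \<le> dist x y powr \<alpha>"
        using e(1) assms(5) by (intro powr_mono2) auto
      then have "1 \<le> dist x y powr \<alpha> / e powr \<alpha>"
        using e(1) by simp
      then have "2 * M * 1 \<le> 2 * M * (dist x y powr \<alpha> / e powr \<alpha>)"
        using M by (intro mult_left_mono) auto
      moreover have "\<bar>f x - f y\<bar> \<le> 2 * M"
        using f xy abs_triangle_ineq4[of "f x" "f y"] by (smt (verit))
      moreover have "(2 / e powr \<alpha>) * (M * dist x y powr \<alpha>) \<le> C * (M * dist x y powr \<alpha>)"
        using M by (intro mult_right_mono) (auto simp: C_def)
      ultimately show ?thesis by simp
    qed
  qed
  moreover have "C \<ge> 1"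
    by (simp add: C_def)
  ultimately have "holder_embed \<Omega> \<alpha> C"
    using assms unfolding holder_embed_def by blast
  then show ?thesis by blast
qed

text \<open>Near a boundary point the normal is \<open>- grad \<rho> / \<bar>grad \<rho>\<bar>\<close> with \<open>\<rho>\<close> a component of the chart. Gluing
  the gradients with bump functions gives \<open>M = - \<mu> \<nu>\<close> on the boundary, \<open>\<mu> > 0\<close>. Before normalising, bumps
  supported inside \<open>\<Omega>\<close> are added to \<open>\<bar>M\<bar>\<^sup>2\<close> where \<open>M\<close> vanishes.\<close>

lemma outer_normal_extension:
  fixes \<Omega> :: "(real^'n) set"
  assumes "holder_boundary \<Omega> (Suc k) \<alpha>" "open \<Omega>" "\<Omega> \<noteq> {}" "bounded \<Omega>" "0 < \<alpha>" "\<alpha> < 1"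
  obtains N :: "real^'n \<Rightarrow> real^'n" and K where "\<And>j. holder_bd \<Omega> \<alpha> k (K j) (\<lambda>x. N x $ j)"
    "\<And>x. x \<in> frontier \<Omega> \<Longrightarrow> outer_normal \<Omega> x = N x"
proof -
  obtain C where C: "holder_embed \<Omega> \<alpha> C"
    using holder_embed_domain[OF assms] by blast
  obtain r \<psi> \<kappa> i where chart: "\<And>x. x \<in> frontier \<Omega> \<Longrightarrow> boundary_chart \<Omega> k \<alpha> x (r x) (\<psi> x) (\<kappa> x) (i x)"
    using boundary_chart_exists[OF assms(1,2)] by metis
  have r: "r x > 0" if "x \<in> frontier \<Omega>" for x
    using boundary_chart.r_pos[OF chart[OF that]] .
  define g where "g t = grad (ball t (r t)) (\<lambda>x. \<psi> t x $ i t)" for t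
  have "compact (frontier \<Omega>)"
    using assms(4) by (simp add: compact_frontier_bounded)
  moreover have "frontier \<Omega> \<subseteq> (\<Union>x\<in>frontier \<Omega>. ball x (r x / 2))"
    using r by force
  \<comment> \<open>Half radii cover the frontier, so cut-offs of half radius are positive somewhere
    at every frontier point while the gradients are controlled on the full balls.\<close>
  ultimately obtain T where T: "T \<subseteq> frontier \<Omega>" "finite T" "frontier \<Omega> \<subseteq> (\<Union>x\<in>T. ball x (r x / 2))"
    using compactE_image[of "frontier \<Omega>" "frontier \<Omega>" "\<lambda>x. ball x (r x / 2)"] by auto
  define M where "M x = (\<chi> j. \<Sum>t\<in>T. bump_ext t (r t / 2) (r t) (Suc k) (\<lambda>z. g t z $ j) x)" for x
  have "\<exists>K. holder_bd \<Omega> \<alpha> k K (bump_ext t (r t / 2) (r t) (Suc k) (\<lambda>z. g t z $ j))" if "t \<in> T" for t j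
  proof -
    have t: "t \<in> frontier \<Omega>"
      using that T by blast
    obtain K where K: "holder_bd (ball t (r t)) \<alpha> (Suc k) K (\<lambda>x. \<psi> t x $ i t)"
      using boundary_chart.holder_\<psi>[OF chart[OF t]] holder_on_iff_holder_bd by blast
    obtain C' where "holder_embed (ball t (r t)) \<alpha> C'"
      using holder_embed_ball[OF r[OF t] assms(5,6)] by blast
    moreover have "holder_bd (ball t (r t)) \<alpha> k K (\<lambda>z. g t z $ j)"
      using K by (simp add: g_def grad_def axis_in_Basis_iff)
    ultimately show ?thesis
      using holder_bd_bump_ext[of t "r t" \<alpha> C' "r t / 2" \<Omega> k K] r[OF t] assms(2,6) by auto
  qed
  then obtain KG where KG: "\<And>t j. t \<in> T \<Longrightarrow>
      holder_bd \<Omega> \<alpha> k (KG t j) (bump_ext t (r t / 2) (r t) (Suc k) (\<lambda>z. g t z $ j))"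
    by metis
  then have hM: "holder_bd \<Omega> \<alpha> k (\<Sum>t\<in>T. KG t j) (\<lambda>x. M x $ j)" for j
    unfolding M_def vec_lambda_beta by (rule holder_bd_sum[OF assms(2)])
  \<comment> \<open>On the frontier the gradients of all charts point along the same inward normal,
    so they cannot cancel in the sum and only their lengths add up.\<close>
  define \<mu> where "\<mu> x = (\<Sum>t\<in>T. bump_ext t (r t / 2) (r t) (Suc k) (\<lambda>z. norm (g t z)) x)" for x
  have \<mu>: "\<mu> x > 0" "M x = - \<mu> x *\<^sub>R outer_normal \<Omega> x" if x: "x \<in> frontier \<Omega>" for x
  proof -
    have gt: "g t x = - norm (g t x) *\<^sub>R outer_normal \<Omega> x" "g t x \<noteq> 0" if "t \<in> T" "x \<in> ball t (r t)" for t
    proof -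
      have t: "t \<in> frontier \<Omega>"
        using that T by blast
      show "g t x \<noteq> 0"
        using boundary_chart.g_nonzero[OF chart[OF t] that(2)] by (simp add: g_def)
      moreover have "outer_normal \<Omega> x = - g t x /\<^sub>R norm (g t x)"
        using boundary_chart.outer_normal_eq[OF chart[OF t] that(2) x] by (simp add: g_def)
      ultimately show "g t x = - norm (g t x) *\<^sub>R outer_normal \<Omega> x"
        by simp
    qed
    have "bump_ext t (r t / 2) (r t) (Suc k) (\<lambda>z. g t z $ j) x
        = - bump_ext t (r t / 2) (r t) (Suc k) (\<lambda>z. norm (g t z)) x * outer_normal \<Omega> x $ j" if "t \<in> T" for t j
    proof (cases "x \<in> ball t (r t)")
      case True
      have "g t x $ j = - norm (g t x) * outer_normal \<Omega> x $ j"
        using arg_cong[OF gt(1)[OF that True], of "\<lambda>v. v $ j"] by simp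
      then show ?thesis
        by (simp add: bump_ext_def)
    qed (simp add: bump_ext_def)
    then show "M x = - \<mu> x *\<^sub>R outer_normal \<Omega> x"
      by (simp add: M_def \<mu>_def vec_eq_iff sum_distrib_right sum_negf)
    obtain t where t: "t \<in> T" "x \<in> ball t (r t / 2)"
      using T(3) x by blast
    then have rt: "r t > 0"
      using T r by blast
    have "0 \<le> bump_ext t' (r t' / 2) (r t') (Suc k) (\<lambda>z. norm (g t' z)) x" for t'
      by (simp add: bump_ext_def bump_nonneg)
    moreover have "0 < bump_ext t (r t / 2) (r t) (Suc k) (\<lambda>z. norm (g t z)) x"
      using t(2) rt gt(2)[OF t(1)] bump_pos_iff[of "r t / 2" t x] by (simp add: bump_ext_def dist_commute)
    ultimately show "\<mu> x > 0"
      unfolding \<mu>_def using t(1) T(2) by (intro sum_pos2) auto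
  qed
  have cM: "continuous_on (closure \<Omega>) M"
    using hM holder_bd_continuous by (intro continuous_on_vec_lambda[of _ "\<lambda>j x. M x $ j", simplified]) blast
  define Z where "Z = {x \<in> closure \<Omega>. M x = 0}"
  have "closed Z"
    unfolding Z_def using continuous_closed_preimage_constant[OF cM] by simp
  then have "compact Z"
    using assms(4) unfolding Z_def by (simp add: compact_eq_bounded_closed bounded_subset[OF bounded_closure])
  have Z\<Omega>: "Z \<subseteq> \<Omega>"
  proof
    fix x assume x: "x \<in> Z"
    show "x \<in> \<Omega>"
    proof (rule ccontr)
      assume "x \<notin> \<Omega>"
      then have fr: "x \<in> frontier \<Omega>"
        using x assms(2) by (simp add: Z_def frontier_def interior_open)
      obtain t where "t \<in> T" "x \<in> ball t (r t)"
      proof -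
        obtain t where "t \<in> T" "x \<in> ball t (r t / 2)"
          using T(3) fr by blast
        moreover from this have "r t > 0"
          using T r by blast
        ultimately show ?thesis
          using that by simp
      qed
      then have "outer_normal \<Omega> x \<noteq> 0"
        using boundary_chart.outer_normal_eq[OF chart _ fr] boundary_chart.g_nonzero[OF chart] T(1)
        by (metis (no_types, lifting) divideR_right neg_equal_0_iff_equal norm_eq_zero scaleR_eq_0_iff inverse_nonzero_iff_nonzero subsetD)
      then show False
        using \<mu>[OF fr] x by (simp add: Z_def)
    qed
  qed
  have "\<exists>e>0. ball z (2 * e) \<subseteq> \<Omega>" if z: "z \<in> Z" for z
  proof -
    obtain e where "e > 0" "ball z e \<subseteq> \<Omega>"
      using openE[OF assms(2) subsetD[OF Z\<Omega> z]] by metis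
    then have "e / 2 > 0 \<and> ball z (2 * (e / 2)) \<subseteq> \<Omega>"
      by simp
    then show ?thesis
      by blast
  qed
  then obtain e where e: "\<And>z. z \<in> Z \<Longrightarrow> e z > 0" "\<And>z. z \<in> Z \<Longrightarrow> ball z (2 * e z) \<subseteq> \<Omega>"
    by metis
  have "Z \<subseteq> (\<Union>z\<in>Z. ball z (e z))"
    using e by force
  then obtain T' where T': "T' \<subseteq> Z" "finite T'" "Z \<subseteq> (\<Union>z\<in>T'. ball z (e z))"
    using compactE_image[OF \<open>compact Z\<close>, of Z "\<lambda>z. ball z (e z)"] by auto
  \<comment> \<open>Radius \<open>2 * e z\<close> leaves the gap between cut-off and ball that
    \<open>holder_bd_bump_ext\<close> asks for, still inside \<Omega>.\<close>
  define b where "b z = bump_ext z (e z) (2 * e z) (Suc k) (\<lambda>_. 1)" for z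
  have "\<exists>K. holder_bd \<Omega> \<alpha> k K (b z)" if "z \<in> T'" for z
  proof -
    have ez: "e z > 0"
      using that T' e by blast
    obtain C' where C': "holder_embed (ball z (2 * e z)) \<alpha> C'"
      using holder_embed_ball[of "2 * e z"] ez assms(5,6) by auto
    have "holder_bd (ball z (2 * e z)) \<alpha> k 1 (\<lambda>_. 1)"
      by (intro holder_bd_const) auto
    then show ?thesis
      unfolding b_def using holder_bd_bump_ext[OF C' assms(6), of "e z"] ez assms(2) by auto
  qed
  then obtain Kb where Kb: "\<And>z. z \<in> T' \<Longrightarrow> holder_bd \<Omega> \<alpha> k (Kb z) (b z)"
    by metis
  have b0: "0 \<le> b z x" for z x
    by (simp add: b_def bump_ext_def bump_nonneg)
  \<comment> \<open>The squared length is polynomial in the components, whereas the length itself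
    could lose smoothness where \<open>M\<close> vanishes. The root is taken once the sum is
    positive; on the frontier the bumps vanish and the value is \<open>\<mu> x ^ 2\<close>.\<close>
  define \<tau> where "\<tau> x = (\<Sum>j\<in>UNIV. M x $ j * M x $ j) + (\<Sum>z\<in>T'. b z x)" for x
  obtain c where mult: "\<And>f g K L. holder_bd \<Omega> \<alpha> k K f \<Longrightarrow> holder_bd \<Omega> \<alpha> k L g \<Longrightarrow>
      holder_bd \<Omega> \<alpha> k (c * K * L) (\<lambda>x. f x * g x)"
    using holder_bd_mult[OF C] by metis
  obtain K\<tau> where h\<tau>: "holder_bd \<Omega> \<alpha> k K\<tau> \<tau>"
  proof -
    have "holder_bd \<Omega> \<alpha> k (\<Sum>j\<in>UNIV. c * (\<Sum>t\<in>T. KG t j) * (\<Sum>t\<in>T. KG t j)) (\<lambda>x. \<Sum>j\<in>UNIV. M x $ j * M x $ j)"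
      by (intro holder_bd_sum assms(2) mult hM)
    moreover have "holder_bd \<Omega> \<alpha> k (\<Sum>z\<in>T'. Kb z) (\<lambda>x. \<Sum>z\<in>T'. b z x)"
      by (intro holder_bd_sum assms(2) Kb)
    ultimately have "holder_bd \<Omega> \<alpha> k ((\<Sum>j\<in>UNIV. c * (\<Sum>t\<in>T. KG t j) * (\<Sum>t\<in>T. KG t j)) + (\<Sum>z\<in>T'. Kb z)) \<tau>"
      unfolding \<tau>_def by (rule holder_bd_add[OF assms(2)])
    then show ?thesis
      using that by blast
  qed
  have pos: "\<tau> x > 0" if x: "x \<in> closure \<Omega>" for x
  proof (cases "M x = 0")
    case True
    then have "x \<in> Z"
      using x by (simp add: Z_def)
    then obtain z where z: "z \<in> T'" "x \<in> ball z (e z)"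
      using T'(3) by blast
    then have "e z > 0"
      using T' e by blast
    then have "0 < b z x"
      using z(2) bump_pos_iff[of "e z" z x] by (simp add: b_def bump_ext_def dist_commute)
    then have "0 < (\<Sum>z\<in>T'. b z x)"
      using z(1) T'(2) b0 by (intro sum_pos2) auto
    moreover have "0 \<le> (\<Sum>j\<in>UNIV. M x $ j * M x $ j)"
      by (intro sum_nonneg) auto
    ultimately show ?thesis
      by (simp add: \<tau>_def)
  next
    case False
    then have "0 < M x \<bullet> M x"
      by simp
    moreover have "0 \<le> (\<Sum>z\<in>T'. b z x)"
      using b0 by (intro sum_nonneg) auto
    ultimately show ?thesis
      by (simp add: \<tau>_def inner_vec_def)
  qed
  obtain z0 where z0: "z0 \<in> closure \<Omega>" "\<And>x. x \<in> closure \<Omega> \<Longrightarrow> \<tau> z0 \<le> \<tau> x"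
    using continuous_attains_inf[of "closure \<Omega>" \<tau>] assms(3,4) holder_bd_continuous[OF h\<tau>] by auto
  obtain L where L: "holder_bd \<Omega> \<alpha> k L (\<lambda>x. \<tau> x powr (- 1 / 2))"
    using holder_bd_powr[OF C h\<tau> pos[OF z0(1)] z0(2)] by blast
  define N where "N x = (\<chi> j. - 1 * (M x $ j * \<tau> x powr (- 1 / 2)))" for x
  have "holder_bd \<Omega> \<alpha> k (\<bar>- 1\<bar> * (c * (\<Sum>t\<in>T. KG t j) * L)) (\<lambda>x. N x $ j)" for j
    unfolding N_def vec_lambda_beta by (intro holder_bd_cmult assms(2) mult hM L)
  moreover have "outer_normal \<Omega> x = N x" if x: "x \<in> frontier \<Omega>" for x
  proof -
    have "x \<notin> \<Omega>"
      using x assms(2) by (simp add: frontier_def interior_open)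
    then have "x \<notin> ball z (2 * e z)" if "z \<in> T'" for z
      using e(2)[of z] that T'(1) by blast
    then have "b z x = 0" if "z \<in> T'" for z
      using that by (simp only: b_def bump_ext_def if_False)
    moreover obtain t where t: "t \<in> T" "x \<in> ball t (r t / 2)"
      using T(3) x by blast
    have tf: "t \<in> frontier \<Omega>" "x \<in> ball t (r t)"
      using t T r[of t] by auto
    have "norm (outer_normal \<Omega> x) = 1"
      using boundary_chart.outer_normal_eq[OF chart[OF tf(1)] tf(2) x]
        boundary_chart.g_nonzero[OF chart[OF tf(1)] tf(2)] by simp
    then have "M x \<bullet> M x = \<mu> x ^ 2"
      unfolding \<mu>(2)[OF x] by (simp add: dot_square_norm power2_eq_square)
    ultimately have "\<tau> x = \<mu> x ^ 2"
      by (simp add: \<tau>_def inner_vec_def)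
    then have "\<tau> x = \<mu> x powr 2"
      using \<mu>(1)[OF x] powr_numeral[of "\<mu> x" num.One] by simp
    then have "\<tau> x powr (- 1 / 2) = \<mu> x powr (2 * (- 1 / 2))"
      by (simp only: powr_powr)
    also have "\<dots> = 1 / \<mu> x"
      using powr_neg_one[OF \<mu>(1)[OF x]] by simp
    finally have "\<tau> x powr (- 1 / 2) = 1 / \<mu> x" .
    then show ?thesis
      using \<mu>(1)[OF x] by (simp add: N_def \<mu>(2)[OF x] vec_eq_iff)
  qed
  ultimately show ?thesis
    by (rule that)
qed

text \<open>The product of \<open>N\<close> with the gradient extends the normal derivative to the
  closure. Its Hoelder norm bounds the quotient norm, and the product estimate is linear in the norm
  of \<open>u\<close>.\<close>

lemma normal_deriv_bounded:
  fixes \<Omega> :: "(real^'n) set"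
  assumes "holder_boundary \<Omega> (Suc k) \<alpha>" "open \<Omega>" "\<Omega> \<noteq> {}" "bounded \<Omega>" "0 < \<alpha>" "\<alpha> < 1"
  obtains C where "\<And>u. u \<in> holder_space \<Omega> (Suc k) \<alpha> \<Longrightarrow> normal_deriv \<Omega> u \<in> bdry_space \<Omega> k \<alpha>"
    "\<And>u. u \<in> holder_space \<Omega> (Suc k) \<alpha> \<Longrightarrow>
       bdry_norm \<Omega> k \<alpha> (normal_deriv \<Omega> u) \<le> C * holder_norm \<Omega> (Suc k) \<alpha> u"
proof -
  obtain N K where N: "\<And>j. holder_bd \<Omega> \<alpha> k (K j) (\<lambda>x. N x $ j)"
    "\<And>x. x \<in> frontier \<Omega> \<Longrightarrow> outer_normal \<Omega> x = N x"
    by (rule outer_normal_extension[OF assms]) (rule that)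
  obtain C where C: "holder_embed \<Omega> \<alpha> C"
    using holder_embed_domain[OF assms] by blast
  obtain c where mult: "\<And>f g K L. holder_bd \<Omega> \<alpha> k K f \<Longrightarrow> holder_bd \<Omega> \<alpha> k L g \<Longrightarrow>
      holder_bd \<Omega> \<alpha> k (c * K * L) (\<lambda>x. f x * g x)"
    using holder_bd_mult[OF C] by metis
  \<comment> \<open>Set to zero off the closure, as elements of \<open>holder_space\<close>
    are.\<close>
  define F where "F u x = (if x \<in> closure \<Omega> then (\<Sum>j\<in>UNIV. N x $ j * pd \<Omega> (axis j 1) u x) else 0)" for u x
  define C' where "C' = real (k + 2) * (\<Sum>j\<in>UNIV. c * K j)"
  have *: "F u \<in> holder_space \<Omega> k \<alpha> \<and> holder_norm \<Omega> k \<alpha> (F u) \<le> C' * holder_norm \<Omega> (Suc k) \<alpha> u \<and>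
      (\<forall>x\<in>frontier \<Omega>. F u x = normal_deriv \<Omega> u x)" if u: "u \<in> holder_space \<Omega> (Suc k) \<alpha>" for u
  proof -
    have "holder_bd \<Omega> \<alpha> (Suc k) (holder_norm \<Omega> (Suc k) \<alpha> u) u"
      using holder_bd_norm[OF assms(2,3)] u unfolding holder_space_def by blast
    then have "holder_bd \<Omega> \<alpha> k (holder_norm \<Omega> (Suc k) \<alpha> u) (pd \<Omega> (axis j 1) u)" for j
      by (simp add: axis_in_Basis_iff)
    then have "holder_bd \<Omega> \<alpha> k (\<Sum>j\<in>UNIV. c * K j * holder_norm \<Omega> (Suc k) \<alpha> u)
        (\<lambda>x. \<Sum>j\<in>UNIV. N x $ j * pd \<Omega> (axis j 1) u x)"
      by (intro holder_bd_sum assms(2) mult N(1))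
    then have F: "holder_bd \<Omega> \<alpha> k (\<Sum>j\<in>UNIV. c * K j * holder_norm \<Omega> (Suc k) \<alpha> u) (F u)"
      by (rule holder_bd_cong[OF assms(2)]) (simp add: F_def)
    have "F u \<in> holder_space \<Omega> k \<alpha>"
      using F unfolding holder_space_def holder_on_iff_holder_bd by (auto simp: F_def)
    moreover have "holder_norm \<Omega> k \<alpha> (F u) \<le> C' * holder_norm \<Omega> (Suc k) \<alpha> u"
      using holder_norm_le[OF assms(2,3) F] by (simp add: C'_def sum_distrib_right algebra_simps sum_distrib_left)
    moreover have "F u x = normal_deriv \<Omega> u x" if "x \<in> frontier \<Omega>" for x
      using that N(2)[OF that] by (simp add: F_def normal_deriv_def inner_vec_def grad_def frontier_def)
    ultimately show ?thesis by blast
  qed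
  show ?thesis
  proof
    show "normal_deriv \<Omega> u \<in> bdry_space \<Omega> k \<alpha>" if "u \<in> holder_space \<Omega> (Suc k) \<alpha>" for u
      using *[OF that] by (auto simp: bdry_space_def normal_deriv_def)
    show "bdry_norm \<Omega> k \<alpha> (normal_deriv \<Omega> u) \<le> C' * holder_norm \<Omega> (Suc k) \<alpha> u"
      if "u \<in> holder_space \<Omega> (Suc k) \<alpha>" for u
      using *[OF that] bdry_norm_le[OF assms(2,3), of "F u" k \<alpha> "normal_deriv \<Omega> u"] by fastforce
  qed
qed


section \<open>The linearised problem\<close>

text \<open>The operator is a trace, whereas Jacobi's formula and the maximum principle speak of
  entrywise sums. Symmetry of the Hessian reconciles them.\<close>

lemma trace_mult_symmetric:
  fixes C H :: "real^'n^'n"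
  assumes "\<And>i j. H $ i $ j = H $ j $ i"
  shows "trace (C ** H) = (\<Sum>i\<in>UNIV. \<Sum>j\<in>UNIV. C $ i $ j * H $ i $ j)"
  unfolding trace_def matrix_matrix_mult_def using assms by simp

section \<open>Linearity and coefficients of the linearised operator\<close>

lemma grad_linear:
  fixes x :: "real^'n"
  assumes "open U" "holder_on U (Suc k) \<alpha> f" "holder_on U (Suc k) \<alpha> g" "x \<in> closure U"
  shows "grad U (\<lambda>x. f x + c * g x) x = grad U f x + c *\<^sub>R grad U g x"
proof -
  have "[axis i (1::real)] \<in> dirs 1" for i :: 'n
    by (auto simp: dirs_def axis_in_Basis_iff)
  then have "pds U [axis i 1] (\<lambda>x. f x + c * g x) x = pds U [axis i 1] f x + c * pds U [axis i 1] g x" for i :: 'n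
    by (rule pds_linear[OF assms(1-3) _ _ assms(4)]) simp
  then show ?thesis
    by (simp add: vec_eq_iff grad_def)
qed

lemma hess_linear:
  fixes x :: "real^'n"
  assumes "open U" "holder_on U (Suc (Suc k)) \<alpha> f" "holder_on U (Suc (Suc k)) \<alpha> g" "x \<in> closure U"
  shows "hess U (\<lambda>x. f x + c * g x) x = hess U f x + c *\<^sub>R hess U g x"
proof -
  have "[axis i (1::real), axis j 1] \<in> dirs 2" for i j :: 'n
    by (auto simp: dirs_def axis_in_Basis_iff)
  then have "pds U [axis i 1, axis j 1] (\<lambda>x. f x + c * g x) x
      = pds U [axis i 1, axis j 1] f x + c * pds U [axis i 1, axis j 1] g x" for i j :: 'n
    by (rule pds_linear[OF assms(1-3) _ _ assms(4)]) simp
  then show ?thesis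
    by (simp add: vec_eq_iff hess_def)
qed

lemma lin_op_linear:
  assumes "open \<Omega>" "holder_on \<Omega> (Suc (Suc k)) \<alpha> f" "holder_on \<Omega> (Suc (Suc k)) \<alpha> g" "x \<in> \<Omega>"
  shows "lin_op \<Omega> a \<Phi> (\<lambda>x. f x + c * g x) x = lin_op \<Omega> a \<Phi> f x + c * lin_op \<Omega> a \<Phi> g x"
proof -
  have "x \<in> closure \<Omega>"
    using assms(4) closure_subset by blast
  note lin = grad_linear[OF assms(1-3) this] hess_linear[OF assms(1-3) this]
  have "trace (C ** (H + c *\<^sub>R H')) = trace (C ** H) + c * trace (C ** H')" for C H H' :: "real^'n^'n"
    by (simp add: trace_def matrix_matrix_mult_def algebra_simps sum.distrib sum_distrib_left)
  then show ?thesis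
    unfolding lin_op_def lin by (simp add: inner_add_right algebra_simps)
qed

text \<open>The maximum principle asks for semidefiniteness and a uniform lower bound on one
  diagonal entry. That entry is continuous and positive on a compact set, so it attains a positive
  minimum.\<close>

lemma cof_hess_lower_bound:
  fixes \<Omega> :: "(real^'n) set"
  assumes "open \<Omega>" "\<Omega> \<noteq> {}" "bounded \<Omega>" "holder_on \<Omega> (Suc (Suc k)) \<alpha> \<Phi>"
    and "c0 > 0" "\<forall>x\<in>closure \<Omega>. \<forall>\<xi>. \<xi> \<bullet> (hess \<Omega> \<Phi> x *v \<xi>) \<ge> c0 * (\<xi> \<bullet> \<xi>)"
  obtains c where "c > 0" "\<And>x. x \<in> closure \<Omega> \<Longrightarrow> c \<le> cof (hess \<Omega> \<Phi> x) $ p $ p"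
    "\<And>x \<xi>. x \<in> closure \<Omega> \<Longrightarrow> 0 \<le> \<xi> \<bullet> (cof (hess \<Omega> \<Phi> x) *v \<xi>)"
proof -
  have "0 < \<xi> \<bullet> (hess \<Omega> \<Phi> x *v \<xi>)" if "x \<in> closure \<Omega>" "\<xi> \<noteq> 0" for x \<xi>
  proof -
    have "0 < c0 * (\<xi> \<bullet> \<xi>)"
      using assms(5) that(2) by simp
    then show ?thesis
      using assms(6) that(1) by (meson order_less_le_trans)
  qed
  then have pos: "0 < \<xi> \<bullet> (cof (hess \<Omega> \<Phi> x) *v \<xi>)" if "x \<in> closure \<Omega>" "\<xi> \<noteq> 0" for x \<xi>
    using that by (intro cof_pos_def) auto
  have H: "continuous_on (closure \<Omega>) (\<lambda>x. hess \<Omega> \<Phi> x $ i $ j)" for i j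
  proof -
    have "[axis i 1, axis j 1 :: real^'n] \<in> dirs 2"
      by (auto simp: dirs_def axis_in_Basis_iff)
    from assms(4)[unfolded holder_on_def, THEN conjunct2, THEN conjunct1, rule_format, OF _ this]
    have "continuous_on (closure \<Omega>) (pds \<Omega> [axis i 1, axis j 1] \<Phi>)"
      by simp
    then show ?thesis
      by (simp add: hess_def)
  qed
  have H': "continuous_on (closure \<Omega>) (\<lambda>x. if P then 1 else if Q then 0 else hess \<Omega> \<Phi> x $ i $ j)" for P Q i j
    using H by (cases P; cases Q) auto
  have "continuous_on (closure \<Omega>) (\<lambda>x. cof (hess \<Omega> \<Phi> x) $ p $ p)"
    unfolding cof_def det_def vec_lambda_beta by (intro continuous_intros H')
  then obtain z where z: "z \<in> closure \<Omega>"
    "\<And>x. x \<in> closure \<Omega> \<Longrightarrow> cof (hess \<Omega> \<Phi> z) $ p $ p \<le> cof (hess \<Omega> \<Phi> x) $ p $ p"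
    using continuous_attains_inf[of "closure \<Omega>" "\<lambda>x. cof (hess \<Omega> \<Phi> x) $ p $ p"] assms(2,3) by auto
  have "0 < axis p 1 \<bullet> (cof (hess \<Omega> \<Phi> z) *v axis p 1)"
    by (intro pos z(1)) (simp add: axis_eq_0_iff)
  then have "0 < cof (hess \<Omega> \<Phi> z) $ p $ p"
    by (simp only: inner_axis_matrix)
  moreover have "0 \<le> \<xi> \<bullet> (cof (hess \<Omega> \<Phi> x) *v \<xi>)" if "x \<in> closure \<Omega>" for x \<xi>
    using pos[OF that, of \<xi>] by (cases "\<xi> = 0") auto
  ultimately show ?thesis
    using that z(2) by blast
qed

text \<open>\<open>holder_on\<close> over the unbounded set \<open>jets \<Omega>\<close> includes
  boundedness of the derivatives, which bounds the drift for every \<Phi>.\<close>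

lemma b_coeff_bounded:
  fixes \<Omega> :: "(real^'n) set"
  assumes "holder_on (jets \<Omega>) (Suc k) \<alpha> a"
  obtains K where "\<And>x p. x \<in> \<Omega> \<Longrightarrow> \<bar>b_coeff \<Omega> a \<Phi> x $ p\<bar> \<le> K"
proof -
  obtain K where K: "holder_bd (jets \<Omega>) \<alpha> (Suc k) K a"
    using assms holder_on_iff_holder_bd by blast
  have "\<bar>b_coeff \<Omega> a \<Phi> x $ p\<bar> \<le> K" if "x \<in> \<Omega>" for x p
  proof -
    have "(0, 0, axis p 1) \<in> (Basis :: ((real^'n) \<times> real \<times> (real^'n)) set)"
      by (auto simp: Basis_prod_def axis_in_Basis_iff)
    then have "holder_bd (jets \<Omega>) \<alpha> k K (pd (jets \<Omega>) (0, 0, axis p 1) a)"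
      using K by simp
    moreover have "(x, \<Phi> x, grad \<Omega> \<Phi> x) \<in> closure (jets \<Omega>)"
      by (rule subsetD[OF closure_subset]) (use that in simp)
    ultimately show ?thesis
      by (simp add: b_coeff_def holder_bd_le)
  qed
  then show ?thesis
    using that by blast
qed

lemma lin_solution_le:
  fixes \<Omega> :: "(real^'n) set"
  assumes "open \<Omega>" "\<Omega> \<noteq> {}" "bounded \<Omega>"
    and "holder_on (jets \<Omega>) (Suc k) \<alpha> a" "\<Phi> \<in> holder_space \<Omega> (m + 2) \<alpha>"
    and "c0 > 0" "\<forall>x\<in>closure \<Omega>. \<forall>\<xi>. \<xi> \<bullet> (hess \<Omega> \<Phi> x *v \<xi>) \<ge> c0 * (\<xi> \<bullet> \<xi>)"
    and "\<forall>x\<in>\<Omega>. q_coeff \<Omega> a \<Phi> x \<ge> 0"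
    and v: "lin_solution \<Omega> m \<alpha> a \<Phi> h v" and w: "lin_solution \<Omega> m \<alpha> a \<Phi> h w"
    and "x \<in> closure \<Omega>"
  shows "v x \<le> w x"
proof -
  have \<Phi>: "holder_on \<Omega> (Suc (Suc m)) \<alpha> \<Phi>" and vw: "holder_on \<Omega> (Suc (Suc m)) \<alpha> v" "holder_on \<Omega> (Suc (Suc m)) \<alpha> w"
    using assms(5) v w by (auto simp: holder_space_def lin_solution_def)
  \<comment> \<open>Any coordinate can carry the exponential perturbation.\<close>
  fix p :: 'n
  obtain c where c: "c > 0" "\<And>x. x \<in> closure \<Omega> \<Longrightarrow> c \<le> cof (hess \<Omega> \<Phi> x) $ p $ p"
    "\<And>x \<xi>. x \<in> closure \<Omega> \<Longrightarrow> 0 \<le> \<xi> \<bullet> (cof (hess \<Omega> \<Phi> x) *v \<xi>)"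
    by (rule cof_hess_lower_bound[OF assms(1-3) \<Phi> assms(6,7)]) (rule that)
  obtain K where K: "\<And>x p. x \<in> \<Omega> \<Longrightarrow> \<bar>b_coeff \<Omega> a \<Phi> x $ p\<bar> \<le> K"
    by (rule b_coeff_bounded[OF assms(4)]) (rule that)
  define u where "u = (\<lambda>x. v x + (- 1) * w x)"
  have u: "holder_on \<Omega> (Suc (Suc m)) \<alpha> u"
    unfolding u_def by (rule holder_on_linear[OF assms(1) vw])
  have L0: "lin_op \<Omega> a \<Phi> u y = 0" if "y \<in> \<Omega>" for y
    unfolding u_def lin_op_linear[OF assms(1) vw that] using v w that by (simp add: lin_solution_def)
  have L: "0 \<le> (\<Sum>i\<in>UNIV. \<Sum>j\<in>UNIV. cof (hess \<Omega> \<Phi> y) $ i $ j * hess \<Omega> u y $ i $ j)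
      - b_coeff \<Omega> a \<Phi> y \<bullet> grad \<Omega> u y - q_coeff \<Omega> a \<Phi> y * u y" if "y \<in> \<Omega>" for y
    using L0[OF that] trace_mult_symmetric[OF hess_symmetric[OF assms(1) u that]] by (simp add: lin_op_def)
  have cl: "y \<in> closure \<Omega>" if "y \<in> \<Omega>" for y
    using that closure_subset by blast
  have "u x \<le> 0"
    by (rule weak_maximum_principle[where C = "\<lambda>x. cof (hess \<Omega> \<Phi> x)" and p = p and c = c and K = K,
          OF assms(1,3) u c(3)[OF cl] c(1) c(2)[OF cl] K _ L _ assms(11)])
       (use assms(8) v w in \<open>auto simp: lin_solution_def u_def\<close>)
  then show ?thesis
    by (simp add: u_def)
qed

lemma lin_solution_unique:
  fixes \<Omega> :: "(real^'n) set"
  assumes "open \<Omega>" "\<Omega> \<noteq> {}" "bounded \<Omega>"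
    and "holder_on (jets \<Omega>) (Suc k) \<alpha> a" "\<Phi> \<in> holder_space \<Omega> (m + 2) \<alpha>"
    and "c0 > 0" "\<forall>x\<in>closure \<Omega>. \<forall>\<xi>. \<xi> \<bullet> (hess \<Omega> \<Phi> x *v \<xi>) \<ge> c0 * (\<xi> \<bullet> \<xi>)"
    and "\<forall>x\<in>\<Omega>. q_coeff \<Omega> a \<Phi> x \<ge> 0"
    and v: "lin_solution \<Omega> m \<alpha> a \<Phi> h v" and w: "lin_solution \<Omega> m \<alpha> a \<Phi> h w"
  shows "v = w"
proof
  fix x
  show "v x = w x"
  proof (cases "x \<in> closure \<Omega>")
    case True
    then show ?thesis
      using lin_solution_le[OF assms] lin_solution_le[OF assms(1-8) w v] by (meson order_antisym)
  next
    case False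
    then show ?thesis
      using v w by (simp add: lin_solution_def holder_space_def)
  qed
qed

text \<open>Evaluating a derivative of order at most \<open>k\<close> at a fixed point is linear and
  bounded by \<open>holder_norm\<close>. So an expansion in norm yields a derivative in
  \<open>t\<close> at every point, boundary points included.\<close>

lemma little_o_t_pds:
  assumes "open U" "U \<noteq> {}" "f0 \<in> holder_space U k \<alpha>" "v \<in> holder_space U k \<alpha>"
    and o: "little_o_t (holder_space U k \<alpha>) (holder_norm U k \<alpha>) (\<lambda>t x. f t x - f0 x - t * v x)"
    and "f 0 = f0" "bs \<in> dirs j" "j \<le> k" "x \<in> closure U"
  shows "((\<lambda>t. pds U bs (f t) x) has_real_derivative pds U bs v x) (at 0)"
proof -
  define R where "R t = (\<lambda>x. f t x - f0 x - t * v x)" for t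
  have R: "\<forall>\<^sub>F t in at 0. R t \<in> holder_space U k \<alpha>" "((\<lambda>t. holder_norm U k \<alpha> (R t) / \<bar>t\<bar>) \<longlongrightarrow> 0) (at 0)"
    using o unfolding little_o_t_def R_def by auto
  have hv: "holder_on U k \<alpha> v" "holder_on U k \<alpha> f0"
    using assms(3,4) by (auto simp: holder_space_def)
  have "\<forall>\<^sub>F t in at 0. norm ((pds U bs (f (0 + t)) x - pds U bs (f 0) x) / t - pds U bs v x)
      \<le> holder_norm U k \<alpha> (R t) / \<bar>t\<bar>"
    \<comment> \<open>The second fact supplies \<open>t \<noteq> 0\<close>.\<close>
    using R(1) eventually_at_ball'[OF zero_less_one, of 0 UNIV]
  proof eventually_elim
    case (elim t)
    have hR: "holder_on U k \<alpha> (R t)"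
      using elim(1) by (simp add: holder_space_def)
    have "f t = (\<lambda>x. R t x + 1 * (f0 x + t * v x))"
      by (auto simp: R_def)
    then have "pds U bs (f t) x = pds U bs (R t) x + (pds U bs f0 x + t * pds U bs v x)"
      using pds_linear[OF assms(1) hR holder_on_linear[OF assms(1) hv(2,1), of t] assms(7-9), of 1]
        pds_linear[OF assms(1) hv(2,1) assms(7-9), of t] by simp
    then have "(pds U bs (f (0 + t)) x - pds U bs (f 0) x) / t - pds U bs v x = pds U bs (R t) x / t"
      using elim(2) assms(6) by (simp add: field_simps)
    moreover have "\<bar>pds U bs (R t) x\<bar> \<le> holder_norm U k \<alpha> (R t)"
      using holder_bd_norm[OF assms(1,2) hR] assms(7-9) unfolding holder_bd_iff by blast
    ultimately show ?case
      by (simp add: divide_right_mono)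
  qed
  then have "((\<lambda>t. (pds U bs (f (0 + t)) x - pds U bs (f 0) x) / t - pds U bs v x) \<longlongrightarrow> 0) (at 0)"
    by (rule Lim_null_comparison[OF _ R(2)])
  then show ?thesis
    unfolding DERIV_def by (rule LIM_zero_cancel)
qed

lemma lin_solution_derivative:
  fixes \<Omega> :: "(real^'n) set"
  assumes "open \<Omega>" "\<Omega> \<noteq> {}" "holder_on (jets \<Omega>) (Suc k) \<alpha> a"
    and \<Phi>: "\<Phi> \<in> holder_space \<Omega> (m + 2) \<alpha>" and v: "v \<in> holder_space \<Omega> (m + 2) \<alpha>"
    and o: "little_o_t (holder_space \<Omega> (m + 2) \<alpha>) (holder_norm \<Omega> (m + 2) \<alpha>) (\<lambda>t x. u t x - \<Phi> x - t * v x)"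
    and u0: "u 0 = \<Phi>" and MA: "\<forall>\<^sub>F t in nhds 0. MA_solution \<Omega> m \<alpha> a (\<lambda>x. \<phi> x + t * h x) (u t)"
  shows "lin_solution \<Omega> m \<alpha> a \<Phi> h v"
proof -
  note der = little_o_t_pds[where f = u, OF assms(1,2) \<Phi> v o u0]
  have der0: "((\<lambda>t. u t x) has_real_derivative v x) (at 0)" if "x \<in> closure \<Omega>" for x
    using der[of "[]" 0, OF _ _ that] by (simp add: dirs_def)
  have der1: "((\<lambda>t. grad \<Omega> (u t) x $ i) has_real_derivative grad \<Omega> v x $ i) (at 0)" if "x \<in> closure \<Omega>" for x i
    using der[of "[axis i 1]" 1, OF _ _ that] by (simp add: dirs_def grad_def axis_in_Basis_iff)
  have der2: "((\<lambda>t. hess \<Omega> (u t) x $ i $ j) has_real_derivative hess \<Omega> v x $ i $ j) (at 0)"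
    if "x \<in> closure \<Omega>" for x i j
    using der[of "[axis i 1, axis j 1]" 2, OF _ _ that] by (simp add: dirs_def hess_def axis_in_Basis_iff)
  have "lin_op \<Omega> a \<Phi> v x = 0" if x: "x \<in> \<Omega>" for x
  proof -
    have xc: "x \<in> closure \<Omega>"
      using x closure_subset by blast
    let ?P = "(x, \<Phi> x, grad \<Omega> \<Phi> x)"
    have P: "?P \<in> jets \<Omega>"
      using x by simp
    define da where "da = frechet_derivative a (at ?P)"
    obtain K where K: "holder_bd (jets \<Omega>) \<alpha> (Suc k) K a"
      using assms(3) holder_on_iff_holder_bd by blast
    have da: "(a has_derivative da) (at ?P)"
      unfolding da_def using holder_bd_SucD(1)[OF K P] .
    note lin = has_derivative_linear[OF da]
    have "((\<lambda>t. grad \<Omega> (u t) x) has_derivative (\<lambda>s. s *\<^sub>R grad \<Omega> v x)) (at 0)"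
      using der1[OF xc] by (intro has_derivative_vec_nthI) (simp add: has_field_derivative_def mult_commute_abs)
    then have "((\<lambda>t. (x, u t x, grad \<Omega> (u t) x)) has_derivative (\<lambda>s. (0, s * v x, s *\<^sub>R grad \<Omega> v x))) (at 0)"
      using der0[OF xc] by (intro has_derivative_Pair has_derivative_const)
        (auto simp: has_field_derivative_def mult_commute_abs)
    from has_derivative_compose[OF this, of a da] da
    have "((\<lambda>t. a (x, u t x, grad \<Omega> (u t) x)) has_derivative (\<lambda>s. da (0, s * v x, s *\<^sub>R grad \<Omega> v x))) (at 0)"
      by (simp add: u0)
    moreover have "da (0, s * v x, s *\<^sub>R grad \<Omega> v x) = (q_coeff \<Omega> a \<Phi> x * v x + b_coeff \<Omega> a \<Phi> x \<bullet> grad \<Omega> v x) * s" for s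
    proof -
      have pd: "pd (jets \<Omega>) e a ?P = da e" for e
        using P by (simp add: pd_def da_def)
      \<comment> \<open>Splits the velocity of the jet into the directions in which the differential
        of \<open>a\<close> is named by \<open>q_coeff\<close> and \<open>b_coeff\<close>.\<close>
      have "(0 :: real^'n, s * v x, s *\<^sub>R grad \<Omega> v x)
          = s *\<^sub>R (v x *\<^sub>R (0, 1, 0) + (\<Sum>i\<in>UNIV. grad \<Omega> v x $ i *\<^sub>R (0, 0, axis i 1)))"
      proof -
        have S: "(\<Sum>i\<in>UNIV. grad \<Omega> v x $ i *\<^sub>R (0 :: real^'n, 0 :: real, axis i 1)) = (0, 0, grad \<Omega> v x)"
          using basis_expansion[of "grad \<Omega> v x"]
          by (simp add: prod_eq_iff fst_sum snd_sum scalar_mult_eq_scaleR)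
        show ?thesis
          unfolding S by simp
      qed
      then have "da (0, s * v x, s *\<^sub>R grad \<Omega> v x)
          = s * (v x * da (0, 1, 0) + (\<Sum>i\<in>UNIV. grad \<Omega> v x $ i * da (0, 0, axis i 1)))"
        by (simp only: linear_add[OF lin] linear_cmul[OF lin] linear_sum[OF lin] real_scaleR_def)
      then show ?thesis
        unfolding q_coeff_def b_coeff_def pd by (simp add: inner_vec_def algebra_simps)
    qed
    ultimately have 1: "((\<lambda>t. a (x, u t x, grad \<Omega> (u t) x)) has_real_derivative
        q_coeff \<Omega> a \<Phi> x * v x + b_coeff \<Omega> a \<Phi> x \<bullet> grad \<Omega> v x) (at 0)"
      by (simp add: has_field_derivative_def)
    have 2: "((\<lambda>t. det (hess \<Omega> (u t) x)) has_real_derivative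
        (\<Sum>i\<in>UNIV. \<Sum>j\<in>UNIV. hess \<Omega> v x $ i $ j * cof (hess \<Omega> \<Phi> x) $ i $ j)) (at 0)"
      using has_real_derivative_det[OF der2[OF xc]] by (simp add: u0)
    \<comment> \<open>The equation at \<open>t = 0\<close> is included, as equality of derivatives
      at zero requires agreement at zero too.\<close>
    have ev: "\<forall>\<^sub>F t in nhds 0. det (hess \<Omega> (u t) x) = a (x, u t x, grad \<Omega> (u t) x)"
      using MA by eventually_elim (use x in \<open>simp add: MA_solution_def\<close>)
    have "((\<lambda>t. det (hess \<Omega> (u t) x)) has_real_derivative
        q_coeff \<Omega> a \<Phi> x * v x + b_coeff \<Omega> a \<Phi> x \<bullet> grad \<Omega> v x) (at 0)"
      using 1 DERIV_cong_ev[OF refl ev refl] by blast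
    from DERIV_unique[OF 2 this]
    have "(\<Sum>i\<in>UNIV. \<Sum>j\<in>UNIV. hess \<Omega> v x $ i $ j * cof (hess \<Omega> \<Phi> x) $ i $ j)
        = q_coeff \<Omega> a \<Phi> x * v x + b_coeff \<Omega> a \<Phi> x \<bullet> grad \<Omega> v x" .
    moreover have "holder_on \<Omega> (Suc (Suc m)) \<alpha> v"
      using v by (simp add: holder_space_def)
    ultimately show ?thesis
      using trace_mult_symmetric[OF hess_symmetric[OF assms(1) _ x]]
      by (simp add: lin_op_def mult.commute)
  qed
  moreover have "v x = h x" if x: "x \<in> frontier \<Omega>" for x
  proof -
    have "x \<in> closure \<Omega>"
      using x by (simp add: frontier_def)
    then have 1: "((\<lambda>t. u t x) has_real_derivative v x) (at 0)"
      by (rule der0)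
    have ev: "\<forall>\<^sub>F t in nhds 0. u t x = \<phi> x + t * h x"
      using MA by eventually_elim (use x in \<open>simp add: MA_solution_def\<close>)
    have "((\<lambda>t. \<phi> x + t * h x) has_real_derivative h x) (at 0)"
      by (auto intro!: derivative_eq_intros)
    then have "((\<lambda>t. u t x) has_real_derivative h x) (at 0)"
      using DERIV_cong_ev[OF refl ev refl] by blast
    then show ?thesis
      using DERIV_unique 1 by blast
  qed
  ultimately show ?thesis
    using v by (simp add: lin_solution_def)
qed

text \<open>At a frontier point evaluation is bounded by \<open>bdry_norm\<close>, so a velocity is
  the pointwise derivative of the curve; elsewhere elements of the space vanish.\<close>

lemma velocity_unique:
  assumes "open U" "U \<noteq> {}"
    and w: "has_velocity (bdry_space U k \<alpha>) (bdry_norm U k \<alpha>) \<gamma> w"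
    and w': "has_velocity (bdry_space U k \<alpha>) (bdry_norm U k \<alpha>) \<gamma> w'"
  shows "w = w'"
proof
  fix x
  have D: "((\<lambda>t. \<gamma> t x) has_real_derivative w x) (at 0)"
    if x: "x \<in> frontier U" and w: "has_velocity (bdry_space U k \<alpha>) (bdry_norm U k \<alpha>) \<gamma> w" for w
  proof -
    define R where "R t = (\<lambda>x. \<gamma> t x - \<gamma> 0 x - t * w x)" for t
    have R: "\<forall>\<^sub>F t in at 0. R t \<in> bdry_space U k \<alpha>" "((\<lambda>t. bdry_norm U k \<alpha> (R t) / \<bar>t\<bar>) \<longlongrightarrow> 0) (at 0)"
      using w unfolding has_velocity_def little_o_t_def R_def by auto
    have "\<forall>\<^sub>F t in at 0. norm ((\<gamma> (0 + t) x - \<gamma> 0 x) / t - w x) \<le> bdry_norm U k \<alpha> (R t) / \<bar>t\<bar>"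
      using R(1) eventually_at_ball'[OF zero_less_one, of 0 UNIV]
    proof eventually_elim
      case (elim t)
      then have "(\<gamma> (0 + t) x - \<gamma> 0 x) / t - w x = R t x / t"
        by (simp add: R_def field_simps)
      then show ?case
        using abs_le_bdry_norm[OF assms(1,2) elim(1) x] by (simp add: divide_right_mono)
    qed
    then have "((\<lambda>t. (\<gamma> (0 + t) x - \<gamma> 0 x) / t - w x) \<longlongrightarrow> 0) (at 0)"
      by (rule Lim_null_comparison[OF _ R(2)])
    then show ?thesis
      unfolding DERIV_def by (rule LIM_zero_cancel)
  qed
  show "w x = w' x"
  proof (cases "x \<in> frontier U")
    case True
    then show ?thesis
      using DERIV_unique[OF D D] w w' by blast
  next
    case False
    then show ?thesis
      using w w' by (simp add: has_velocity_def bdry_space_def)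
  qed
qed


section \<open>The first variation\<close>

lemma eventually_line_in_bdry_ball:
  assumes "open U" "U \<noteq> {}" "\<phi> \<in> bdry_space U k \<alpha>" "h \<in> bdry_space U k \<alpha>" "0 < \<delta>"
  shows "\<forall>\<^sub>F t in nhds 0. (\<lambda>x. \<phi> x + t * h x) \<in> bdry_ball U k \<alpha> \<phi> \<delta>"
proof -
  have "((\<lambda>t. real (k + 2) * \<bar>t\<bar> * bdry_norm U k \<alpha> h) \<longlongrightarrow> real (k + 2) * \<bar>0\<bar> * bdry_norm U k \<alpha> h) (nhds 0)"
    by (intro tendsto_intros filterlim_ident)
  then have "\<forall>\<^sub>F t in nhds 0. real (k + 2) * \<bar>t\<bar> * bdry_norm U k \<alpha> h < \<delta>"
    using assms(5) order_tendstoD(2) by fastforce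
  then show ?thesis
  proof eventually_elim
    case (elim t)
    have "(\<lambda>x. \<phi> x + t * h x) \<in> bdry_space U k \<alpha>"
      by (rule bdry_space_linear[OF assms(1,3,4)])
    moreover have "bdry_norm U k \<alpha> (\<lambda>x. \<phi> x + t * h x - \<phi> x) < \<delta>"
      using bdry_norm_scale[OF assms(1,2,4), of t] elim by simp
    ultimately show ?case
      unfolding bdry_ball_def by simp
  qed
qed

text \<open>Additivity and homogeneity are stated as one identity for \<open>f + c g\<close>. Both
  functions zero with \<open>c = 1\<close> gives value zero at zero; then \<open>f = 0\<close>
  isolates the scaling.\<close>

lemma bounded_multilinear_1_scale:
  assumes "open U" "bounded_multilinear 1 (bdry_space U k \<alpha>) nX Y nY T" "h \<in> bdry_space U k \<alpha>"
  shows "T [\<lambda>x. t * h x] = (\<lambda>y. t * T [h] y)"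
proof -
  have z: "(\<lambda>_. 0) \<in> bdry_space U k \<alpha>"
    by (rule bdry_space_zero[OF assms(1)])
  have "\<forall>hs i f g c. set hs \<subseteq> bdry_space U k \<alpha> \<and> length hs = 1 \<and> i < 1 \<and>
      f \<in> bdry_space U k \<alpha> \<and> g \<in> bdry_space U k \<alpha> \<longrightarrow>
      T (hs[i := (\<lambda>x. f x + c * g x)]) = (\<lambda>y. T (hs[i := f]) y + c * T (hs[i := g]) y)"
    using assms(2) unfolding bounded_multilinear_def by blast
  from this[rule_format, of "[\<lambda>_. 0]" 0 "\<lambda>_. 0"] z
  have *: "T [\<lambda>x. 0 + c * g x] = (\<lambda>y. T [\<lambda>_. 0] y + c * T [g] y)" if "g \<in> bdry_space U k \<alpha>" for g c
    using that by simp
  have "T [\<lambda>_. 0] = (\<lambda>y. T [\<lambda>_. 0] y + 1 * T [\<lambda>_. 0] y)"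
    using *[OF z, of 1] by simp
  then have "T [\<lambda>_. 0] y = 0" for y
    by (metis add_cancel_left_right mult_1)
  then show ?thesis
    using *[OF assms(3), of t] by simp
qed

text \<open>The case \<open>j = 0\<close> of the differentiability clause, for increments
  \<open>t h\<close>. Their norm is at most \<open>N * \<bar>t\<bar>\<close>, so the Frechet
  remainder is o(t).\<close>

lemma frechet_class_directional:
  fixes nX :: "('a::euclidean_space \<Rightarrow> real) \<Rightarrow> real"
  assumes "open U" "U \<noteq> {}" "\<phi> \<in> bdry_space U k \<alpha>" "h \<in> bdry_space U k \<alpha>" "0 < \<delta>"
    and S: "frechet_class (Suc n) (bdry_space U k \<alpha>) (bdry_norm U k \<alpha>) (holder_space U k \<alpha>) (holder_norm U k \<alpha>)
      (bdry_ball U k \<alpha> \<phi> \<delta>) S"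
  obtains v where "v \<in> holder_space U k \<alpha>"
    "little_o_t (holder_space U k \<alpha>) (holder_norm U k \<alpha>) (\<lambda>t x. S (\<lambda>y. \<phi> y + t * h y) x - S \<phi> x - t * v x)"
proof -
  let ?X = "bdry_space U k \<alpha>" and ?nX = "bdry_norm U k \<alpha>"
  let ?Y = "holder_space U k \<alpha>" and ?nY = "holder_norm U k \<alpha>"
  let ?W = "bdry_ball U k \<alpha> \<phi> \<delta>"
  obtain D where D0: "\<forall>\<eta>\<in>?W. D \<eta> [] = S \<eta>"
    and ml: "\<forall>j\<le>Suc n. \<forall>\<eta>\<in>?W. bounded_multilinear j ?X ?nX ?Y ?nY (D \<eta>)"
    and diff: "\<forall>j<Suc n. \<forall>\<eta>\<in>?W. \<forall>\<epsilon>>0. \<exists>d>0. \<forall>h\<in>?X. ?nX h < d \<and> (\<lambda>x. \<eta> x + h x) \<in> ?W \<longrightarrow>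
           (\<forall>hs. set hs \<subseteq> ?X \<and> length hs = j \<longrightarrow>
              ?nY (\<lambda>y. D (\<lambda>x. \<eta> x + h x) hs y - D \<eta> hs y - D \<eta> (h # hs) y)
                \<le> \<epsilon> * ?nX h * prod_list (map ?nX hs))"
    using S unfolding frechet_class_def by blast
  have line: "\<forall>\<^sub>F t in nhds 0. (\<lambda>x. \<phi> x + t * h x) \<in> ?W"
    by (rule eventually_line_in_bdry_ball[OF assms(1-5)])
  then have \<phi>: "\<phi> \<in> ?W"
    using eventually_nhds_x_imp_x by fastforce
  define v where "v = D \<phi> [h]"
  have ml1: "bounded_multilinear 1 ?X ?nX ?Y ?nY (D \<phi>)"
    using ml \<phi> by simp
  then have v: "v \<in> ?Y"
    unfolding bounded_multilinear_def v_def using assms(4) by simp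
  have SY: "S \<eta> \<in> ?Y" if "\<eta> \<in> ?W" for \<eta>
    using ml[rule_format, of 0 \<eta>] D0 that unfolding bounded_multilinear_def by simp
  define R where "R t = (\<lambda>x. S (\<lambda>y. \<phi> y + t * h y) x - S \<phi> x - t * v x)" for t
  have RY: "R t \<in> ?Y" if "(\<lambda>x. \<phi> x + t * h x) \<in> ?W" for t
  proof -
    have "(\<lambda>x. (S (\<lambda>y. \<phi> y + t * h y) x + (- 1) * S \<phi> x) + (- t) * v x) \<in> ?Y"
      by (intro holder_space_linear assms(1) SY that \<phi> v)
    then show ?thesis
      by (simp add: R_def)
  qed
  have th: "(\<lambda>x. t * h x) \<in> ?X" for t
    using bdry_space_linear[OF assms(1) bdry_space_zero[OF assms(1)] assms(4), of t] by simp
  define N where "N = real (k + 2) * ?nX h"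
  have N: "0 \<le> N"
    using bdry_norm_nonneg[OF assms(1,2,4)] by (simp add: N_def)
  have scale: "?nX (\<lambda>x. t * h x) \<le> N * \<bar>t\<bar>" for t
    using bdry_norm_scale[OF assms(1,2,4), of t] by (simp add: N_def algebra_simps)
  have "((\<lambda>t. ?nY (R t) / \<bar>t\<bar>) \<longlongrightarrow> 0) (at 0)"
  proof (rule tendstoI)
    fix e :: real assume e: "0 < e"
    \<comment> \<open>\<open>N\<close> may be zero; adding one keeps the quotient meaningful and
      still gives \<open>\<epsilon> * N < e\<close>.\<close>
    define \<epsilon> where "\<epsilon> = e / (2 * (N + 1))"
    have \<epsilon>: "0 < \<epsilon>" "\<epsilon> * N < e"
      using e N by (auto simp: \<epsilon>_def field_simps add_strict_increasing)
    obtain d where d: "d > 0" "\<And>h. h \<in> ?X \<Longrightarrow> ?nX h < d \<Longrightarrow> (\<lambda>x. \<phi> x + h x) \<in> ?W \<Longrightarrow>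
        ?nY (\<lambda>y. D (\<lambda>x. \<phi> x + h x) [] y - D \<phi> [] y - D \<phi> [h] y) \<le> \<epsilon> * ?nX h"
      using diff[rule_format, of 0 \<phi> \<epsilon>] \<phi> \<epsilon>(1) by auto
    have "((\<lambda>t. N * \<bar>t\<bar>) \<longlongrightarrow> N * \<bar>0\<bar>) (nhds 0)"
      by (intro tendsto_intros filterlim_ident)
    then have "\<forall>\<^sub>F t in nhds 0. N * \<bar>t\<bar> < d"
      using d(1) order_tendstoD(2) by fastforce
    then have "\<forall>\<^sub>F t in nhds 0. t \<noteq> 0 \<longrightarrow> dist (?nY (R t) / \<bar>t\<bar>) 0 < e"
      using line
    proof eventually_elim
      case (elim t)
      have "?nX (\<lambda>x. t * h x) < d"
        using elim(1) scale[of t] by linarith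
      from d(2)[OF th this elim(2)]
      have "?nY (R t) \<le> \<epsilon> * ?nX (\<lambda>x. t * h x)"
        using elim(2) \<phi> D0 by (simp add: R_def v_def bounded_multilinear_1_scale[OF assms(1) ml1 assms(4)])
      also have "\<dots> \<le> \<epsilon> * (N * \<bar>t\<bar>)"
        using scale \<epsilon>(1) by (intro mult_left_mono) auto
      finally have le: "?nY (R t) \<le> \<epsilon> * N * \<bar>t\<bar>"
        by simp
      have "0 \<le> ?nY (R t)"
        using holder_norm_nonneg[OF assms(1,2)] RY[OF elim(2)] by (simp add: holder_space_def)
      show ?case
      proof
        assume "t \<noteq> 0"
        then have "?nY (R t) / \<bar>t\<bar> \<le> \<epsilon> * N"
          using le by (simp add: field_simps)
        then show "dist (?nY (R t) / \<bar>t\<bar>) 0 < e"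
          using \<epsilon>(2) \<open>0 \<le> ?nY (R t)\<close> by simp
      qed
    qed
    then show "\<forall>\<^sub>F t in at 0. dist (?nY (R t) / \<bar>t\<bar>) 0 < e"
      by (simp add: eventually_at_filter)
  qed
  moreover have "\<forall>\<^sub>F t in nhds 0. R t \<in> ?Y"
    using line by eventually_elim (rule RY)
  then have "\<forall>\<^sub>F t in at 0. R t \<in> ?Y"
    by (simp add: eventually_at_filter eventually_mono)
  ultimately have "little_o_t ?Y ?nY (\<lambda>t x. S (\<lambda>y. \<phi> y + t * h y) x - S \<phi> x - t * v x)"
    unfolding little_o_t_def R_def by blast
  then show ?thesis
    using that v by blast
qed

lemma normal_deriv_linear:
  fixes \<Omega> :: "(real^'n) set"
  assumes "open \<Omega>" "f \<in> holder_space \<Omega> (Suc k) \<alpha>" "g \<in> holder_space \<Omega> (Suc k) \<alpha>"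
  shows "normal_deriv \<Omega> (\<lambda>x. f x + c * g x) = (\<lambda>x. normal_deriv \<Omega> f x + c * normal_deriv \<Omega> g x)"
proof
  fix x
  have fg: "holder_on \<Omega> (Suc k) \<alpha> f" "holder_on \<Omega> (Suc k) \<alpha> g"
    using assms(2,3) by (auto simp: holder_space_def)
  have "grad \<Omega> (\<lambda>x. f x + c * g x) x = grad \<Omega> f x + c *\<^sub>R grad \<Omega> g x" if "x \<in> frontier \<Omega>"
    using that by (intro grad_linear[OF assms(1) fg]) (simp add: frontier_def)
  then show "normal_deriv \<Omega> (\<lambda>x. f x + c * g x) x = normal_deriv \<Omega> f x + c * normal_deriv \<Omega> g x"
    by (simp add: normal_deriv_def inner_add_right)
qed

theorem proposition3p2:
  fixes \<Omega> :: "(real^'n) set" and m :: nat and \<alpha> c0 \<delta> :: real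
    and a :: "(real^'n) \<times> real \<times> (real^'n) \<Rightarrow> real"
    and \<phi> \<Phi> :: "real^'n \<Rightarrow> real"
    and V :: "(real^'n \<Rightarrow> real) set"
  assumes "open \<Omega>" "connected \<Omega>" "\<Omega> \<noteq> {}" "bounded \<Omega>"
    and "0 < \<alpha>" "\<alpha> < 1"
    and "holder_boundary \<Omega> (m + 2) \<alpha>"
    and "\<phi> \<in> bdry_space \<Omega> (m + 2) \<alpha>"
    and "holder_on (jets \<Omega>) (2 * m + 1) \<alpha> a"
    and "\<forall>x\<in>closure \<Omega>. \<forall>z p. a (x, z, p) > 0"
    and "MA_solution \<Omega> m \<alpha> a \<phi> \<Phi>"
    and "strictly_convex_fun \<Omega> \<Phi>"
    and "c0 > 0" "\<forall>x\<in>closure \<Omega>. \<forall>\<xi>. \<xi> \<bullet> (hess \<Omega> \<Phi> x *v \<xi>) \<ge> c0 * (\<xi> \<bullet> \<xi>)"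
    and "\<forall>x\<in>\<Omega>. q_coeff \<Omega> a \<Phi> x \<ge> 0"
    and "locally_well_posed \<Omega> m \<alpha> a \<phi> \<Phi> \<delta> V"
  shows "(\<forall>h\<in>bdry_space \<Omega> (m + 2) \<alpha>.
            (\<exists>!v. lin_solution \<Omega> m \<alpha> a \<Phi> h v) \<and>
            little_o_t (holder_space \<Omega> (m + 2) \<alpha>) (holder_norm \<Omega> (m + 2) \<alpha>)
              (\<lambda>t x. sol \<Omega> m \<alpha> a V (\<lambda>y. \<phi> y + t * h y) x - \<Phi> x - t * lin_sol \<Omega> m \<alpha> a \<Phi> h x) \<and>
            little_o_t (bdry_space \<Omega> (m + 1) \<alpha>) (bdry_norm \<Omega> (m + 1) \<alpha>)
              (\<lambda>t x. normal_deriv \<Omega> (sol \<Omega> m \<alpha> a V (\<lambda>y. \<phi> y + t * h y)) x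
                     - normal_deriv \<Omega> \<Phi> x - t * normal_deriv \<Omega> (lin_sol \<Omega> m \<alpha> a \<Phi> h) x))
       \<and> first_variation \<Omega> m \<alpha> a \<phi> \<delta> V = lin_cauchy_data \<Omega> m \<alpha> a \<Phi>
       \<and> lin_cauchy_data \<Omega> m \<alpha> a \<Phi> \<subseteq> bdry_space \<Omega> (m + 2) \<alpha> \<times> bdry_space \<Omega> (m + 1) \<alpha>"
proof -
  let ?X = "bdry_space \<Omega> (m + 2) \<alpha>" and ?nX = "bdry_norm \<Omega> (m + 2) \<alpha>"
  let ?Y = "holder_space \<Omega> (m + 2) \<alpha>" and ?nY = "holder_norm \<Omega> (m + 2) \<alpha>"
  let ?Z = "bdry_space \<Omega> (m + 1) \<alpha>" and ?nZ = "bdry_norm \<Omega> (m + 1) \<alpha>"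
  let ?u = "sol \<Omega> m \<alpha> a V" and ?v = "lin_sol \<Omega> m \<alpha> a \<Phi>"
  note \<Omega> = assms(1,3)
  have a: "holder_on (jets \<Omega>) (Suc (2 * m)) \<alpha> a"
    using assms(9) by simp
  have \<Phi>: "\<Phi> \<in> ?Y"
    using assms(11) by (simp add: MA_solution_def)
  obtain \<delta>' where \<delta>: "\<delta> > 0" and VY: "V \<subseteq> ?Y"
    and ex1: "\<And>\<eta>. \<eta> \<in> bdry_ball \<Omega> (m + 2) \<alpha> \<phi> \<delta> \<Longrightarrow> \<exists>!u. u \<in> V \<and> MA_solution \<Omega> m \<alpha> a \<eta> u"
    and \<delta>': "\<delta>' > 0"
    and fc: "frechet_class (Suc m) ?X ?nX ?Y ?nY (bdry_ball \<Omega> (m + 2) \<alpha> \<phi> \<delta>') ?u"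
    and u\<phi>: "?u \<phi> = \<Phi>"
    using assms(16) unfolding locally_well_posed_def by auto
  have sol: "?u \<eta> \<in> V \<and> MA_solution \<Omega> m \<alpha> a \<eta> (?u \<eta>)" if "\<eta> \<in> bdry_ball \<Omega> (m + 2) \<alpha> \<phi> \<delta>" for \<eta>
    unfolding sol_def by (rule theI'[OF ex1[OF that]])
  have uniq: "v = w" if "lin_solution \<Omega> m \<alpha> a \<Phi> h v" "lin_solution \<Omega> m \<alpha> a \<Phi> h w" for h v w
    by (rule lin_solution_unique[OF assms(1,3,4) a \<Phi> assms(13,14,15) that])
  have main: "lin_solution \<Omega> m \<alpha> a \<Phi> h (?v h) \<and>
      little_o_t ?Y ?nY (\<lambda>t x. ?u (\<lambda>y. \<phi> y + t * h y) x - \<Phi> x - t * ?v h x)" if h: "h \<in> ?X" for h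
  proof -
    obtain v where v: "v \<in> ?Y" and o: "little_o_t ?Y ?nY (\<lambda>t x. ?u (\<lambda>y. \<phi> y + t * h y) x - \<Phi> x - t * v x)"
      using frechet_class_directional[OF \<Omega> assms(8) h \<delta>' fc] unfolding u\<phi> by blast
    \<comment> \<open>Unique solvability, which gives \<open>sol\<close> its meaning, holds on the
      ball of radius \<delta>; differentiability was used on the possibly smaller one of radius
      \<delta>'.\<close>
    have "\<forall>\<^sub>F t in nhds 0. MA_solution \<Omega> m \<alpha> a (\<lambda>x. \<phi> x + t * h x) (?u (\<lambda>y. \<phi> y + t * h y))"
      using eventually_line_in_bdry_ball[OF \<Omega> assms(8) h \<delta>] by eventually_elim (use sol in blast)
    then have lin: "lin_solution \<Omega> m \<alpha> a \<Phi> h v"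
      by (rule lin_solution_derivative[OF \<Omega> a \<Phi> v o, rotated]) (simp add: u\<phi>)
    then have "?v h = v"
      unfolding lin_sol_def using uniq by blast
    then show ?thesis
      using lin o by simp
  qed
  obtain C where nd: "\<And>u. u \<in> ?Y \<Longrightarrow> normal_deriv \<Omega> u \<in> ?Z"
    "\<And>u. u \<in> ?Y \<Longrightarrow> ?nZ (normal_deriv \<Omega> u) \<le> C * ?nY u"
  proof -
    have "holder_boundary \<Omega> (Suc (m + 1)) \<alpha>"
      using assms(7) by simp
    then show ?thesis
      by (rule normal_deriv_bounded[OF _ assms(1,3,4,5,6)]) (rule that, simp_all)
  qed
  have vY: "?v h \<in> ?Y" if "h \<in> ?X" for h
    using main[OF that] by (simp add: lin_solution_def)
  have main': "little_o_t ?Z ?nZ (\<lambda>t x. normal_deriv \<Omega> (?u (\<lambda>y. \<phi> y + t * h y)) x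
      - normal_deriv \<Omega> \<Phi> x - t * normal_deriv \<Omega> (?v h) x)" if h: "h \<in> ?X" for h
  proof -
    define R where "R t = (\<lambda>x. ?u (\<lambda>y. \<phi> y + t * h y) x - \<Phi> x - t * ?v h x)" for t
    have R: "\<forall>\<^sub>F t in at 0. R t \<in> ?Y" "((\<lambda>t. ?nY (R t) / \<bar>t\<bar>) \<longlongrightarrow> 0) (at 0)"
      using main[OF h] unfolding little_o_t_def R_def by auto
    define Q where "Q t = (\<lambda>x. normal_deriv \<Omega> (?u (\<lambda>y. \<phi> y + t * h y)) x
      - normal_deriv \<Omega> \<Phi> x - t * normal_deriv \<Omega> (?v h) x)" for t
    \<comment> \<open>Linearity of the normal derivative holds for members of the space, and the
      remainder is known to be one only for \<open>t\<close> near zero.\<close>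
    have Q: "\<forall>\<^sub>F t in at 0. Q t = normal_deriv \<Omega> (R t)"
      using R(1)
    proof eventually_elim
      case (elim t)
      have w: "(\<lambda>x. \<Phi> x + t * ?v h x) \<in> ?Y"
        by (rule holder_space_linear[OF assms(1) \<Phi> vY[OF h]])
      have "?u (\<lambda>y. \<phi> y + t * h y) = (\<lambda>x. R t x + 1 * (\<Phi> x + t * ?v h x))"
        by (auto simp: R_def)
      then have "normal_deriv \<Omega> (?u (\<lambda>y. \<phi> y + t * h y))
          = (\<lambda>x. normal_deriv \<Omega> (R t) x + 1 * (normal_deriv \<Omega> \<Phi> x + t * normal_deriv \<Omega> (?v h) x))"
        using normal_deriv_linear[of \<Omega> "R t" "m + 1" \<alpha> "\<lambda>x. \<Phi> x + t * ?v h x" 1]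
          normal_deriv_linear[of \<Omega> \<Phi> "m + 1" \<alpha> "?v h" t] assms(1) elim w \<Phi> vY[OF h]
        by simp
      then show ?case
        by (auto simp: Q_def)
    qed
    have "\<forall>\<^sub>F t in at 0. Q t \<in> ?Z"
      using Q R(1) by eventually_elim (use nd(1) in simp)
    moreover have "((\<lambda>t. ?nZ (Q t) / \<bar>t\<bar>) \<longlongrightarrow> 0) (at 0)"
    proof (rule Lim_null_comparison)
      show "\<forall>\<^sub>F t in at 0. norm (?nZ (Q t) / \<bar>t\<bar>) \<le> C * (?nY (R t) / \<bar>t\<bar>)"
        using Q R(1)
      proof eventually_elim
        case (elim t)
        have "0 \<le> ?nZ (Q t)"
          using bdry_norm_nonneg[OF \<Omega>] nd(1)[OF elim(2)] elim(1) by simp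
        then show ?case
          using divide_right_mono[OF nd(2)[OF elim(2)], of "\<bar>t\<bar>"] elim(1) by simp
      qed
      show "((\<lambda>t. C * (?nY (R t) / \<bar>t\<bar>)) \<longlongrightarrow> 0) (at 0)"
        by (rule tendsto_mult_right_zero[OF R(2)])
    qed
    ultimately show ?thesis
      unfolding little_o_t_def Q_def by blast
  qed
  have vel1: "has_velocity ?X ?nX (\<lambda>t x. \<phi> x + t * h x) h" if h: "h \<in> ?X" for h
  proof -
    have "(\<lambda>_. 0) \<in> ?X"
      by (rule bdry_space_zero[OF assms(1)])
    \<comment> \<open>The remainder of an affine curve is the zero function, whose quotient norm
      vanishes by scaling \<open>h\<close> with zero.\<close>
    moreover have "?nX (\<lambda>_. 0) = 0"
      using bdry_norm_scale[OF \<Omega> h, of 0] bdry_norm_nonneg[OF \<Omega> calculation] by simp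
    ultimately show ?thesis
      using h by (simp add: has_velocity_def little_o_t_def)
  qed
  have vel2: "has_velocity ?Z ?nZ (\<lambda>t. normal_deriv \<Omega> (?u (\<lambda>x. \<phi> x + t * h x))) (normal_deriv \<Omega> (?v h))"
    if h: "h \<in> ?X" for h
    using main'[OF h] nd(1)[OF vY[OF h]] by (simp add: has_velocity_def u\<phi>)
  have "first_variation \<Omega> m \<alpha> a \<phi> \<delta> V = lin_cauchy_data \<Omega> m \<alpha> a \<Phi>"
  proof (intro equalityI subsetI)
    fix p assume "p \<in> first_variation \<Omega> m \<alpha> a \<phi> \<delta> V"
    then obtain h w z where p: "p = (w, z)" and h: "h \<in> ?X"
      and w: "has_velocity ?X ?nX (\<lambda>t x. \<phi> x + t * h x) w"
      and z: "has_velocity ?Z ?nZ (\<lambda>t. normal_deriv \<Omega> (?u (\<lambda>x. \<phi> x + t * h x))) z"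
      unfolding first_variation_def Let_def by blast
    \<comment> \<open>Both components of the curve already have known velocities, so uniqueness pins
      down the pair.\<close>
    have "w = h" "z = normal_deriv \<Omega> (?v h)"
      using velocity_unique[OF \<Omega> w vel1[OF h]] velocity_unique[OF \<Omega> z vel2[OF h]] by auto
    then show "p \<in> lin_cauchy_data \<Omega> m \<alpha> a \<Phi>"
      using p h unfolding lin_cauchy_data_def by blast
  next
    fix p assume "p \<in> lin_cauchy_data \<Omega> m \<alpha> a \<Phi>"
    then obtain h where p: "p = (h, normal_deriv \<Omega> (?v h))" and h: "h \<in> ?X"
      unfolding lin_cauchy_data_def by blast
    have "\<forall>\<^sub>F t in nhds 0. ((\<lambda>x. \<phi> x + t * h x), normal_deriv \<Omega> (?u (\<lambda>x. \<phi> x + t * h x)))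
        \<in> cauchy_data \<Omega> m \<alpha> a \<phi> \<delta> V"
      using eventually_line_in_bdry_ball[OF \<Omega> assms(8) h \<delta>]
      by eventually_elim (auto simp: cauchy_data_def)
    then show "p \<in> first_variation \<Omega> m \<alpha> a \<phi> \<delta> V"
      unfolding first_variation_def Let_def p using h vel1[OF h] vel2[OF h] by blast
  qed
  moreover have "lin_cauchy_data \<Omega> m \<alpha> a \<Phi> \<subseteq> ?X \<times> ?Z"
    unfolding lin_cauchy_data_def using nd(1) vY by blast
  moreover have "\<exists>!v. lin_solution \<Omega> m \<alpha> a \<Phi> h v" if "h \<in> ?X" for h
    using main[OF that] uniq by blast
  ultimately show ?thesis
    using main main' by blast
qed

end
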